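(* ${}^1\mathsf{OG\mapsto\alpha}\equiv_{\mathsf{W}}\mathsf{LPO}^{\ast}$, where ${}^1\mathsf{OG\mapsto\alpha}$ is the first-order part of the problem $\mathsf{OG\mapsto\alpha}$ which, given a countable ordered group $(G,\leq)$, outputs a copy of the well-order $\alpha$ such that the order type of $G$ is $\mathbb{Z}^{\alpha}\mathbb{Q}^{\epsilon}$ for some $\epsilon\in\{0,1\}$.
   Context: Weihrauch reducibility: a represented space is a set $X$ with a partial surjection $\delta_X:\subseteq\mathbb{N}^{\mathbb{N}}\to X$; if $\delta_X(p)=x$, $p$ is a name of $x$. A problem is a partial multi-valued function between represented spaces. $f\leq_{\mathsf{W}}g$ iff there are computable partial functions $\Phi,\Psi$ on Baire space such that whenever $p$ is a name of some $x\in\mathrm{dom}(f)$, $\Phi(p)$ is a name of some $z\in\mathrm{dom}(g)$, and for every name $q$ of an element of $g(z)$, $\Psi(p,q)$ is a name of an element of $f(x)$. $f\equiv_{\mathsf{W}}g$ means $f\leq_{\mathsf{W}}g$ and $g\leq_{\mathsf{W}}f$. First-order part: a problem $\mathsf{Q}$ is first-order if its outputs are natural numbers. The first-order part ${}^1\mathsf{P}$ of a problem $\mathsf{P}$ is (up to $\equiv_{\mathsf{W}}$) $\max_{\leq_{\mathsf{W}}}\{\mathsf{Q}\text{ first-order}:\mathsf{Q}\leq_{\mathsf{W}}\mathsf{P}\}$. It exists and is realized by the problem whose instances are triples $\langle f,\Phi,\Psi\rangle$ with $f\in\mathbb{N}^{\mathbb{N}}$ and $\Phi,\Psi$ Turing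 functionals such that $\Phi(f)\in\mathrm{dom}(\mathsf{P})$ and $\Psi^{f\oplus g}(0)\downarrow$ for all $g\in\mathsf{P}(\Phi(f))$, and whose solutions are all $y$ with $\Psi^{f\oplus g}(0)\downarrow=y$ for some $g\in\mathsf{P}(\Phi(f))$. Ordered groups: an ordered group is a group $G$ with a linear order $\leq$ such that $a\leq b$ implies $ag\leq bg$ and $ga\leq gb$ for all $g$. Countable ordered groups are presented on subsets of $\mathbb{N}$, a name coding the universe, operation and order. The order type of $G$ is a linear order $X$ such that there is an order-preserving bijection $G\to X$. For linear orders $X,Y$, the product $XY$ is $X\times Y$ with $\langle x_0,y_0\rangle<\langle x_1,y_1\rangle$ iff $y_0<y_1$, or $y_0=y_1$ and $x_0<x_1$. $\mathbb{Z}^X$ is the set of finitely supported functions $X\to\mathbb{Z}$, where for $f\neq g$, $f<g$ iff $f(x)<g(x)$ at the maximum $x$ where they differ. $\mathbb{Z}^\alpha\mathbb{Q}^0=\mathbb{Z}^\alpha$ and $\mathbb{Z}^\alpha\mathbb{Q}^1=\mathbb{Z}^\alpha\mathbb{Q}$. By Maltsev's theorem every countable ordered group has order type $\mathbb{Z}^\alpha\mathbb{Q}^\epsilon$ for some ordinal $\alpha$ and $\epsilon\in\{0,1\}$. A copy of an ordinal $\alpha$ is a pair $(A,<_A)$ with $A\subseteq\mathbb{N}$, $<_A\subseteq A\times A$ a well-order of $A$ isomorphic to $\alpha$, coded in Baire space. $\mathsf{LPO}:\mathbb{N}^{\mathbb{N}}\to\{0,1\}$ is $\mathsf{LPO}(p)=0$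 if $p(n)=0$ for some $n$, and $1$ otherwise. The finite parallelization $h^{\ast}$ of a problem $h$ takes $(k,(x_0,\dots,x_{k-1}))$ with $k\in\mathbb{N}$ and all $x_i\in\mathrm{dom}(h)$, and outputs $(k,(y_0,\dots,y_{k-1}))$ with $y_i\in h(x_i)$. *)

theory Defs
  imports Complex_Main "HOL-Library.Nat_Bijection" "HOL-Library.FuncSet" "HOL-Algebra.Group"
begin

section \<open>Turing functionals\<close>

type_synonym baire = "nat \<Rightarrow> nat"

text \<open>
  Turing functionals are presented as the unary partial recursive functions relative to an oracle;
  pairs of arguments are coded by \<^const>\<open>prod_encode\<close>. The constructors are the zero function,
  successor, the two unpairing functions, the oracle, pairing, composition (outer functional
  first), primitive recursion and unbounded minimization.
\<close>

datatype tf =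
  Zero | Succ | Left | Right | Oracle
| Tuple tf tf | Comp tf tf | PrimRec tf tf | Mu tf

text \<open>\<open>evalt p c x y\<close>: the functional \<open>c\<close> with oracle \<open>p\<close> halts on input \<open>x\<close> with output \<open>y\<close>.\<close>

inductive evalt :: "baire \<Rightarrow> tf \<Rightarrow> nat \<Rightarrow> nat \<Rightarrow> bool" for p :: baire where
  zero: "evalt p Zero x 0"
| succ: "evalt p Succ x (Suc x)"
| left: "evalt p Left (prod_encode (x, y)) x"
| right: "evalt p Right (prod_encode (x, y)) y"
| query: "evalt p Oracle x (p x)"
| tuple: "evalt p c x y \<Longrightarrow> evalt p d x z \<Longrightarrow> evalt p (Tuple c d) x (prod_encode (y, z))"
| comp: "evalt p d x y \<Longrightarrow> evalt p c y z \<Longrightarrow> evalt p (Comp c d) x z"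
| primrec_0: "evalt p c x y \<Longrightarrow> evalt p (PrimRec c d) (prod_encode (x, 0)) y"
| primrec_Suc: "evalt p (PrimRec c d) (prod_encode (x, n)) y
    \<Longrightarrow> evalt p d (prod_encode (x, prod_encode (n, y))) z
    \<Longrightarrow> evalt p (PrimRec c d) (prod_encode (x, Suc n)) z"
| mu: "evalt p c (prod_encode (x, n)) 0
    \<Longrightarrow> (\<And>m. m < n \<Longrightarrow> \<exists>v>0. evalt p c (prod_encode (x, m)) v)
    \<Longrightarrow> evalt p (Mu c) x n"

inductive_cases evalt_zeroE: "evalt p Zero x y"
inductive_cases evalt_succE: "evalt p Succ x y"
inductive_cases evalt_leftE: "evalt p Left x y"
inductive_cases evalt_rightE: "evalt p Right x y"
inductive_cases evalt_oracleE: "evalt p Oracle x y"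
inductive_cases evalt_tupleE: "evalt p (Tuple c d) x y"
inductive_cases evalt_compE: "evalt p (Comp c d) x y"
inductive_cases evalt_primrecE: "evalt p (PrimRec c d) x y"
inductive_cases evalt_muE: "evalt p (Mu c) x y"

lemma evalt_functional: "evalt p c x y \<Longrightarrow> evalt p c x z \<Longrightarrow> y = z"
proof (induction arbitrary: z rule: evalt.induct)
  case zero then show ?case by (auto elim: evalt_zeroE)
next
  case succ then show ?case by (auto elim: evalt_succE)
next
  case left then show ?case by (auto elim: evalt_leftE)
next
  case right then show ?case by (auto elim: evalt_rightE)
next
  case query then show ?case by (auto elim: evalt_oracleE)
next
  case tuple then show ?case by (metis evalt_tupleE)
next
  case comp then show ?case by (metis evalt_compE)
next
  case (primrec_0 c x y d)
  show ?case by (rule evalt_primrecE[OF primrec_0.prems]) (auto dest: primrec_0.IH)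
next
  case (primrec_Suc c d x n y z')
  show ?case by (rule evalt_primrecE[OF primrec_Suc.prems]) (auto dest!: primrec_Suc.IH)
next
  case (mu c x n)
  show ?case
  proof (rule evalt_muE[OF mu.prems])
    assume z: "evalt p c (prod_encode (x, z)) 0"
      "\<And>m. m < z \<Longrightarrow> \<exists>v>0. evalt p c (prod_encode (x, m)) v"
    show ?thesis
    proof (rule linorder_cases[of n z])
      assume "n < z" then show ?thesis using z(2) mu.IH(1) by blast
    next
      assume "z < n" then show ?thesis using z(1) mu.IH(2) by blast
    qed
  qed
qed

text \<open>\<open>computes c p q\<close>: the functional \<open>c\<close>, applied to the point \<open>p\<close> of Baire space, yields \<open>q\<close>.\<close>

definition computes :: "tf \<Rightarrow> baire \<Rightarrow> baire \<Rightarrow> bool" where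
  "computes c p q \<longleftrightarrow> (\<forall>n. evalt p c n (q n))"

definition computable_baire :: "(baire \<Rightarrow> baire option) \<Rightarrow> bool" where
  "computable_baire F \<longleftrightarrow> (\<exists>c. \<forall>p q. F p = Some q \<longrightarrow> computes c p q)"

primrec tf_code :: "tf \<Rightarrow> nat" where
  "tf_code Zero = prod_encode (0, 0)"
| "tf_code Succ = prod_encode (1, 0)"
| "tf_code Left = prod_encode (2, 0)"
| "tf_code Right = prod_encode (3, 0)"
| "tf_code Oracle = prod_encode (4, 0)"
| "tf_code (Tuple c d) = prod_encode (5, prod_encode (tf_code c, tf_code d))"
| "tf_code (Comp c d) = prod_encode (6, prod_encode (tf_code c, tf_code d))"
| "tf_code (PrimRec c d) = prod_encode (7, prod_encode (tf_code c, tf_code d))"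
| "tf_code (Mu c) = prod_encode (8, tf_code c)"

lemma inj_tf_code: "inj tf_code"
proof (rule injI)
  fix c d show "tf_code c = tf_code d \<Longrightarrow> c = d"
  proof (induction c arbitrary: d)
    case Zero then show ?case by (cases d) simp_all
  next
    case Succ then show ?case by (cases d) simp_all
  next
    case Left then show ?case by (cases d) simp_all
  next
    case Right then show ?case by (cases d) simp_all
  next
    case Oracle then show ?case by (cases d) simp_all
  next
    case Tuple then show ?case by (cases d) simp_all
  next
    case Comp then show ?case by (cases d) simp_all
  next
    case PrimRec then show ?case by (cases d) simp_all
  next
    case Mu then show ?case by (cases d) simp_all
  qed
qed


section \<open>Represented spaces\<close>

text \<open>
  A representation is a partial function on Baire space; the represented space is its range,
  and \<open>p\<close> is a name of \<open>x\<close> iff \<open>\<delta> p = Some x\<close>.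
\<close>

type_synonym 'a rep = "baire \<Rightarrow> 'a option"

definition join :: "baire \<Rightarrow> baire \<Rightarrow> baire" (infixr "\<uplus>" 65) where
  "(p \<uplus> q) n = (if even n then p (n div 2) else q (n div 2))"

definition baire_rep :: "baire rep" where
  "baire_rep p = Some p"

definition nat_rep :: "nat rep" where
  "nat_rep p = Some (p 0)"

definition tf_rep :: "tf rep" where
  "tf_rep p = (if p 0 \<in> range tf_code then Some (inv_into UNIV tf_code (p 0)) else None)"

definition set_rep :: "nat set rep" where
  "set_rep p = Some {n. p n \<noteq> 0}"

definition rel_rep :: "nat rel rep" where
  "rel_rep p = Some {(x, y). p (prod_encode (x, y)) \<noteq> 0}"

definition prod_rep :: "'a rep \<Rightarrow> 'b rep \<Rightarrow> ('a \<times> 'b) rep" where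
  "prod_rep \<delta> \<epsilon> p =
     (case (\<delta> (\<lambda>n. p (2 * n)), \<epsilon> (\<lambda>n. p (2 * n + 1))) of
        (Some x, Some y) \<Rightarrow> Some (x, y)
      | _ \<Rightarrow> None)"

text \<open>Finite sequences: \<open>p 0\<close> is the length, followed by names of the entries.\<close>

definition list_rep :: "'a rep \<Rightarrow> 'a list rep" where
  "list_rep \<delta> p =
     (let ys = map (\<lambda>i. \<delta> (\<lambda>n. p (Suc (prod_encode (i, n))))) [0..<p 0]
      in if None \<in> set ys then None else Some (map the ys))"


section \<open>Problems and Weihrauch reducibility\<close>

text \<open>\<open>sol f x\<close> is the set of solutions; \<open>x\<close> is an instance iff it is nonempty.\<close>

record ('a, 'b) problem =
  in_rep :: "'a rep"
  out_rep :: "'b rep"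
  sol :: "'a \<Rightarrow> 'b set"

definition pdom :: "('a, 'b) problem \<Rightarrow> 'a set" where
  "pdom f = {x. sol f x \<noteq> {}}"

text \<open>As usual, a function of two arguments \<open>p\<close>, \<open>q\<close> from Baire space is applied to \<open>p \<uplus> q\<close>.\<close>

definition weihrauch_le :: "('a, 'b) problem \<Rightarrow> ('c, 'd) problem \<Rightarrow> bool" (infix "\<le>\<^sub>W" 50) where
  "f \<le>\<^sub>W g \<longleftrightarrow>
     (\<exists>\<Phi> \<Psi>. computable_baire \<Phi> \<and> computable_baire \<Psi> \<and>
        (\<forall>p x. in_rep f p = Some x \<and> x \<in> pdom f \<longrightarrow>
           (\<exists>r z. \<Phi> p = Some r \<and> in_rep g r = Some z \<and> z \<in> pdom g \<and>
              (\<forall>q y. out_rep g q = Some y \<and> y \<in> sol g z \<longrightarrow>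
                 (\<exists>s w. \<Psi> (p \<uplus> q) = Some s \<and> out_rep f s = Some w \<and> w \<in> sol f x)))))"

definition weihrauch_equiv :: "('a, 'b) problem \<Rightarrow> ('c, 'd) problem \<Rightarrow> bool" (infix "\<equiv>\<^sub>W" 50) where
  "f \<equiv>\<^sub>W g \<longleftrightarrow> f \<le>\<^sub>W g \<and> g \<le>\<^sub>W f"

definition sol_names :: "('a, 'b) problem \<Rightarrow> 'a \<Rightarrow> baire set" where
  "sol_names P x = {q. \<exists>y. out_rep P q = Some y \<and> y \<in> sol P x}"

text \<open>
  The first-order part, realized by the problem with instances \<open>(f, \<Phi>, \<Psi>)\<close>. The requirement
  that \<open>\<Phi>(f)\<close> be in the domain of \<open>P\<close> means that it is a name of an instance of \<open>P\<close>, and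
  \<open>g\<close> ranges over the names of the solutions of that instance.
\<close>

definition fop_instance :: "('a, 'b) problem \<Rightarrow> baire \<times> tf \<times> tf \<Rightarrow> 'a \<Rightarrow> bool" where
  "fop_instance P = (\<lambda>(f, \<Phi>, \<Psi>) x.
     (\<exists>r. computes \<Phi> f r \<and> in_rep P r = Some x) \<and> x \<in> pdom P \<and>
     (\<forall>g \<in> sol_names P x. \<exists>y. evalt (f \<uplus> g) \<Psi> 0 y))"

definition first_order_part :: "('a, 'b) problem \<Rightarrow> (baire \<times> tf \<times> tf, nat) problem" where
  "first_order_part P =
     \<lparr>in_rep = prod_rep baire_rep (prod_rep tf_rep tf_rep),
      out_rep = nat_rep,
      sol = (\<lambda>(f, \<Phi>, \<Psi>).
        {y. \<exists>x. fop_instance P (f, \<Phi>, \<Psi>) x \<and> (\<exists>g \<in> sol_names P x. evalt (f \<uplus> g) \<Psi> 0 y)})\<rparr>"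

text \<open>The pair of \<open>k\<close> and a \<open>k\<close>-tuple is a list of length \<open>k\<close>.\<close>

definition finite_parallelization :: "('a, 'b) problem \<Rightarrow> ('a list, 'b list) problem" where
  "finite_parallelization h =
     \<lparr>in_rep = list_rep (in_rep h),
      out_rep = list_rep (out_rep h),
      sol = (\<lambda>xs. {ys. list_all2 (\<lambda>x y. y \<in> sol h x) xs ys})\<rparr>"

definition LPO :: "(baire, nat) problem" where
  "LPO = \<lparr>in_rep = baire_rep, out_rep = nat_rep, sol = (\<lambda>p. {if \<exists>n. p n = 0 then 0 else 1})\<rparr>"


section \<open>Linear orders\<close>

text \<open>
  A linear order is given by its universe and its strict order relation. The universe is kept
  separately since the strict order on a one-element set is the empty relation.
\<close>

type_synonym 'a linord = "'a set \<times> 'a rel"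

definition linear_ord :: "'a linord \<Rightarrow> bool" where
  "linear_ord = (\<lambda>(A, R). R \<subseteq> A \<times> A \<and> strict_linear_order_on A R)"

definition well_ord :: "'a linord \<Rightarrow> bool" where
  "well_ord = (\<lambda>(A, R). linear_ord (A, R) \<and> wf R)"

definition ord_iso :: "'a linord \<Rightarrow> 'b linord \<Rightarrow> bool" where
  "ord_iso = (\<lambda>(A, R) (B, S).
     \<exists>h. bij_betw h A B \<and> (\<forall>x \<in> A. \<forall>y \<in> A. (x, y) \<in> R \<longleftrightarrow> (h x, h y) \<in> S))"

text \<open>In the product, the second component is the more significant one.\<close>

definition ord_prod :: "'a linord \<Rightarrow> 'b linord \<Rightarrow> ('a \<times> 'b) linord" where
  "ord_prod = (\<lambda>(A, R) (B, S).
     (A \<times> B,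
      {((x0, y0), (x1, y1)). x0 \<in> A \<and> x1 \<in> A \<and> y0 \<in> B \<and> y1 \<in> B \<and>
         ((y0, y1) \<in> S \<or> y0 = y1 \<and> (x0, x1) \<in> R)}))"

definition int_pow :: "'a linord \<Rightarrow> ('a \<Rightarrow> int) linord" where
  "int_pow = (\<lambda>(A, R).
     let F = {f. finite {x. f x \<noteq> 0} \<and> {x. f x \<noteq> 0} \<subseteq> A} in
     (F,
      {(f, g). f \<in> F \<and> g \<in> F \<and>
         (\<exists>x \<in> A. f x \<noteq> g x \<and> (\<forall>y \<in> A. f y \<noteq> g y \<and> y \<noteq> x \<longrightarrow> (y, x) \<in> R) \<and> f x < g x)}))"

definition rat_ord :: "rat linord" where
  "rat_ord = (UNIV, {(x, y). x < y})"


section \<open>Ordered groups\<close>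

definition ordered_group :: "('a, 'b) monoid_scheme \<Rightarrow> 'a rel \<Rightarrow> bool" where
  "ordered_group G L \<longleftrightarrow>
     group G \<and> L \<subseteq> carrier G \<times> carrier G \<and> linear_order_on (carrier G) L \<and>
     (\<forall>a \<in> carrier G. \<forall>b \<in> carrier G. \<forall>g \<in> carrier G. (a, b) \<in> L \<longrightarrow>
        (a \<otimes>\<^bsub>G\<^esub> g, b \<otimes>\<^bsub>G\<^esub> g) \<in> L \<and> (g \<otimes>\<^bsub>G\<^esub> a, g \<otimes>\<^bsub>G\<^esub> b) \<in> L)"

definition group_ord :: "('a, 'b) monoid_scheme \<Rightarrow> 'a rel \<Rightarrow> 'a linord" where
  "group_ord G L = (carrier G, L - Id)"

text \<open>
  A group on a subset of the natural numbers is determined by its universe and operation; the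
  neutral element is not part of a name. The operation is made \<^const>\<open>undefined\<close> off the universe
  so that the points of the represented space are the ordered groups themselves.
\<close>

definition mk_group :: "nat set \<Rightarrow> (nat \<Rightarrow> nat \<Rightarrow> nat) \<Rightarrow> nat monoid" where
  "mk_group A m =
     \<lparr>carrier = A, mult = (\<lambda>x\<in>A. \<lambda>y\<in>A. m x y),
      one = (THE e. e \<in> A \<and> (\<forall>x \<in> A. m e x = x \<and> m x e = x))\<rparr>"

definition og_rep :: "(nat monoid \<times> nat rel) rep" where
  "og_rep p =
     (case prod_rep set_rep (prod_rep baire_rep rel_rep) p of
        Some (A, m, L) \<Rightarrow>
          (let G = mk_group A (\<lambda>x y. m (prod_encode (x, y))) in
           if ordered_group G L then Some (G, L) else None)
      | None \<Rightarrow> None)"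

definition wo_rep :: "nat linord rep" where
  "wo_rep p =
     (case prod_rep set_rep rel_rep p of
        Some X \<Rightarrow> (if well_ord X then Some X else None)
      | None \<Rightarrow> None)"

text \<open>
  Solutions are the well-orders \<open>\<alpha>\<close> on subsets of the natural numbers such that the order type of
  the group is \<open>\<int>\<^sup>\<alpha>\<close> (the case \<open>\<epsilon> = 0\<close>) or \<open>\<int>\<^sup>\<alpha>\<rat>\<close> (the case \<open>\<epsilon> = 1\<close>).
\<close>

definition OG_to_ordinal :: "(nat monoid \<times> nat rel, nat linord) problem" where
  "OG_to_ordinal =
     \<lparr>in_rep = og_rep,
      out_rep = wo_rep,
      sol = (\<lambda>(G, L). {\<alpha>. ordered_group G L \<and> well_ord \<alpha> \<and>
        (ord_iso (group_ord G L) (int_pow \<alpha>) \<or>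
         ord_iso (group_ord G L) (ord_prod (int_pow \<alpha>) rat_ord))})\<rparr>"

end

theory Submission
  imports Defs "HOL-Library.Countable_Set"
begin

text \<open>
  A convergent computation \<open>\<Psi>\<close> sees only a finite part of a copy of \<open>\<alpha>\<close>, and a finite linear order with
  \<open>j\<close> elements extends to a copy of \<open>\<alpha>\<close>, beyond any given use, iff \<open>j \<le> |\<alpha>|\<close>. So if \<open>j\<close> is the least
  size of a finite linear order on which \<open>\<Psi>\<close> converges, then its value there is a solution, whatever the
  group is. The existence of a convergent order of size \<open>j\<close> is a single question to LPO, and the size
  of the first convergent order found bounds the number of questions.

  Conversely, given \<open>k\<close> sequences, order the indices of a free abelian group so that its order type is
  \<open>\<int>\<^sup>m\<rat>\<close>, where \<open>m\<close> is the number of sequences without a zero: start with \<open>k\<close> indices and put every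
  new index just above the \<open>m\<^sub>s\<close> lowest of them, where \<open>m\<^sub>s\<close> is the current guess. Above the \<open>m\<close> indices
  that survive there is no least one, so the quotient is dense. As \<open>m\<close> is approximated from above by the
  guesses and from below by any copy of \<open>\<alpha>\<close>, it is found by a search.
\<close>

section \<open>Computable functions with an oracle\<close>

text \<open>To become a single question to \<open>LPO\<close>, convergence of \<open>\<Psi>\<close>
  on some order of size \<open>j\<close> has to be decidable from a witness. No universal machine is
  built for this: a witness contains a finite set of evaluation facts, each justified by others in
  the set, and checking it takes bounded quantifiers only. In the converse direction the group is
  known, but the copy returned is arbitrary and either value of \<epsilon> may lie behind it. So the
  size of a finite \<alpha> must be an invariant of the bare order type. The invariant is the number
  of times that finite condensation can be iterated before it stabilizes: each step removes one
  factor \<int>, and neither a dense factor nor a single point can be condensed. Reading \<int> to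
  the power \<alpha> as its product with one point covers both values of \<epsilon> by one argument.
  The first-order problem returns a stage rather than \<open>m\<close>. The number of sequences seen
  to have a zero is at most \<open>k - m\<close>, the number of elements of \<alpha> seen is at most
  \<open>m\<close>, and the two add up to \<open>k\<close> only when both are final. By then every
  sequence that has a zero has shown one, and the answers follow by bounded search.\<close>

definition pfst :: "nat \<Rightarrow> nat" where "pfst z = fst (prod_decode z)"
definition psnd :: "nat \<Rightarrow> nat" where "psnd z = snd (prod_decode z)"

lemma pfst_pair [simp]: "pfst (prod_encode (x, y)) = x"
  and psnd_pair [simp]: "psnd (prod_encode (x, y)) = y"
  by (simp_all add: pfst_def psnd_def)

lemma pair_collapse [simp]: "prod_encode (pfst z, psnd z) = z"
  by (simp add: pfst_def psnd_def)

definition computable_on :: "baire set \<Rightarrow> (baire \<Rightarrow> nat \<Rightarrow> nat) \<Rightarrow> bool" where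
  "computable_on D F \<longleftrightarrow> (\<exists>c. \<forall>p\<in>D. \<forall>x. evalt p c x (F p x))"

definition decidable_on :: "baire set \<Rightarrow> (baire \<Rightarrow> nat \<Rightarrow> bool) \<Rightarrow> bool" where
  "decidable_on D P \<longleftrightarrow> computable_on D (\<lambda>p x. of_bool (P p x))"

named_theorems comp_intros

lemma computable_on_id [comp_intros]: "computable_on D (\<lambda>p x. x)"
proof -
  have "evalt p (Tuple Left Right) (prod_encode (pfst x, psnd x)) x" for p x
    by (metis evalt.left evalt.right evalt.tuple pair_collapse)
  then show ?thesis by (auto simp: computable_on_def)
qed

lemma computable_on_compose:
  assumes "computable_on D F" "computable_on D G"
  shows "computable_on D (\<lambda>p x. F p (G p x))"
  using assms unfolding computable_on_def by (meson evalt.comp)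

lemma computable_on_Suc [comp_intros]:
  "computable_on D F \<Longrightarrow> computable_on D (\<lambda>p x. Suc (F p x))"
  unfolding computable_on_def by (meson evalt.comp evalt.succ)

lemma computable_on_const [comp_intros]: "computable_on D (\<lambda>p x. n)"
proof (induction n)
  case 0
  then show ?case unfolding computable_on_def by (meson evalt.zero)
next
  case (Suc n)
  then show ?case by (rule computable_on_Suc)
qed

lemma computable_on_oracle [comp_intros]:
  "computable_on D F \<Longrightarrow> computable_on D (\<lambda>p x. p (F p x))"
  unfolding computable_on_def by (meson evalt.comp evalt.query)

lemma computable_on_pair [comp_intros]:
  "computable_on D F \<Longrightarrow> computable_on D G \<Longrightarrow> computable_on D (\<lambda>p x. prod_encode (F p x, G p x))"
  unfolding computable_on_def by (meson evalt.tuple)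

lemma computable_on_pfst [comp_intros]:
  assumes "computable_on D F" shows "computable_on D (\<lambda>p x. pfst (F p x))"
proof -
  have "evalt p Left z (pfst z)" for p z by (metis evalt.left pair_collapse)
  then show ?thesis using assms unfolding computable_on_def by (meson evalt.comp)
qed

lemma computable_on_psnd [comp_intros]:
  assumes "computable_on D F" shows "computable_on D (\<lambda>p x. psnd (F p x))"
proof -
  have "evalt p Right z (psnd z)" for p z by (metis evalt.right pair_collapse)
  then show ?thesis using assms unfolding computable_on_def by (meson evalt.comp)
qed

text \<open>Functionals are unary, so a function of two arguments becomes a function of the pair
  \<open>z\<close>. Rules with binders take their premises in this uncurried form.\<close>

lemma computable_on_compose2:
  assumes "computable_on D (\<lambda>p z. F p (pfst z) (psnd z))" "computable_on D G" "computable_on D H"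
  shows "computable_on D (\<lambda>p x. F p (G p x) (H p x))"
  using computable_on_compose[OF assms(1) computable_on_pair[OF assms(2,3)]] by simp

text \<open>\<open>PrimRec\<close> recurses on the second component and keeps the first as a
  parameter. Applied to the pair of \<open>x\<close> and \<open>N p x\<close>, it keeps
  \<open>x\<close> while the length of the recursion depends on \<open>x\<close> too.\<close>

lemma computable_on_rec [comp_intros]:
  assumes B: "computable_on D B"
    and H: "computable_on D (\<lambda>p z. H p (pfst z) (pfst (psnd z)) (psnd (psnd z)))"
    and N: "computable_on D N"
  shows "computable_on D (\<lambda>p x. rec_nat (B p x) (\<lambda>i r. H p x i r) (N p x))"
proof -
  obtain b where b: "\<And>p x. p \<in> D \<Longrightarrow> evalt p b x (B p x)"
    using B unfolding computable_on_def by blast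
  obtain h where h: "\<And>p z. p \<in> D \<Longrightarrow> evalt p h z (H p (pfst z) (pfst (psnd z)) (psnd (psnd z)))"
    using H unfolding computable_on_def by blast
  have "evalt p (PrimRec b h) (prod_encode (x, n)) (rec_nat (B p x) (\<lambda>i r. H p x i r) n)"
    if "p \<in> D" for p x n
  proof (induction n)
    case 0
    then show ?case using b[OF that] by (auto intro: evalt.primrec_0)
  next
    case (Suc n)
    show ?case
      using evalt.primrec_Suc[OF Suc]
        h[OF that, of "prod_encode (x, prod_encode (n, rec_nat (B p x) (\<lambda>i r. H p x i r) n))"]
      by simp
  qed
  then have "evalt p (PrimRec b h) z (rec_nat (B p (pfst z)) (\<lambda>i r. H p (pfst z) i r) (psnd z))"
    if "p \<in> D" for p z
    using that by (metis pair_collapse)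
  then have "computable_on D (\<lambda>p z. rec_nat (B p (pfst z)) (\<lambda>i r. H p (pfst z) i r) (psnd z))"
    unfolding computable_on_def by blast
  from computable_on_compose2[OF this computable_on_id N] show ?thesis .
qed

lemma computable_on_add [comp_intros]:
  assumes "computable_on D F" "computable_on D G"
  shows "computable_on D (\<lambda>p x. F p x + G p x)"
proof -
  have "m + n = rec_nat m (\<lambda>_ r. Suc r) n" for m n :: nat by (induction n) auto
  then show ?thesis by simp (intro comp_intros assms)
qed

lemma computable_on_diff [comp_intros]:
  assumes "computable_on D F" "computable_on D G"
  shows "computable_on D (\<lambda>p x. F p x - G p x)"
proof -
  have pred: "n - 1 = rec_nat 0 (\<lambda>i _. i) n" for n :: nat by (cases n) auto
  have "m - n = rec_nat m (\<lambda>_ r. rec_nat 0 (\<lambda>i _. i) r) n" for m n :: nat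
    by (induction n) (simp_all flip: pred)
  then show ?thesis by simp (intro comp_intros assms)
qed

lemma computable_on_mult [comp_intros]:
  assumes "computable_on D F" "computable_on D G"
  shows "computable_on D (\<lambda>p x. F p x * G p x)"
proof -
  have "m * n = rec_nat 0 (\<lambda>_ r. r + m) n" for m n :: nat by (induction n) auto
  then show ?thesis by (simp only:) (intro comp_intros assms computable_on_compose[OF assms(1)])
qed

lemma computable_on_sum [comp_intros]:
  assumes "computable_on D (\<lambda>p z. F p (pfst z) (psnd z))" "computable_on D N"
  shows "computable_on D (\<lambda>p x. \<Sum>i<N p x. F p x i)"
proof -
  have "(\<Sum>i<n. f i) = rec_nat 0 (\<lambda>i r. r + f i) n" for f :: "nat \<Rightarrow> nat" and n
    by (induction n) auto
  then show ?thesis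
    by simp (intro comp_intros assms computable_on_compose2[OF assms(1)])
qed

lemma computable_on_of_bool [comp_intros]:
  "decidable_on D P \<Longrightarrow> computable_on D (\<lambda>p x. of_bool (P p x))"
  by (simp add: decidable_on_def)

lemma computable_on_if [comp_intros]:
  assumes "decidable_on D P" "computable_on D F" "computable_on D G"
  shows "computable_on D (\<lambda>p x. if P p x then F p x else G p x)"
proof -
  have "(if b then m else n) = of_bool b * m + (1 - of_bool b) * n" for b and m n :: nat by simp
  then show ?thesis by (simp only:) (intro comp_intros assms)
qed

lemma decidable_on_not [comp_intros]:
  assumes "decidable_on D P" shows "decidable_on D (\<lambda>p x. \<not> P p x)"
proof -
  have "of_bool (\<not> b) = 1 - (of_bool b :: nat)" for b by simp
  then show ?thesis unfolding decidable_on_def by (simp only:) (intro comp_intros assms)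
qed

lemma decidable_on_conj [comp_intros]:
  assumes "decidable_on D P" "decidable_on D Q" shows "decidable_on D (\<lambda>p x. P p x \<and> Q p x)"
  unfolding decidable_on_def of_bool_conj by (intro comp_intros assms)

lemma decidable_on_disj [comp_intros]:
  assumes "decidable_on D P" "decidable_on D Q" shows "decidable_on D (\<lambda>p x. P p x \<or> Q p x)"
proof -
  have "(a \<or> b) = (\<not> (\<not> a \<and> \<not> b))" for a b by simp
  then show ?thesis by (simp only:) (intro comp_intros assms)
qed

lemma decidable_on_imp [comp_intros]:
  assumes "decidable_on D P" "decidable_on D Q" shows "decidable_on D (\<lambda>p x. P p x \<longrightarrow> Q p x)"
  unfolding imp_conv_disj by (intro comp_intros assms)

lemma decidable_on_le [comp_intros]:
  assumes "computable_on D F" "computable_on D G" shows "decidable_on D (\<lambda>p x. F p x \<le> G p x)"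
proof -
  have "of_bool (m \<le> n) = 1 - (m - n)" for m n :: nat by simp
  then show ?thesis unfolding decidable_on_def by (simp only:) (intro comp_intros assms)
qed

lemma decidable_on_less [comp_intros]:
  assumes "computable_on D F" "computable_on D G" shows "decidable_on D (\<lambda>p x. F p x < G p x)"
  unfolding not_le[symmetric] by (intro comp_intros assms)

lemma decidable_on_eq [comp_intros]:
  assumes "computable_on D F" "computable_on D G" shows "decidable_on D (\<lambda>p x. F p x = G p x)"
  unfolding eq_iff by (intro comp_intros assms)

lemma decidable_on_ex_less [comp_intros]:
  assumes "decidable_on D (\<lambda>p z. P p (pfst z) (psnd z))" "computable_on D N"
  shows "decidable_on D (\<lambda>p x. \<exists>i<N p x. P p x i)"
proof -
  have "(\<exists>i<n. Q i) \<longleftrightarrow> (0::nat) < (\<Sum>i<n. of_bool (Q i))" for Q and n :: nat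
    by (auto simp: sum_pos2 simp flip: neq0_conv)
  then show ?thesis by (simp only:) (intro comp_intros assms)
qed

lemma decidable_on_all_less [comp_intros]:
  assumes "decidable_on D (\<lambda>p z. P p (pfst z) (psnd z))" "computable_on D N"
  shows "decidable_on D (\<lambda>p x. \<forall>i<N p x. P p x i)"
proof -
  have "(\<forall>i<n. Q i) \<longleftrightarrow> \<not> (\<exists>i<n. \<not> Q i)" for Q and n :: nat by simp
  then show ?thesis by (simp only:) (intro comp_intros assms)
qed

lemma computable_on_card [comp_intros]:
  assumes "decidable_on D (\<lambda>p z. P p (pfst z) (psnd z))" "computable_on D N"
  shows "computable_on D (\<lambda>p x. card {i. i < N p x \<and> P p x i})"
proof -
  have "card {i. i < n \<and> Q i} = (\<Sum>i<n. of_bool (Q i))" for Q and n :: nat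
    by (simp add: lessThan_def Collect_conj_eq)
  then show ?thesis by (simp only:) (intro comp_intros assms)
qed

lemma decidable_on_even [comp_intros]:
  assumes "computable_on D F" shows "decidable_on D (\<lambda>p x. even (F p x))"
proof -
  have "of_bool (even n) = rec_nat (1::nat) (\<lambda>_ r. 1 - r) n" for n by (induction n) auto
  then show ?thesis unfolding decidable_on_def by (simp only:) (intro comp_intros assms)
qed

lemma computable_on_div2 [comp_intros]:
  assumes "computable_on D F" shows "computable_on D (\<lambda>p x. F p x div 2)"
proof -
  have "n div 2 = rec_nat 0 (\<lambda>i r. r + of_bool (\<not> even i)) n" for n by (induction n) auto
  then show ?thesis by (simp only:) (intro comp_intros assms)
qed

text \<open>\<open>Mu\<close> looks for a zero, so the negation of \<open>P\<close> is computed. Its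
  rule demands positive values at all earlier arguments, which is exactly minimality.\<close>

lemma computable_on_Least:
  assumes P: "decidable_on D (\<lambda>p z. P p (pfst z) (psnd z))"
    and ex: "\<And>p x. p \<in> D \<Longrightarrow> \<exists>n. P p x n"
  shows "computable_on D (\<lambda>p x. LEAST n. P p x n)"
proof -
  have "computable_on D (\<lambda>p z. of_bool (\<not> P p (pfst z) (psnd z)))" by (intro comp_intros P)
  then obtain c where c: "\<And>p z. p \<in> D \<Longrightarrow> evalt p c z (of_bool (\<not> P p (pfst z) (psnd z)))"
    unfolding computable_on_def by blast
  have "evalt p (Mu c) x (LEAST n. P p x n)" if "p \<in> D" for p x
  proof (rule evalt.mu)
    have "P p x (LEAST n. P p x n)" using ex[OF that] by (rule LeastI_ex)
    then show "evalt p c (prod_encode (x, LEAST n. P p x n)) 0"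
      using c[OF that, of "prod_encode (x, LEAST n. P p x n)"] by simp
  next
    fix m assume "m < (LEAST n. P p x n)"
    then have "\<not> P p x m" by (rule not_less_Least)
    then show "\<exists>v>0. evalt p c (prod_encode (x, m)) v"
      using c[OF that, of "prod_encode (x, m)"] by auto
  qed
  then show ?thesis unfolding computable_on_def by blast
qed

text \<open>The use principle: a derivation is finite and queries finitely many places of the
  oracle.\<close>

lemma evalt_use:
  "evalt p c x y \<Longrightarrow> \<exists>u. \<forall>q. (\<forall>i<u. q i = p i) \<longrightarrow> evalt q c x y"
proof (induction rule: evalt.induct)
  case (query x)
  have "evalt q Oracle x (p x)" if "\<forall>i<Suc x. q i = p i" for q
    using that evalt.query[of q x] by simp
  then show ?case by blast
next
  case (tuple c x y d z)
  then obtain u v where "\<forall>q. (\<forall>i<u. q i = p i) \<longrightarrow> evalt q c x y"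
    "\<forall>q. (\<forall>i<v. q i = p i) \<longrightarrow> evalt q d x z" by blast
  then have "\<forall>q. (\<forall>i<max u v. q i = p i) \<longrightarrow> evalt q (Tuple c d) x (prod_encode (y, z))"
    by (auto intro: evalt.tuple)
  then show ?case by blast
next
  case (comp d x y c z)
  then obtain u v where "\<forall>q. (\<forall>i<u. q i = p i) \<longrightarrow> evalt q d x y"
    "\<forall>q. (\<forall>i<v. q i = p i) \<longrightarrow> evalt q c y z" by blast
  then have "\<forall>q. (\<forall>i<max u v. q i = p i) \<longrightarrow> evalt q (Comp c d) x z"
    by (auto intro!: evalt.comp[of _ d x y])
  then show ?case by blast
next
  case (primrec_Suc c d x n y z)
  then obtain u v where "\<forall>q. (\<forall>i<u. q i = p i) \<longrightarrow> evalt q (PrimRec c d) (prod_encode (x, n)) y"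
    "\<forall>q. (\<forall>i<v. q i = p i) \<longrightarrow> evalt q d (prod_encode (x, prod_encode (n, y))) z" by blast
  then have "\<forall>q. (\<forall>i<max u v. q i = p i) \<longrightarrow> evalt q (PrimRec c d) (prod_encode (x, Suc n)) z"
    using evalt.primrec_Suc[of _ c d x n y z] by simp
  then show ?case by blast
next
  case (mu c x n)
  obtain u where u: "\<forall>q. (\<forall>i<u. q i = p i) \<longrightarrow> evalt q c (prod_encode (x, n)) 0"
    using mu.IH(1) ..
  have "\<forall>m. \<exists>v. m < n \<longrightarrow> (\<forall>q. (\<forall>i<v. q i = p i) \<longrightarrow> (\<exists>y>0. evalt q c (prod_encode (x, m)) y))"
    using mu.IH(2) by meson
  then obtain V where V: "\<And>m q. m < n \<Longrightarrow> \<forall>i<V m. q i = p i \<Longrightarrow> \<exists>y>0. evalt q c (prod_encode (x, m)) y"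
    by metis
  have "evalt q (Mu c) x n" if q: "\<forall>i<u + (\<Sum>m<n. V m). q i = p i" for q
  proof (rule evalt.mu)
    show "evalt q c (prod_encode (x, n)) 0" using q u by simp
    fix m assume "m < n"
    then have "V m \<le> (\<Sum>m<n. V m)" by (intro member_le_sum) auto
    then show "\<exists>v>0. evalt q c (prod_encode (x, m)) v" using q by (intro V[OF \<open>m < n\<close>]) auto
  qed
  then show ?case by blast
qed (auto intro: evalt.zero evalt.succ evalt.left evalt.right evalt.primrec_0)


section \<open>Coding finitely supported sequences\<close>

text \<open>The tail is the first component of a pair: since a pair is larger than its first component
  unless it is \<open>0 = \<langle>0, 0\<rangle>\<close>, every number codes a finitely supported sequence, and conversely.\<close>

primrec seq_of :: "nat \<Rightarrow> nat \<Rightarrow> nat" where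
  "seq_of t 0 = psnd t"
| "seq_of t (Suc i) = seq_of (pfst t) i"

lemma pfst_0 [simp]: "pfst 0 = 0" and psnd_0 [simp]: "psnd 0 = 0"
  by (simp_all add: pfst_def psnd_def prod_decode_def prod_decode_aux.simps)

lemma pair_00 [simp]: "prod_encode (0, 0) = 0"
  by (simp add: prod_encode_def)

lemma pfst_less: "z > 0 \<Longrightarrow> pfst z < z"
proof -
  have "pfst z \<noteq> z \<or> z = 0"
  proof (rule disjCI, rule notI)
    assume "z \<noteq> 0" "pfst z = z"
    then have "prod_encode (z, psnd z) = z" using pair_collapse[of z] by simp
    then have "z + psnd z = 0"
      by (cases "z + psnd z") (auto simp: prod_encode_def)
    with \<open>z \<noteq> 0\<close> show False by simp
  qed
  moreover have "pfst z \<le> z" using le_prod_encode_1[of "pfst z" "psnd z"] by simp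
  ultimately show "z > 0 \<Longrightarrow> pfst z < z" by linarith
qed

lemma seq_of_0 [simp]: "seq_of 0 i = 0"
  by (induction i) auto

text \<open>The code itself bounds the support, which later turns every quantifier over a coded
  finite object into a bounded one.\<close>

lemma seq_of_support: "seq_of t i \<noteq> 0 \<Longrightarrow> i < t"
proof (induction i arbitrary: t)
  case 0
  then show ?case by (cases t) auto
next
  case (Suc i)
  then have "i < pfst t" "t \<noteq> 0" by (auto intro: gr0I)
  then show ?case using pfst_less[of t] by linarith
qed

lemma inj_seq_of: "seq_of s = seq_of t \<Longrightarrow> s = t"
proof (induction s arbitrary: t rule: less_induct)
  case (less s)
  have snd: "psnd s = psnd t" using fun_cong[OF less.prems, of 0] by simp
  have fst: "seq_of (pfst s) = seq_of (pfst t)"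
    using fun_cong[OF less.prems, of "Suc i" for i] by auto
  show ?case
  proof (cases "s = 0")
    case False
    then have "pfst s = pfst t" using less.IH[OF pfst_less fst] by simp
    then show ?thesis using snd pair_collapse by metis
  next
    case True
    \<comment> \<open>At \<open>s = 0\<close> the tail is no smaller and the outer induction stalls.
      That only \<open>0\<close> codes the zero sequence is shown by descending along
      \<open>t\<close> instead.\<close>
    have "t = 0" if "seq_of t = (\<lambda>_. 0)" for t
      using that
    proof (induction t rule: less_induct)
      case (less t)
      have "seq_of (pfst t) = (\<lambda>_. 0)" using fun_cong[OF less.prems, of "Suc i" for i] by auto
      moreover have "psnd t = 0" using fun_cong[OF less.prems, of 0] by simp
      ultimately have "t > 0 \<Longrightarrow> t = 0"
        using less.IH[OF pfst_less] pair_collapse[of t] pair_00 by metis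
      then show ?case by blast
    qed
    then show ?thesis using less.prems True by fastforce
  qed
qed

lemma seq_of_surj:
  assumes "\<And>i. i \<ge> n \<Longrightarrow> f i = 0"
  shows "\<exists>t. seq_of t = f"
  using assms
proof (induction n arbitrary: f)
  case 0
  then have "seq_of 0 = f" by auto
  then show ?case by blast
next
  case (Suc n)
  have "\<exists>t. seq_of t = (\<lambda>i. f (Suc i))" by (rule Suc.IH) (simp add: Suc.prems)
  then obtain t where t: "seq_of t = (\<lambda>i. f (Suc i))" by blast
  have "seq_of (prod_encode (t, f 0)) i = f i" for i by (cases i) (simp_all add: t)
  then show ?case by blast
qed

lemma seq_of_finite_support:
  assumes "finite {i. f i \<noteq> 0}"
  shows "\<exists>t. seq_of t = f"
proof -
  obtain n where "\<And>i. f i \<noteq> 0 \<Longrightarrow> i < n"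
    using assms by (auto simp: finite_nat_set_iff_bounded)
  then show ?thesis by (intro seq_of_surj[of n]) (meson leD)
qed

lemma computable_on_seq_of [comp_intros]:
  assumes "computable_on D F" "computable_on D G"
  shows "computable_on D (\<lambda>p x. seq_of (F p x) (G p x))"
proof -
  \<comment> \<open>\<open>seq_of\<close> recurses with a changing code. Since \<open>pfst\<close>
    commutes with its own iterates, this becomes an iteration from a fixed code, which primitive
    recursion accepts.\<close>
  have "pfst (rec_nat t (\<lambda>_ r. pfst r) i) = rec_nat (pfst t) (\<lambda>_ r. pfst r) i" for t i
    by (induction i) auto
  then have "seq_of t i = psnd (rec_nat t (\<lambda>_ r. pfst r) i)" for t i
    by (induction i arbitrary: t) auto
  then show ?thesis by (simp only:) (intro comp_intros assms)
qed


section \<open>Certificates of computations\<close>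

text \<open>The evaluation rules read backwards: the fact \<open>(c, x, y)\<close> follows in one
  step from facts in \<open>S\<close>. The numerals are the constructor tags of
  \<open>tf_code\<close>. \<open>Z\<close> limits the intermediate values that the rules leave open;
  it is \<open>UNIV\<close> while facts are collected and an initial segment when the check must be
  decidable.\<close>

definition justified :: "baire \<Rightarrow> nat set \<Rightarrow> (nat \<Rightarrow> nat \<Rightarrow> nat \<Rightarrow> bool) \<Rightarrow> nat \<Rightarrow> nat \<Rightarrow> nat \<Rightarrow> bool" where
  "justified f Z S c x y \<longleftrightarrow>
     pfst c = 0 \<and> y = 0 \<or>
     pfst c = 1 \<and> y = Suc x \<or>
     pfst c = 2 \<and> y = pfst x \<or>
     pfst c = 3 \<and> y = psnd x \<or>
     pfst c = 4 \<and> y = f x \<or>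
     pfst c = 5 \<and> S (pfst (psnd c)) x (pfst y) \<and> S (psnd (psnd c)) x (psnd y) \<or>
     pfst c = 6 \<and> (\<exists>z\<in>Z. S (psnd (psnd c)) x z \<and> S (pfst (psnd c)) z y) \<or>
     pfst c = 7 \<and> psnd x = 0 \<and> S (pfst (psnd c)) (pfst x) y \<or>
     pfst c = 7 \<and> psnd x \<noteq> 0 \<and>
       (\<exists>z\<in>Z. S c (prod_encode (pfst x, psnd x - 1)) z \<and>
         S (psnd (psnd c)) (prod_encode (pfst x, prod_encode (psnd x - 1, z))) y) \<or>
     pfst c = 8 \<and> S (psnd c) (prod_encode (x, y)) 0 \<and>
       (\<forall>m<y. \<exists>v\<in>Z. 0 < v \<and> S (psnd c) (prod_encode (x, m)) v)"

lemma justified_mono: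
  assumes "justified f Z S c x y" "\<And>c x y. S c x y \<Longrightarrow> T c x y" "Z \<subseteq> Y"
  shows "justified f Y T c x y"
  using assms unfolding justified_def by (elim disjE) (simp_all, (meson subsetD)+)

text \<open>Every premise of a rule of \<^const>\<open>evalt\<close> is smaller than the conclusion, so a set of facts is
  sound as soon as each of its elements is justified by others; no order of derivation is needed.\<close>

lemma justified_sound:
  assumes S: "\<And>c x y. S c x y \<Longrightarrow> justified f Z S c x y"
  shows "S (tf_code c) x y \<Longrightarrow> evalt f c x y"
proof (induction c arbitrary: x y)
  case Zero
  from S[OF Zero] show ?case by (auto simp: justified_def intro: evalt.zero)
next
  case Succ
  from S[OF Succ] show ?case by (auto simp: justified_def intro: evalt.succ)
next
  case Left
  from S[OF Left] show ?case
    by (simp add: justified_def) (metis evalt.left pair_collapse)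
next
  case Right
  from S[OF Right] show ?case
    by (simp add: justified_def) (metis evalt.right pair_collapse)
next
  case Oracle
  from S[OF Oracle] show ?case by (auto simp: justified_def intro: evalt.query)
next
  case (Tuple c d)
  from S[OF Tuple.prems] have "S (tf_code c) x (pfst y)" "S (tf_code d) x (psnd y)"
    by (simp_all add: justified_def)
  from evalt.tuple[OF Tuple.IH(1)[OF this(1)] Tuple.IH(2)[OF this(2)]] show ?case by simp
next
  case (Comp c d)
  from S[OF Comp.prems] obtain z where "S (tf_code d) x z" "S (tf_code c) z y"
    by (auto simp: justified_def)
  from evalt.comp[OF Comp.IH(2)[OF this(1)] Comp.IH(1)[OF this(2)]] show ?case .
next
  case (PrimRec c d)
  have "evalt f (PrimRec c d) (prod_encode (a, n)) y"
    if "S (tf_code (PrimRec c d)) (prod_encode (a, n)) y" for a n y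
    using that
  proof (induction n arbitrary: y)
    case 0
    from S[OF this] show ?case by (auto simp: justified_def intro: evalt.primrec_0 PrimRec.IH)
  next
    case (Suc n)
    from S[OF Suc.prems] obtain z where "S (tf_code (PrimRec c d)) (prod_encode (a, n)) z"
      "S (tf_code d) (prod_encode (a, prod_encode (n, z))) y"
      by (auto simp: justified_def)
    then show ?case by (intro evalt.primrec_Suc[OF Suc.IH PrimRec.IH(2)])
  qed
  from this[of "pfst x" "psnd x"] PrimRec.prems show ?case by simp
next
  case (Mu c)
  from S[OF Mu.prems] have "S (tf_code c) (prod_encode (x, y)) 0"
    "\<And>m. m < y \<Longrightarrow> \<exists>v>0. S (tf_code c) (prod_encode (x, m)) v"
    by (auto simp: justified_def)
  then show ?case by (intro evalt.mu) (use Mu.IH in blast)+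
qed

text \<open>Finite sets of facts, unlike their codes, are easily united, so derivations are
  assembled here and coded once at the end.\<close>

definition closed_facts :: "baire \<Rightarrow> (nat \<times> nat \<times> nat) set \<Rightarrow> bool" where
  "closed_facts f F \<longleftrightarrow> finite F \<and>
     (\<forall>c x y. (c, x, y) \<in> F \<longrightarrow> justified f UNIV (\<lambda>c x y. (c, x, y) \<in> F) c x y)"

lemma closed_facts_Un:
  assumes "closed_facts f F" "closed_facts f G" shows "closed_facts f (F \<union> G)"
  unfolding closed_facts_def
proof (intro conjI allI impI)
  fix c x y assume "(c, x, y) \<in> F \<union> G"
  then have "justified f UNIV (\<lambda>c x y. (c, x, y) \<in> F) c x y \<or> justified f UNIV (\<lambda>c x y. (c, x, y) \<in> G) c x y"
    using assms unfolding closed_facts_def by blast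
  then show "justified f UNIV (\<lambda>c x y. (c, x, y) \<in> F \<union> G) c x y"
    by (elim disjE) (erule justified_mono; simp)+
qed (use assms closed_facts_def in simp)

lemma closed_facts_UN:
  assumes "finite I" "\<And>i. i \<in> I \<Longrightarrow> closed_facts f (F i)" shows "closed_facts f (\<Union>i\<in>I. F i)"
  using assms
proof (induction I rule: finite_induct)
  case empty
  then show ?case by (simp add: closed_facts_def)
next
  case (insert i I)
  then show ?case by (simp add: closed_facts_Un)
qed

lemma closed_facts_insert:
  assumes "closed_facts f F" "justified f UNIV (\<lambda>c x y. (c, x, y) \<in> F) c x y"
  shows "closed_facts f (insert (c, x, y) F)"
  unfolding closed_facts_def
proof (intro conjI allI impI)
  fix c' x' y' assume "(c', x', y') \<in> insert (c, x, y) F"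
  then have "justified f UNIV (\<lambda>c x y. (c, x, y) \<in> F) c' x' y'"
    using assms unfolding closed_facts_def by blast
  then show "justified f UNIV (\<lambda>a b d. (a, b, d) \<in> insert (c, x, y) F) c' x' y'"
    by (rule justified_mono) auto
qed (use assms closed_facts_def in simp)

lemma closed_facts_complete:
  "evalt f c x y \<Longrightarrow> \<exists>F. closed_facts f F \<and> (tf_code c, x, y) \<in> F"
proof (induction rule: evalt.induct)
  have *: "\<exists>F. closed_facts f F \<and> (c, x, y) \<in> F"
    if "closed_facts f F" "justified f UNIV (\<lambda>c x y. (c, x, y) \<in> F) c x y" for F c x y
    using closed_facts_insert[OF that] by blast
  have e: "closed_facts f {}" by (simp add: closed_facts_def)
  {
    case (zero x)
    show ?case by (rule *[OF e]) (simp add: justified_def)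
  next
    case (succ x)
    show ?case by (rule *[OF e]) (simp add: justified_def)
  next
    case (left x y)
    show ?case by (rule *[OF e]) (simp add: justified_def)
  next
    case (right x y)
    show ?case by (rule *[OF e]) (simp add: justified_def)
  next
    case (query x)
    show ?case by (rule *[OF e]) (simp add: justified_def)
  next
    case (tuple c x y d z)
    then obtain F G where "closed_facts f F" "(tf_code c, x, y) \<in> F"
      "closed_facts f G" "(tf_code d, x, z) \<in> G" by blast
    then show ?case by (intro *[OF closed_facts_Un, of F G]) (simp_all add: justified_def)
  next
    case (comp d x y c z)
    then obtain F G where "closed_facts f F" "(tf_code c, y, z) \<in> F"
      "closed_facts f G" "(tf_code d, x, y) \<in> G" by blast
    then show ?case by (intro *[OF closed_facts_Un, of F G]) (auto simp: justified_def)
  next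
    case (primrec_0 c x y d)
    then obtain F where "closed_facts f F" "(tf_code c, x, y) \<in> F" by blast
    then show ?case by (intro *[of F]) (simp_all add: justified_def)
  next
    case (primrec_Suc c d x n y z)
    then obtain F G where "closed_facts f F" "(tf_code (PrimRec c d), prod_encode (x, n), y) \<in> F"
      "closed_facts f G" "(tf_code d, prod_encode (x, prod_encode (n, y)), z) \<in> G" by blast
    then show ?case by (intro *[OF closed_facts_Un, of F G]) (auto simp: justified_def)
  next
    case (mu c x n)
    obtain F where F: "closed_facts f F" "(tf_code c, prod_encode (x, n), 0) \<in> F"
      using mu.IH(1) by blast
    have "\<forall>m. \<exists>G. m < n \<longrightarrow> closed_facts f G \<and> (\<exists>v>0. (tf_code c, prod_encode (x, m), v) \<in> G)"
      using mu.IH(2) by meson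
    then obtain G where G: "\<And>m. m < n \<Longrightarrow> closed_facts f (G m)"
      "\<And>m. m < n \<Longrightarrow> \<exists>v>0. (tf_code c, prod_encode (x, m), v) \<in> G m" by metis
    have "closed_facts f (F \<union> (\<Union>m\<in>{..<n}. G m))"
      using F(1) G(1) by (intro closed_facts_Un closed_facts_UN) auto
    then show ?case
    proof (rule *)
      have "\<exists>v>0. (tf_code c, prod_encode (x, m), v) \<in> F \<union> (\<Union>m\<in>{..<n}. G m)" if "m < n" for m
        using G(2)[OF that] that by blast
      then show "justified f UNIV (\<lambda>c x y. (c, x, y) \<in> F \<union> (\<Union>m\<in>{..<n}. G m)) (tf_code (Mu c)) x n"
        using F(2) by (simp add: justified_def)
    qed
  }
qed

definition listed :: "nat \<Rightarrow> nat \<Rightarrow> nat \<Rightarrow> nat \<Rightarrow> bool" where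
  "listed w c x y \<longleftrightarrow> seq_of w (prod_encode (c, prod_encode (x, y))) \<noteq> 0"

text \<open>\<open>w\<close> plays three parts: it codes the set of facts, bounds the positions to
  be checked and bounds the intermediate values. Being decidable relative to \<open>f\<close>, this
  replaces the computation predicate of a universal functional.\<close>

definition certificate :: "baire \<Rightarrow> nat \<Rightarrow> bool" where
  "certificate f w \<longleftrightarrow> (\<forall>e<w. seq_of w e \<noteq> 0 \<longrightarrow>
     justified f {..<w} (listed w) (pfst e) (pfst (psnd e)) (psnd (psnd e)))"

text \<open>Pairs majorize their components, so every argument and value of a listed fact lies below
  \<open>w\<close>. Hence bounding the intermediate values by \<open>w\<close> loses
  nothing.\<close>

lemma listed_bounds:
  assumes "listed w c x y"
  shows "prod_encode (c, prod_encode (x, y)) < w" "x < w" "y < w"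
proof -
  show *: "prod_encode (c, prod_encode (x, y)) < w"
    using assms seq_of_support unfolding listed_def by blast
  show "x < w" "y < w"
    using * le_prod_encode_1[of x y] le_prod_encode_2[of y x] le_prod_encode_2[of "prod_encode (x, y)" c]
    by linarith+
qed

lemma certificate_sound:
  assumes "certificate f w" "listed w (tf_code c) x y" shows "evalt f c x y"
proof (rule justified_sound[of "listed w"])
  fix c x y assume *: "listed w c x y"
  then show "justified f {..<w} (listed w) c x y"
    using assms(1)[unfolded certificate_def, rule_format, OF listed_bounds(1)[OF *]]
    by (simp add: listed_def)
qed (fact assms(2))

lemma certificate_complete:
  assumes "evalt f c x y"
  shows "\<exists>w. certificate f w \<and> listed w (tf_code c) x y"
proof -
  obtain F where F: "closed_facts f F" "(tf_code c, x, y) \<in> F"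
    using closed_facts_complete[OF assms] by blast
  have "finite ((\<lambda>(c, x, y). prod_encode (c, prod_encode (x, y))) ` F)"
    using F(1) by (simp add: closed_facts_def)
  then have "\<exists>w. seq_of w = (\<lambda>e. of_bool (e \<in> (\<lambda>(c, x, y). prod_encode (c, prod_encode (x, y))) ` F))"
    by (intro seq_of_finite_support) simp
  then obtain w where w: "seq_of w = (\<lambda>e. of_bool (e \<in> (\<lambda>(c, x, y). prod_encode (c, prod_encode (x, y))) ` F))"
    by blast
  have L: "listed w c x y \<longleftrightarrow> (c, x, y) \<in> F" for c x y
    unfolding listed_def w by (force simp: image_iff)
  have "certificate f w"
    unfolding certificate_def
  proof (intro allI impI)
    fix e assume "e < w" "seq_of w e \<noteq> 0"
    then have "listed w (pfst e) (pfst (psnd e)) (psnd (psnd e))" by (simp add: listed_def)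
    then have "justified f UNIV (listed w) (pfst e) (pfst (psnd e)) (psnd (psnd e))"
      using F(1) unfolding closed_facts_def L by (auto intro: justified_mono simp: L)
    then show "justified f {..<w} (listed w) (pfst e) (pfst (psnd e)) (psnd (psnd e))"
      unfolding justified_def lessThan_iff by (elim disjE) (simp_all, (meson listed_bounds lessThan_iff)+)
  qed
  then show ?thesis using F(2) L by blast
qed

lemma decidable_on_listed [comp_intros]:
  assumes "computable_on D W" "computable_on D C" "computable_on D X" "computable_on D Y"
  shows "decidable_on D (\<lambda>p x. listed (W p x) (C p x) (X p x) (Y p x))"
  unfolding listed_def by (intro comp_intros assms)

text \<open>The oracle \<open>f p x\<close> may vary with the input, because it will be joined with
  a finite order that the input codes.\<close>

lemma decidable_on_certificate:
  assumes f: "computable_on D (\<lambda>p z. f p (pfst z) (psnd z))" and W: "computable_on D W"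
  shows "decidable_on D (\<lambda>p x. certificate (f p x) (W p x))"
  unfolding certificate_def justified_def Bex_def lessThan_iff
  by (intro comp_intros computable_on_compose2[OF f] computable_on_compose[OF W])


section \<open>Linear orders and their isomorphisms\<close>

lemma linear_ordD:
  assumes "linear_ord (A, R)"
  shows "R \<subseteq> A \<times> A" "(x, x) \<notin> R" "(x, y) \<in> R \<Longrightarrow> (y, z) \<in> R \<Longrightarrow> (x, z) \<in> R"
    "x \<in> A \<Longrightarrow> y \<in> A \<Longrightarrow> x \<noteq> y \<Longrightarrow> (x, y) \<in> R \<or> (y, x) \<in> R"
  using assms unfolding linear_ord_def strict_linear_order_on_def irrefl_def total_on_def
  by (auto elim: transE)

lemma linear_ordI:
  assumes "R \<subseteq> A \<times> A" "\<And>x. (x, x) \<notin> R"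
    "\<And>x y z. (x, y) \<in> R \<Longrightarrow> (y, z) \<in> R \<Longrightarrow> (x, z) \<in> R"
    "\<And>x y. x \<in> A \<Longrightarrow> y \<in> A \<Longrightarrow> x \<noteq> y \<Longrightarrow> (x, y) \<in> R \<or> (y, x) \<in> R"
  shows "linear_ord (A, R)"
  using assms unfolding linear_ord_def strict_linear_order_on_def irrefl_def total_on_def trans_def
  by blast

lemma ord_isoI:
  assumes "bij_betw h A B" "\<And>x y. x \<in> A \<Longrightarrow> y \<in> A \<Longrightarrow> (x, y) \<in> R \<longleftrightarrow> (h x, h y) \<in> S"
  shows "ord_iso (A, R) (B, S)"
  using assms unfolding ord_iso_def by blast

lemma ord_isoE:
  assumes "ord_iso (A, R) (B, S)"
  obtains h where "bij_betw h A B" "\<And>x y. x \<in> A \<Longrightarrow> y \<in> A \<Longrightarrow> (x, y) \<in> R \<longleftrightarrow> (h x, h y) \<in> S"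
  using assms unfolding ord_iso_def by blast

lemma ord_iso_refl: "ord_iso X X"
  by (cases X) (auto intro: ord_isoI[of id])

lemma ord_iso_sym: "ord_iso X Y \<Longrightarrow> ord_iso Y X"
proof -
  assume *: "ord_iso X Y"
  obtain A R B S where XY: "X = (A, R)" "Y = (B, S)" by fastforce
  obtain h where h: "bij_betw h A B" "\<And>x y. x \<in> A \<Longrightarrow> y \<in> A \<Longrightarrow> (x, y) \<in> R \<longleftrightarrow> (h x, h y) \<in> S"
    using * unfolding XY by (rule ord_isoE) (rule that; simp)
  show "ord_iso Y X"
    unfolding XY
  proof (rule ord_isoI)
    show i: "bij_betw (inv_into A h) B A" by (rule bij_betw_inv_into[OF h(1)])
    show "(x, y) \<in> S \<longleftrightarrow> (inv_into A h x, inv_into A h y) \<in> R" if "x \<in> B" "y \<in> B" for x y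
      using h(2)[of "inv_into A h x" "inv_into A h y"] that i bij_betw_inv_into_right[OF h(1)]
      by (simp add: bij_betw_apply)
  qed
qed

lemma ord_iso_trans: "ord_iso X Y \<Longrightarrow> ord_iso Y Z \<Longrightarrow> ord_iso X Z"
proof -
  assume *: "ord_iso X Y" "ord_iso Y Z"
  obtain A R B S C T where XYZ: "X = (A, R)" "Y = (B, S)" "Z = (C, T)" by (metis prod.exhaust)
  obtain h where h: "bij_betw h A B" "\<And>x y. x \<in> A \<Longrightarrow> y \<in> A \<Longrightarrow> (x, y) \<in> R \<longleftrightarrow> (h x, h y) \<in> S"
    using *(1) unfolding XYZ by (rule ord_isoE) (rule that; simp)
  obtain k where k: "bij_betw k B C" "\<And>x y. x \<in> B \<Longrightarrow> y \<in> B \<Longrightarrow> (x, y) \<in> S \<longleftrightarrow> (k x, k y) \<in> T"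
    using *(2) unfolding XYZ by (rule ord_isoE) (rule that; simp)
  show "ord_iso X Z"
    unfolding XYZ
    by (rule ord_isoI[OF bij_betw_trans[OF h(1) k(1)]]) (simp add: h k bij_betw_apply[OF h(1)])
qed

definition image_ord :: "('a \<Rightarrow> 'b) \<Rightarrow> 'a linord \<Rightarrow> 'b linord" where
  "image_ord h X = (h ` fst X, map_prod h h ` snd X)"

lemma image_ord_iff:
  assumes "inj_on h A" "R \<subseteq> A \<times> A" "x \<in> A" "y \<in> A"
  shows "(h x, h y) \<in> map_prod h h ` R \<longleftrightarrow> (x, y) \<in> R"
proof
  assume "(h x, h y) \<in> map_prod h h ` R"
  then obtain x' y' where "(x', y') \<in> R" "h x = h x'" "h y = h y'" by auto
  then show "(x, y) \<in> R" using assms by (metis inj_onD mem_Sigma_iff subsetD)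
qed auto

lemma ord_iso_image:
  assumes "linear_ord (A, R)" "inj_on h A" shows "ord_iso (A, R) (image_ord h (A, R))"
  unfolding image_ord_def fst_conv snd_conv
  using image_ord_iff[OF assms(2) linear_ordD(1)[OF assms(1)]] assms(2)
  by (intro ord_isoI[of h]) (auto simp: bij_betw_def)

lemma linear_ord_iso:
  assumes "ord_iso (A, R) (B, S)" "linear_ord (A, R)" "S \<subseteq> B \<times> B"
  shows "linear_ord (B, S)"
proof -
  obtain h where h: "bij_betw h B A" "\<And>x y. x \<in> B \<Longrightarrow> y \<in> B \<Longrightarrow> (x, y) \<in> S \<longleftrightarrow> (h x, h y) \<in> R"
    using ord_iso_sym[OF assms(1)] by (rule ord_isoE) (rule that; simp)
  have i: "h x \<in> A" if "x \<in> B" for x using h(1) that by (simp add: bij_betw_apply)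
  have j: "h x \<noteq> h y" if "x \<in> B" "y \<in> B" "x \<noteq> y" for x y
    using h(1) that by (meson bij_betw_imp_inj_on inj_onD)
  have S: "x \<in> B \<and> y \<in> B" if "(x, y) \<in> S" for x y using assms(3) that by blast
  note R = linear_ordD[OF assms(2)]
  show ?thesis
  proof (rule linear_ordI[OF assms(3)])
    show "(x, x) \<notin> S" for x using S h(2) R(2) by blast
    show "(x, z) \<in> S" if "(x, y) \<in> S" "(y, z) \<in> S" for x y z
    proof -
      have "(h x, h y) \<in> R" "(h y, h z) \<in> R" "x \<in> B" "z \<in> B" using that S h(2) by blast+
      then show ?thesis using R(3) h(2) by blast
    qed
    show "(x, y) \<in> S \<or> (y, x) \<in> S" if "x \<in> B" "y \<in> B" "x \<noteq> y" for x y
      using R(4)[OF i i j] h(2) that by blast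
  qed
qed

lemma well_ord_iso:
  assumes "ord_iso (A, R) (B, S)" "well_ord (A, R)" "S \<subseteq> B \<times> B"
  shows "well_ord (B, S)"
proof -
  obtain h where h: "bij_betw h B A" "\<And>x y. x \<in> B \<Longrightarrow> y \<in> B \<Longrightarrow> (x, y) \<in> S \<longleftrightarrow> (h x, h y) \<in> R"
    using ord_iso_sym[OF assms(1)] by (rule ord_isoE) (rule that; simp)
  have "S \<subseteq> inv_image R h" using h(2) assms(3) unfolding inv_image_def by blast
  moreover have "wf (inv_image R h)" using assms(2) by (intro wf_inv_image) (simp add: well_ord_def)
  ultimately have "wf S" using wf_subset by blast
  then show ?thesis
    using linear_ord_iso[OF assms(1) _ assms(3)] assms(2) by (simp add: well_ord_def)
qed

lemma linear_ord_restrict: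
  assumes "linear_ord (A, R)" "B \<subseteq> A" shows "linear_ord (B, R \<inter> B \<times> B)"
  using linear_ordD[OF assms(1)] assms(2) by (intro linear_ordI) (simp, blast+)

lemma finite_linear_ord_well_ord:
  assumes "linear_ord (A, R)" "finite A" shows "well_ord (A, R)"
proof -
  have "finite R" using linear_ordD(1)[OF assms(1)] assms(2) by (meson finite_SigmaI finite_subset)
  moreover have "trans R" using linear_ordD(3)[OF assms(1)] unfolding trans_def by blast
  ultimately have "wf R"
    using linear_ordD(2)[OF assms(1)] by (intro finite_acyclic_wf) (auto simp: acyclic_def)
  then show ?thesis using assms(1) by (simp add: well_ord_def)
qed

lemma finite_linear_ord_rank:
  assumes lin: "linear_ord (A, R)" and fin: "finite A"
  shows "ord_iso (A, R) ({..<card A}, {(x, y). x < y \<and> y < card A})"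
proof (rule ord_isoI)
  define r where "r x = card {y. (y, x) \<in> R}" for x
  note R = linear_ordD[OF lin]
  have sub: "{y. (y, x) \<in> R} \<subseteq> A" for x using R(1) by blast
  have mono: "r x < r y" if "(x, y) \<in> R" for x y
    unfolding r_def
  proof (rule psubset_card_mono)
    show "finite {z. (z, y) \<in> R}" using sub fin by (rule finite_subset)
    show "{z. (z, x) \<in> R} \<subset> {z. (z, y) \<in> R}" using R(2)[of x] R(3) that by blast
  qed
  have bound: "r x < card A" if "x \<in> A" for x
    unfolding r_def using R(2)[of x] sub that by (intro psubset_card_mono[OF fin]) blast
  have eq: "x = y" if "x \<in> A" "y \<in> A" "r x = r y" for x y
    using R(4)[OF that(1,2)] mono[of x y] mono[of y x] that(3) by auto
  then have inj: "inj_on r A" by (auto simp: inj_on_def)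
  have "r ` A = {..<card A}"
    using bound inj by (intro card_subset_eq) (auto simp: card_image)
  then show "bij_betw r A {..<card A}" using inj by (simp add: bij_betw_def)
  show "(x, y) \<in> R \<longleftrightarrow> (r x, r y) \<in> {(x, y). x < y \<and> y < card A}" if "x \<in> A" "y \<in> A" for x y
    using mono[of x y] mono[of y x] R(4)[OF that] R(2)[of x] bound[OF that(2)]
    by (cases "x = y") auto
qed

lemma finite_linear_ords_iso:
  assumes "linear_ord (A, R)" "finite A" "linear_ord (B, S)" "finite B" "card A = card B"
  shows "ord_iso (A, R) (B, S)"
  by (rule ord_iso_trans[OF finite_linear_ord_rank[OF assms(1,2), unfolded assms(5)]
        ord_iso_sym[OF finite_linear_ord_rank[OF assms(3,4)]]])

section \<open>Integer powers and products respect isomorphism\<close>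

definition int_less :: "'a set \<Rightarrow> 'a rel \<Rightarrow> ('a \<Rightarrow> int) \<Rightarrow> ('a \<Rightarrow> int) \<Rightarrow> bool" where
  "int_less A R f g \<longleftrightarrow>
     (\<exists>x \<in> A. f x \<noteq> g x \<and> (\<forall>y \<in> A. f y \<noteq> g y \<and> y \<noteq> x \<longrightarrow> (y, x) \<in> R) \<and> f x < g x)"

definition fin_supp :: "'a set \<Rightarrow> ('a \<Rightarrow> int) set" where
  "fin_supp A = {f. finite {x. f x \<noteq> 0} \<and> {x. f x \<noteq> 0} \<subseteq> A}"

lemma int_pow_eq:
  "int_pow (A, R) = (fin_supp A, {(f, g). f \<in> fin_supp A \<and> g \<in> fin_supp A \<and> int_less A R f g})"
  by (simp add: int_pow_def fin_supp_def int_less_def Let_def)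

text \<open>Functions are transported by composing with the isomorphism. The points of the power are
  total functions, so the composite is set to \<open>0\<close> off the universe.\<close>

lemma int_pow_ord_iso:
  assumes "ord_iso X Y" shows "ord_iso (int_pow X) (int_pow Y)"
proof -
  obtain A R B S where XY: "X = (A, R)" "Y = (B, S)" by fastforce
  obtain h where h: "bij_betw h B A" "\<And>x y. x \<in> B \<Longrightarrow> y \<in> B \<Longrightarrow> (x, y) \<in> S \<longleftrightarrow> (h x, h y) \<in> R"
    using ord_iso_sym[OF assms] unfolding XY by (rule ord_isoE) (rule that; simp)
  define k where "k = inv_into B h"
  have k: "bij_betw k A B" unfolding k_def by (rule bij_betw_inv_into[OF h(1)])
  have hk: "h (k x) = x" "k x \<in> B" if "x \<in> A" for x
    using that h(1) k by (simp_all add: k_def bij_betw_inv_into_right bij_betw_apply)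
  have kh: "k (h x) = x" "h x \<in> A" if "x \<in> B" for x
    using that h(1) by (simp_all add: k_def bij_betw_inv_into_left bij_betw_apply)
  define F where "F f = (\<lambda>y. if y \<in> B then f (h y) else (0 :: int))" for f
  define G where "G g = (\<lambda>x. if x \<in> A then g (k x) else (0 :: int))" for g
  have F: "F f \<in> fin_supp B" if "f \<in> fin_supp A" for f
  proof -
    have "{y. F f y \<noteq> 0} \<subseteq> k ` {x. f x \<noteq> 0}"
      using kh unfolding F_def by (auto simp: image_iff) metis
    then have "finite {y. F f y \<noteq> 0}"
      using that finite_surj unfolding fin_supp_def by blast
    then show ?thesis by (auto simp: fin_supp_def F_def)
  qed
  have G: "G g \<in> fin_supp A" if "g \<in> fin_supp B" for g
  proof -
    have "{x. G g x \<noteq> 0} \<subseteq> h ` {y. g y \<noteq> 0}"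
      using hk unfolding G_def by (auto simp: image_iff) metis
    then have "finite {x. G g x \<noteq> 0}"
      using that finite_surj unfolding fin_supp_def by blast
    then show ?thesis by (auto simp: fin_supp_def G_def)
  qed
  have GF: "G (F f) = f" if "f \<in> fin_supp A" for f
    using that hk by (auto simp: G_def F_def fin_supp_def fun_eq_iff)
  have FG: "F (G g) = g" if "g \<in> fin_supp B" for g
    using that kh by (auto simp: G_def F_def fin_supp_def fun_eq_iff)
  have less: "int_less A R f g \<longleftrightarrow> int_less B S (F f) (F g)" for f g
  proof
    assume "int_less A R f g"
    then obtain x where x: "x \<in> A" "f x \<noteq> g x" "f x < g x"
      "\<And>y. y \<in> A \<Longrightarrow> f y \<noteq> g y \<Longrightarrow> y \<noteq> x \<Longrightarrow> (y, x) \<in> R"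
      unfolding int_less_def by blast
    have "(y, k x) \<in> S" if "y \<in> B" "f (h y) \<noteq> g (h y)" "y \<noteq> k x" for y
    proof -
      have "h y \<noteq> x" using kh(1)[OF that(1)] that(3) by auto
      then have "(h y, x) \<in> R" using x(4) kh(2) that by blast
      then show ?thesis using h(2)[of y "k x"] hk x(1) that(1) by simp
    qed
    then show "int_less B S (F f) (F g)"
      unfolding int_less_def using x hk by (intro bexI[of _ "k x"]) (simp_all add: F_def)
  next
    assume "int_less B S (F f) (F g)"
    then obtain x where x: "x \<in> B" "f (h x) \<noteq> g (h x)" "f (h x) < g (h x)"
      "\<And>y. y \<in> B \<Longrightarrow> f (h y) \<noteq> g (h y) \<Longrightarrow> y \<noteq> x \<Longrightarrow> (y, x) \<in> S"
      unfolding int_less_def F_def by auto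
    have "(y, h x) \<in> R" if "y \<in> A" "f y \<noteq> g y" "y \<noteq> h x" for y
    proof -
      have "k y \<noteq> x" using hk(1)[of y] that by auto
      then have "(k y, x) \<in> S" using x(4)[of "k y"] hk that by auto
      then show ?thesis using h(2)[of "k y" x] hk x(1) that(1) by simp
    qed
    then show "int_less A R f g"
      unfolding int_less_def using x kh by (intro bexI[of _ "h x"]) auto
  qed
  show ?thesis
    unfolding XY int_pow_eq
    by (rule ord_isoI[of F]) (auto intro!: bij_betw_byWitness[of _ G] simp: F G GF FG less)
qed

lemma ord_prod_ord_iso:
  assumes "ord_iso X X'" "ord_iso Y Y'" shows "ord_iso (ord_prod X Y) (ord_prod X' Y')"
proof -
  obtain A R B S where XY: "X = (A, R)" "Y = (B, S)" by fastforce
  obtain A' R' B' S' where XY': "X' = (A', R')" "Y' = (B', S')" by fastforce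
  obtain h where h: "bij_betw h A A'" "\<And>x y. x \<in> A \<Longrightarrow> y \<in> A \<Longrightarrow> (x, y) \<in> R \<longleftrightarrow> (h x, h y) \<in> R'"
    using assms(1) unfolding XY XY' by (rule ord_isoE) (rule that; simp)
  obtain k where k: "bij_betw k B B'" "\<And>x y. x \<in> B \<Longrightarrow> y \<in> B \<Longrightarrow> (x, y) \<in> S \<longleftrightarrow> (k x, k y) \<in> S'"
    using assms(2) unfolding XY XY' by (rule ord_isoE) (rule that; simp)
  have "k x = k y \<longleftrightarrow> x = y" if "x \<in> B" "y \<in> B" for x y
    using k(1) that by (meson bij_betw_imp_inj_on inj_onD)
  then show ?thesis
    unfolding XY XY' ord_prod_def prod.case
    using h(2) k(2) bij_betw_apply[OF h(1)] bij_betw_apply[OF k(1)]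
    by (intro ord_isoI[OF bij_betw_map_prod[OF h(1) k(1)]]) auto
qed


section \<open>Reducing the first-order part to finitely many instances of LPO\<close>

definition named_set :: "baire \<Rightarrow> nat set" where
  "named_set g = {n. g (2 * n) \<noteq> 0}"

definition named_rel :: "baire \<Rightarrow> nat rel" where
  "named_rel g = {(x, y). g (Suc (2 * prod_encode (x, y))) \<noteq> 0}"

lemma wo_rep_eq:
  "wo_rep g = (if well_ord (named_set g, named_rel g) then Some (named_set g, named_rel g) else None)"
  by (simp add: wo_rep_def prod_rep_def set_rep_def rel_rep_def named_set_def named_rel_def)

text \<open>Any nonzero value signals membership, so a well-order has many names, and the first
  \<open>u\<close> values of \<open>g\<close> can be kept verbatim when they say nothing false about
  \<open>(A, R)\<close>. The support bound makes the name finitely supported, hence coded by a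
  number, when \<open>A\<close> is finite.\<close>

lemma wo_rep_splice:
  assumes "well_ord (A, R)"
    and "\<And>n. n < u \<Longrightarrow> n \<in> A \<longleftrightarrow> n \<in> named_set g"
    and "\<And>x y. prod_encode (x, y) < u \<Longrightarrow> (x, y) \<in> R \<longleftrightarrow> (x, y) \<in> named_rel g"
  shows "\<exists>h. wo_rep h = Some (A, R) \<and> (\<forall>i<u. h i = g i) \<and>
    {i. h i \<noteq> 0} \<subseteq> {..<u} \<union> (*) 2 ` A \<union> (\<lambda>e. Suc (2 * prod_encode e)) ` R"
proof (intro exI conjI allI impI)
  define h where "h i = (if i < u then g i else if even i then of_bool (i div 2 \<in> A)
    else of_bool (prod_decode (i div 2) \<in> R))" for i
  have "named_set h = A" "named_rel h = R"
    using assms(2,3) by (auto simp: named_set_def named_rel_def h_def)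
  then show "wo_rep h = Some (A, R)" using assms(1) by (simp add: wo_rep_eq)
  show "h i = g i" if "i < u" for i using that by (simp add: h_def)
  show "{i. h i \<noteq> 0} \<subseteq> {..<u} \<union> (*) 2 ` A \<union> (\<lambda>e. Suc (2 * prod_encode e)) ` R"
  proof
    fix i assume "i \<in> {i. h i \<noteq> 0}"
    then consider "i < u" | "even i" "i div 2 \<in> A" | "odd i" "prod_decode (i div 2) \<in> R"
      by (auto simp: h_def split: if_splits)
    then show "i \<in> {..<u} \<union> (*) 2 ` A \<union> (\<lambda>e. Suc (2 * prod_encode e)) ` R"
    proof cases
      case 2
      then have "i = 2 * (i div 2)" by simp
      with 2(2) show ?thesis by blast
    next
      case 3
      then have "i = Suc (2 * prod_encode (prod_decode (i div 2)))" by simp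
      with 3(2) show ?thesis by blast
    qed simp
  qed
qed

definition copies :: "nat linord \<Rightarrow> baire set" where
  "copies \<alpha> = {g. \<exists>\<beta>. wo_rep g = Some \<beta> \<and> ord_iso \<alpha> \<beta>}"

text \<open>A finitely supported name is a complete oracle, so convergence on a finite order is one
  computation rather than a statement about all extensions of a finite string.\<close>

definition convergent_part :: "baire \<Rightarrow> tf \<Rightarrow> nat \<Rightarrow> nat \<Rightarrow> nat \<Rightarrow> bool" where
  "convergent_part f c j t y \<longleftrightarrow>
     linear_ord (named_set (seq_of t), named_rel (seq_of t)) \<and>
     card (named_set (seq_of t)) = j \<and> evalt (f \<uplus> seq_of t) c 0 y"

lemma finite_named_set: "finite (named_set (seq_of t))"
proof -
  have "named_set (seq_of t) \<subseteq> {..<t}"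
    using seq_of_support by (fastforce simp: named_set_def)
  then show ?thesis using finite_subset by blast
qed

text \<open>Cut a copy of the well-order down to its elements below the use: the computation does
  not notice, and what remains is a finite suborder, hence no larger than \<open>A\<close>.\<close>

lemma convergent_part_exists:
  assumes \<alpha>: "well_ord (A, R)" and conv: "\<forall>g\<in>copies (A, R). \<exists>y. evalt (f \<uplus> g) c 0 y"
  shows "\<exists>j t y. convergent_part f c j t y \<and> (infinite A \<or> j \<le> card A)"
proof -
  have lin: "linear_ord (A, R)" using \<alpha> by (simp add: well_ord_def)
  obtain g where g: "wo_rep g = Some (A, R)"
    using wo_rep_splice[OF \<alpha>, of 0] by auto
  then have AR: "named_set g = A" "named_rel g = R" by (simp_all add: wo_rep_eq split: if_splits)
  have "g \<in> copies (A, R)" using g ord_iso_refl by (auto simp: copies_def)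
  then obtain y where "evalt (f \<uplus> g) c 0 y" using conv by blast
  then obtain u where u: "\<And>q. \<forall>i<u. q i = (f \<uplus> g) i \<Longrightarrow> evalt q c 0 y"
    using evalt_use by blast
  define B where "B = A \<inter> {..<u}"
  define S where "S = R \<inter> B \<times> B"
  have linB: "linear_ord (B, S)" unfolding S_def by (rule linear_ord_restrict[OF lin]) (simp add: B_def)
  have "finite B" by (simp add: B_def)
  have mem: "(x, y) \<in> S \<longleftrightarrow> (x, y) \<in> R" if "prod_encode (x, y) < u" for x y
    using that le_prod_encode_1[of x y] le_prod_encode_2[of y x] linear_ordD(1)[OF lin]
    by (auto simp: S_def B_def)
  obtain h where h: "wo_rep h = Some (B, S)" "\<And>i. i < u \<Longrightarrow> h i = g i"
    "{i. h i \<noteq> 0} \<subseteq> {..<u} \<union> (*) 2 ` B \<union> (\<lambda>e. Suc (2 * prod_encode e)) ` S"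
    using wo_rep_splice[OF finite_linear_ord_well_ord[OF linB \<open>finite B\<close>], of u g] mem
    by (auto simp: AR B_def)
  have "finite ({..<u} \<union> (*) 2 ` B \<union> (\<lambda>e. Suc (2 * prod_encode e)) ` S)"
    using \<open>finite B\<close> by (simp add: S_def)
  then obtain t where t: "seq_of t = h" using seq_of_finite_support h(3) finite_subset by metis
  have "evalt (f \<uplus> seq_of t) c 0 y" by (rule u) (auto simp: t join_def h(2))
  moreover have "named_set (seq_of t) = B" "named_rel (seq_of t) = S"
    using h(1) by (simp_all add: t wo_rep_eq split: if_splits)
  ultimately have "convergent_part f c (card B) t y"
    using linB by (simp add: convergent_part_def)
  moreover have "infinite A \<or> card B \<le> card A" by (auto simp: B_def intro: card_mono)
  ultimately show ?thesis by blast
qed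

text \<open>Finite orders of equal size are isomorphic, so any \<open>j\<close> elements of
  \<open>A\<close> can be renamed to the given finite order. All other elements are renamed to
  numbers beyond the use, where the computation does not see them.\<close>

lemma convergent_part_extends:
  assumes \<alpha>: "well_ord (A, R)" and c: "convergent_part f c j t y" and j: "infinite A \<or> j \<le> card A"
  shows "\<exists>g\<in>copies (A, R). evalt (f \<uplus> g) c 0 y"
proof -
  have lin: "linear_ord (A, R)" using \<alpha> by (simp add: well_ord_def)
  define A0 R0 where "A0 = named_set (seq_of t)" and "R0 = named_rel (seq_of t)"
  have lin0: "linear_ord (A0, R0)" and card0: "card A0 = j" and ev: "evalt (f \<uplus> seq_of t) c 0 y"
    using c by (simp_all add: convergent_part_def A0_def R0_def)
  have fin0: "finite A0" by (simp add: A0_def finite_named_set)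
  obtain u where u: "\<And>q. \<forall>i<u. q i = (f \<uplus> seq_of t) i \<Longrightarrow> evalt q c 0 y"
    using evalt_use[OF ev] by blast
  obtain B where B: "B \<subseteq> A" "card B = j" "finite B"
    using j infinite_arbitrarily_large[of A j] obtain_subset_with_card_n[of j A] by metis
  have "ord_iso (B, R \<inter> B \<times> B) (A0, R0)"
    using B by (intro finite_linear_ords_iso linear_ord_restrict[OF lin] lin0 fin0) (simp_all add: card0)
  then obtain h0 where h0: "bij_betw h0 B A0"
    "\<And>x y. x \<in> B \<Longrightarrow> y \<in> B \<Longrightarrow> (x, y) \<in> R \<inter> B \<times> B \<longleftrightarrow> (h0 x, h0 y) \<in> R0"
    by (rule ord_isoE) (rule that; simp)
  \<comment> \<open>\<open>v\<close> exceeds the use and all of \<open>A0\<close>, so the new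
    elements \<open>v + x\<close> neither collide with \<open>A0\<close> nor show up below the
    use.\<close>
  define v where "v = Suc (u + Max (insert 0 A0))"
  have v: "x < v" if "x \<in> A0" for x
  proof -
    have "x \<le> Max (insert 0 A0)" using fin0 that by (intro Max_ge) auto
    then show ?thesis by (simp add: v_def)
  qed
  have "u < v" by (simp add: v_def)
  define h where "h x = (if x \<in> B then h0 x else v + x)" for x
  have hB: "h x \<in> A0" if "x \<in> B" for x using that h0(1) by (simp add: h_def bij_betw_apply)
  have hv: "h x \<ge> v" if "x \<notin> B" for x using that by (simp add: h_def)
  have inj: "inj_on h A"
  proof (rule inj_onI)
    fix x y assume *: "x \<in> A" "y \<in> A" "h x = h y"
    then have "x \<in> B \<longleftrightarrow> y \<in> B" using hB hv v by (metis leD)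
    then show "x = y"
      using *(3) h0(1) by (auto simp: h_def bij_betw_def inj_on_def split: if_splits)
  qed
  obtain A' R' where AR': "image_ord h (A, R) = (A', R')" by fastforce
  then have A': "A' = h ` A" and R': "R' = map_prod h h ` R" by (simp_all add: image_ord_def)
  have iso: "ord_iso (A, R) (A', R')"
    using ord_iso_image[OF lin inj] unfolding AR' .
  have sub: "R' \<subseteq> A' \<times> A'" using linear_ordD(1)[OF lin] unfolding A' R' by auto
  have wo: "well_ord (A', R')" by (rule well_ord_iso[OF iso \<alpha> sub])
  have small: "x \<in> A' \<longleftrightarrow> x \<in> A0" if "x < v" for x
  proof
    assume "x \<in> A'"
    then show "x \<in> A0" using that hB hv unfolding A' by (metis imageE leD)
  next
    assume "x \<in> A0"
    then obtain b where "b \<in> B" "h0 b = x" using h0(1) by (auto simp: bij_betw_def)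
    then show "x \<in> A'" unfolding A' using B(1) by (auto simp: h_def image_iff intro!: bexI[of _ b])
  qed
  have rel: "(x, y) \<in> R' \<longleftrightarrow> (x, y) \<in> R0" if "prod_encode (x, y) < u" for x y
  proof (cases "x \<in> A0 \<and> y \<in> A0")
    case True
    then obtain a b where ab: "a \<in> B" "h0 a = x" "b \<in> B" "h0 b = y"
      using h0(1) by (auto simp: bij_betw_def)
    then have "(h a, h b) \<in> R' \<longleftrightarrow> (a, b) \<in> R"
      unfolding R' using B(1) by (intro image_ord_iff[OF inj linear_ordD(1)[OF lin]]) auto
    then show ?thesis using ab h0(2)[of a b] by (simp add: h_def)
  next
    \<comment> \<open>Below \<open>v\<close> the copy has the elements of \<open>A0\<close> only, so
      the pair belongs to neither relation.\<close>
    case False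
    have "x < v" "y < v"
      using that \<open>u < v\<close> le_prod_encode_1[of x y] le_prod_encode_2[of y x] by linarith+
    then have "\<not> (x \<in> A' \<and> y \<in> A')" using False small by blast
    then show ?thesis using False sub linear_ordD(1)[OF lin0] by blast
  qed
  have small': "n \<in> A' \<longleftrightarrow> n \<in> named_set (seq_of t)" if "n < u" for n
    using small[of n] that \<open>u < v\<close> by (simp add: A0_def)
  obtain g where g: "wo_rep g = Some (A', R')" "\<And>i. i < u \<Longrightarrow> g i = seq_of t i"
    using wo_rep_splice[OF wo small' rel[unfolded R0_def]] by blast
  have "evalt (f \<uplus> g) c 0 y" by (rule u) (auto simp: join_def g(2))
  moreover have "g \<in> copies (A, R)" using g(1) iso by (auto simp: copies_def)
  ultimately show ?thesis by blast
qed

text \<open>\<open>z\<close> codes a triple: a finite order, a certificate and the value. The first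
  four conjuncts are the axioms of a strict linear order with quantifiers bounded by the code of the
  order. Every atom about that code has the form \<open>\<noteq> 0\<close>, even under a negation,
  so that it can be folded into membership.\<close>

definition part_witness :: "baire \<Rightarrow> nat \<Rightarrow> nat \<Rightarrow> nat \<Rightarrow> bool" where
  "part_witness f c j z \<longleftrightarrow>
     (\<forall>e<pfst z. seq_of (pfst z) (Suc (2 * e)) \<noteq> 0 \<longrightarrow>
        seq_of (pfst z) (2 * pfst e) \<noteq> 0 \<and> seq_of (pfst z) (2 * psnd e) \<noteq> 0) \<and>
     (\<forall>x<pfst z. \<not> seq_of (pfst z) (Suc (2 * prod_encode (x, x))) \<noteq> 0) \<and>
     (\<forall>x<pfst z. \<forall>y<pfst z. \<forall>w<pfst z. seq_of (pfst z) (Suc (2 * prod_encode (x, y))) \<noteq> 0 \<longrightarrow>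
        seq_of (pfst z) (Suc (2 * prod_encode (y, w))) \<noteq> 0 \<longrightarrow>
        seq_of (pfst z) (Suc (2 * prod_encode (x, w))) \<noteq> 0) \<and>
     (\<forall>x<pfst z. \<forall>y<pfst z. seq_of (pfst z) (2 * x) \<noteq> 0 \<longrightarrow> seq_of (pfst z) (2 * y) \<noteq> 0 \<longrightarrow>
        x = y \<or> seq_of (pfst z) (Suc (2 * prod_encode (x, y))) \<noteq> 0 \<or>
        seq_of (pfst z) (Suc (2 * prod_encode (y, x))) \<noteq> 0) \<and>
     card {x. x < pfst z \<and> seq_of (pfst z) (2 * x) \<noteq> 0} = j \<and>
     certificate (f \<uplus> seq_of (pfst z)) (pfst (psnd z)) \<and>
     listed (pfst (psnd z)) c 0 (psnd (psnd z))"

text \<open>Elements, and codes of related pairs, lie below the code of the order, so the bounded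
  axioms amount to the full ones.\<close>

lemma part_witness_iff:
  "part_witness f (tf_code c) j z \<longleftrightarrow>
     linear_ord (named_set (seq_of (pfst z)), named_rel (seq_of (pfst z))) \<and>
     card (named_set (seq_of (pfst z))) = j \<and>
     certificate (f \<uplus> seq_of (pfst z)) (pfst (psnd z)) \<and>
     listed (pfst (psnd z)) (tf_code c) 0 (psnd (psnd z))"
proof -
  define t where "t = pfst z"
  define A R where "A = named_set (seq_of t)" and "R = named_rel (seq_of t)"
  have A: "seq_of t (2 * x) \<noteq> 0 \<longleftrightarrow> x \<in> A" and R: "seq_of t (Suc (2 * prod_encode (x, y))) \<noteq> 0 \<longleftrightarrow> (x, y) \<in> R"
    for x y by (simp_all add: A_def R_def named_set_def named_rel_def)
  have R': "seq_of t (Suc (2 * e)) \<noteq> 0 \<longleftrightarrow> (pfst e, psnd e) \<in> R" for e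
    using R[of "pfst e" "psnd e"] by simp
  have At: "x < t" if "x \<in> A" for x
    using that seq_of_support[of t "2 * x"] by (simp flip: A)
  have Rt: "prod_encode (x, y) < t" if "(x, y) \<in> R" for x y
    using that seq_of_support[of t "Suc (2 * prod_encode (x, y))"] by (simp flip: R)
  have Rt': "x < t" "y < t" if "(x, y) \<in> R" for x y
    using Rt[OF that] le_prod_encode_1[of x y] le_prod_encode_2[of y x] by linarith+
  have card: "{x. x < t \<and> x \<in> A} = A" using At by blast
  have lin: "linear_ord (A, R) \<longleftrightarrow>
    (\<forall>e<t. (pfst e, psnd e) \<in> R \<longrightarrow> pfst e \<in> A \<and> psnd e \<in> A) \<and> (\<forall>x<t. (x, x) \<notin> R) \<and>
    (\<forall>x<t. \<forall>y<t. \<forall>w<t. (x, y) \<in> R \<longrightarrow> (y, w) \<in> R \<longrightarrow> (x, w) \<in> R) \<and>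
    (\<forall>x<t. \<forall>y<t. x \<in> A \<longrightarrow> y \<in> A \<longrightarrow> x = y \<or> (x, y) \<in> R \<or> (y, x) \<in> R)" (is "_ \<longleftrightarrow> ?rhs")
  proof
    assume "linear_ord (A, R)"
    note * = linear_ordD[OF this]
    show ?rhs using * by blast
  next
    assume rhs: ?rhs
    show "linear_ord (A, R)"
    proof (rule linear_ordI)
      show "R \<subseteq> A \<times> A"
      proof safe
        fix x y assume "(x, y) \<in> R"
        then show "x \<in> A" "y \<in> A"
          using rhs[THEN conjunct1, rule_format, of "prod_encode (x, y)"] Rt by simp_all
      qed
      show "(x, x) \<notin> R" for x using rhs Rt' by blast
      show "(x, z) \<in> R" if "(x, y) \<in> R" "(y, z) \<in> R" for x y z
        using rhs Rt'[OF that(1)] Rt'[OF that(2)] that by blast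
      show "(x, y) \<in> R \<or> (y, x) \<in> R" if "x \<in> A" "y \<in> A" "x \<noteq> y" for x y
        using rhs At[OF that(1)] At[OF that(2)] that by blast
    qed
  qed
  show ?thesis
    unfolding part_witness_def t_def[symmetric] A_def[symmetric] R_def[symmetric] A R R' pfst_pair psnd_pair card lin
    by (simp only: conj_assoc)
qed

text \<open>This makes the existence of a convergent order of size \<open>j\<close> a search for one
  number, that is, a question for \<open>LPO\<close>.\<close>

lemma part_witness_exists_iff: "(\<exists>z. part_witness f (tf_code c) j z) \<longleftrightarrow> (\<exists>t y. convergent_part f c j t y)"
proof
  assume "\<exists>z. part_witness f (tf_code c) j z"
  then show "\<exists>t y. convergent_part f c j t y"
    using certificate_sound unfolding part_witness_iff convergent_part_def by blast
next
  assume "\<exists>t y. convergent_part f c j t y"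
  then obtain t y where ty: "convergent_part f c j t y" by blast
  then obtain w where "certificate (f \<uplus> seq_of t) w" "listed w (tf_code c) 0 y"
    using certificate_complete unfolding convergent_part_def by blast
  then have "part_witness f (tf_code c) j (prod_encode (t, prod_encode (w, y)))"
    using ty unfolding part_witness_iff convergent_part_def by simp
  then show "\<exists>z. part_witness f (tf_code c) j z" ..
qed

lemma part_witness_convergent:
  "part_witness f (tf_code c) j z \<Longrightarrow> convergent_part f c j (pfst z) (psnd (psnd z))"
  using certificate_sound unfolding part_witness_iff convergent_part_def by blast

lemma decidable_on_part_witness:
  assumes f: "computable_on D (\<lambda>p. f p)"
    and "computable_on D C" "computable_on D J" "computable_on D Z"
  shows "decidable_on D (\<lambda>p x. part_witness (f p) (C p x) (J p x) (Z p x))"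
proof -
  have "computable_on D (\<lambda>p z. (f p \<uplus> seq_of (pfst (Z p (pfst z)))) (psnd z))"
    unfolding join_def by (intro comp_intros computable_on_compose[OF f] computable_on_compose[OF assms(4)])
  note cert = decidable_on_certificate[OF this]
  show ?thesis
    unfolding part_witness_def
    by (intro comp_intros assms cert computable_on_compose[OF assms(4)])
qed

section \<open>Unpacking names and reductions\<close>

lemma join_even [simp]: "(p \<uplus> q) (2 * n) = p n"
  and join_odd [simp]: "(p \<uplus> q) (Suc (2 * n)) = q n"
  by (simp_all add: join_def)

lemma list_rep_eq_Some:
  "list_rep \<delta> p = Some xs \<longleftrightarrow>
     length xs = p 0 \<and> (\<forall>i<p 0. \<delta> (\<lambda>n. p (Suc (prod_encode (i, n)))) = Some (xs ! i))"
proof -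
  have "None \<in> set (map f [0..<k]) \<longleftrightarrow> (\<exists>i<k. f i = None)" for f :: "nat \<Rightarrow> 'a option" and k
    by (auto simp: image_iff Bex_def)
  then show ?thesis
    unfolding list_rep_def Let_def
    by (auto simp: list_eq_iff_nth_eq) (metis option.collapse option.sel option.distinct(1))+
qed

lemma weihrauch_leI:
  assumes \<Phi>: "computable_on D \<Phi>" and \<Psi>: "computable_on E \<Psi>"
    and dom: "\<And>p x. in_rep f p = Some x \<Longrightarrow> x \<in> pdom f \<Longrightarrow> p \<in> D"
    and red: "\<And>p x. in_rep f p = Some x \<Longrightarrow> x \<in> pdom f \<Longrightarrow>
      \<exists>z. in_rep g (\<Phi> p) = Some z \<and> z \<in> pdom g \<and>
        (\<forall>q y. out_rep g q = Some y \<and> y \<in> sol g z \<longrightarrow>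
          p \<uplus> q \<in> E \<and> (\<exists>w. out_rep f (\<Psi> (p \<uplus> q)) = Some w \<and> w \<in> sol f x))"
  shows "f \<le>\<^sub>W g"
proof -
  have comp: "computable_baire (\<lambda>p. if p \<in> D then Some (F p) else None)" if "computable_on D F" for D F
    using that unfolding computable_baire_def computable_on_def computes_def by auto
  show ?thesis
    unfolding weihrauch_le_def
  proof (rule exI[of _ "\<lambda>p. if p \<in> D then Some (\<Phi> p) else None"],
      rule exI[of _ "\<lambda>r. if r \<in> E then Some (\<Psi> r) else None"], intro conjI allI impI)
    fix p x assume "in_rep f p = Some x \<and> x \<in> pdom f"
    then have px: "in_rep f p = Some x" "x \<in> pdom f" by blast+
    show "\<exists>r z. (if p \<in> D then Some (\<Phi> p) else None) = Some r \<and> in_rep g r = Some z \<and> z \<in> pdom g \<and>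
      (\<forall>q y. out_rep g q = Some y \<and> y \<in> sol g z \<longrightarrow>
        (\<exists>s w. (if p \<uplus> q \<in> E then Some (\<Psi> (p \<uplus> q)) else None) = Some s \<and>
          out_rep f s = Some w \<and> w \<in> sol f x))"
      using dom[OF px] red[OF px] by auto
  qed (intro comp \<Phi> \<Psi>)+
qed

lemma sol_names_copies:
  assumes "out_rep P = wo_rep" "\<alpha> \<in> sol P x"
    "\<And>\<beta>. ord_iso \<alpha> \<beta> \<Longrightarrow> well_ord \<beta> \<Longrightarrow> \<beta> \<in> sol P x"
  shows "copies \<alpha> \<subseteq> sol_names P x"
  using assms by (auto simp: copies_def sol_names_def wo_rep_def split: option.splits if_splits)

text \<open>Closure under isomorphism carries the argument: every copy of one solution is a
  solution, so a convergent finite order that is no larger than this solution leads to a correct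
  value.\<close>

lemma first_order_part_le_LPO:
  fixes P :: "('a, nat linord) problem"
  assumes rep: "out_rep P = wo_rep"
    and wo: "\<And>x \<alpha>. \<alpha> \<in> sol P x \<Longrightarrow> well_ord \<alpha>"
    and iso: "\<And>x \<alpha> \<beta>. \<alpha> \<in> sol P x \<Longrightarrow> ord_iso \<alpha> \<beta> \<Longrightarrow> well_ord \<beta> \<Longrightarrow> \<beta> \<in> sol P x"
  shows "first_order_part P \<le>\<^sub>W finite_parallelization LPO"
proof -
  \<comment> \<open>In a name of the triple, the function sits at the even places, and place
    \<open>3 = 2 * (2 * 0 + 1) + 1\<close> holds the code of the second functional.\<close>
  define W where "W p j z \<longleftrightarrow> part_witness (\<lambda>n. p (2 * n)) (p 3) j z" for p j z
  define D where "D = {p. \<exists>e. W p (pfst e) (psnd e)}"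
  define first where "first p = (LEAST e. W p (pfst e) (psnd e))" for p
  \<comment> \<open>Place \<open>0\<close> holds the number \<open>k\<close> of questions. Question
    \<open>j < k\<close> is the sequence that vanishes exactly at the witnesses for size
    \<open>j\<close>. Size \<open>k\<close> is not asked about, as its witness has been
    found.\<close>
  define \<Phi> where "\<Phi> p n = (if n = 0 then pfst (first p) else of_bool (\<not> W p (pfst (n - 1)) (psnd (n - 1))))"
    for p n
  \<comment> \<open>\<open>e\<close> codes a size and a witness. An answer \<open>0\<close> says
    that witnesses exist, so the size is the least one with answer \<open>0\<close>, or
    \<open>k\<close> if there is none. \<open>r 1\<close> is the length \<open>k\<close> of the list
    of answers.\<close>
  define good where "good r e \<longleftrightarrow> W (\<lambda>n. r (2 * n)) (pfst e) (psnd e) \<and>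
    (pfst e = r 1 \<or> pfst e < r 1 \<and> r (Suc (2 * Suc (prod_encode (pfst e, 0)))) = 0) \<and>
    (\<forall>i<pfst e. r (Suc (2 * Suc (prod_encode (i, 0)))) \<noteq> 0)" for r e
  define E where "E = {r. \<exists>e. good r e}"
  define \<Psi> :: "baire \<Rightarrow> nat \<Rightarrow> nat" where "\<Psi> r n = psnd (psnd (psnd (LEAST e. good r e)))" for r n
  have "computable_on D (\<lambda>p x. LEAST e. W p (pfst e) (psnd e))"
    unfolding W_def
    by (intro computable_on_Least decidable_on_part_witness comp_intros) (auto simp: D_def W_def)
  then have \<Phi>: "computable_on D \<Phi>"
    unfolding \<Phi>_def first_def W_def by (intro comp_intros decidable_on_part_witness)
  have \<Psi>: "computable_on E \<Psi>"
    unfolding \<Psi>_def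
    by (intro comp_intros computable_on_Least, unfold good_def W_def)
      (intro comp_intros decidable_on_part_witness, auto simp: E_def good_def W_def)
  show ?thesis
  proof (rule weihrauch_leI[OF \<Phi> \<Psi>])
    fix p X assume X: "in_rep (first_order_part P) p = Some X" "X \<in> pdom (first_order_part P)"
    obtain f \<phi> \<psi> where X_eq: "X = (f, \<phi>, \<psi>)" by (cases X)
    have f: "f = (\<lambda>n. p (2 * n))" and "tf_rep (\<lambda>n. p (2 * (2 * n + 1) + 1)) = Some \<psi>"
      using X(1) by (auto simp: first_order_part_def prod_rep_def baire_rep_def X_eq split: option.splits)
    then have \<psi>: "p 3 = tf_code \<psi>"
      by (auto simp: tf_rep_def numeral_3_eq_3 f_inv_into_f split: if_splits)
    obtain x where x: "fop_instance P (f, \<phi>, \<psi>) x"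
      using X(2) by (auto simp: first_order_part_def pdom_def X_eq)
    obtain \<alpha> where \<alpha>: "\<alpha> \<in> sol P x" using x by (auto simp: fop_instance_def pdom_def)
    obtain A R where AR: "\<alpha> = (A, R)" by fastforce
    have copies: "copies (A, R) \<subseteq> sol_names P x"
      using sol_names_copies[OF rep \<alpha>] iso[OF \<alpha>] AR by blast
    have wo_AR: "well_ord (A, R)" using wo[OF \<alpha>] AR by simp
    have W_ex: "(\<exists>z. W p j z) \<longleftrightarrow> (\<exists>t y. convergent_part f \<psi> j t y)" for j
      unfolding W_def \<psi> f by (rule part_witness_exists_iff)
    have "\<forall>g\<in>copies (A, R). \<exists>y. evalt (f \<uplus> g) \<psi> 0 y"
      using x copies by (auto simp: fop_instance_def)
    from convergent_part_exists[OF wo_AR this]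
    obtain j1 where j1_conv: "\<exists>t y. convergent_part f \<psi> j1 t y" and j1_card: "infinite A \<or> j1 \<le> card A"
      by metis
    then obtain z1 where j1: "W p j1 z1" using W_ex[of j1] by metis
    then have "W p (pfst (prod_encode (j1, z1))) (psnd (prod_encode (j1, z1)))" by simp
    then show "p \<in> D" unfolding D_def by blast
    then have first: "W p (pfst (first p)) (psnd (first p))"
      unfolding first_def D_def mem_Collect_eq by (rule LeastI_ex)
    define k where "k = pfst (first p)"
    define xs where "xs = map (\<lambda>j n. of_bool (\<not> W p j n) :: nat) [0..<k]"
    have xs: "in_rep (finite_parallelization LPO) (\<Phi> p) = Some xs"
      by (simp add: finite_parallelization_def LPO_def list_rep_eq_Some baire_rep_def xs_def \<Phi>_def k_def)
    have LPO_sol: "y \<in> sol LPO (xs ! i) \<longleftrightarrow> y = of_bool (\<not> (\<exists>z. W p i z))" if "i < k" for i y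
      using that by (auto simp: LPO_def xs_def)
    have "list_all2 (\<lambda>x y. y \<in> sol LPO x) xs (map (\<lambda>i. of_bool (\<not> (\<exists>z. W p i z))) [0..<k])"
      using LPO_sol by (auto simp: list_all2_conv_all_nth xs_def)
    then have dom: "xs \<in> pdom (finite_parallelization LPO)"
      by (auto simp: pdom_def finite_parallelization_def)
    define j where "j = (LEAST j. \<exists>z. W p j z)"
    have "\<exists>j z. W p j z" using j1 by blast
    then have j: "\<exists>z. W p j z" unfolding j_def by (rule LeastI_ex)
    have j_le: "j \<le> i" if "W p i z" for i z unfolding j_def by (rule Least_le) (use that in blast)
    have "j \<le> k" using j_le[OF first] by (simp add: k_def)
    have j_card: "infinite A \<or> j \<le> card A" using j_le[OF j1] j1_card by linarith
    have "p \<uplus> q \<in> E \<and>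
        (\<exists>w. out_rep (first_order_part P) (\<Psi> (p \<uplus> q)) = Some w \<and> w \<in> sol (first_order_part P) X)"
      if q: "out_rep (finite_parallelization LPO) q = Some ys" "ys \<in> sol (finite_parallelization LPO) xs"
      for q ys
    proof -
      have all2: "list_all2 (\<lambda>x y. y \<in> sol LPO x) xs ys"
        using q(2) by (simp add: finite_parallelization_def)
      have "length xs = k" by (simp add: xs_def)
      have "list_rep nat_rep q = Some ys" using q(1) by (simp add: finite_parallelization_def LPO_def)
      then have q': "length ys = q 0" "\<And>i. i < q 0 \<Longrightarrow> q (Suc (prod_encode (i, 0))) = ys ! i"
        by (simp_all add: list_rep_eq_Some nat_rep_def)
      have q0: "q 0 = k" using q'(1) list_all2_lengthD[OF all2] \<open>length xs = k\<close> by simp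
      have qi: "q (Suc (prod_encode (i, 0))) = of_bool (\<not> (\<exists>z. W p i z))" if "i < k" for i
        using LPO_sol[OF that] q'(2)[of i] list_all2_nthD[OF all2, of i] that q0 \<open>length xs = k\<close> by simp
      have good: "good (p \<uplus> q) e \<longleftrightarrow> W p (pfst e) (psnd e) \<and>
        (pfst e = k \<or> pfst e < k \<and> q (Suc (prod_encode (pfst e, 0))) = 0) \<and>
        (\<forall>i<pfst e. q (Suc (prod_encode (i, 0))) \<noteq> 0)" for e
        unfolding good_def join_even join_odd One_nat_def
        using join_odd[of p q 0] q0 by simp
      obtain z where z: "W p j z" using j by blast
      have "good (p \<uplus> q) (prod_encode (j, z))"
        unfolding good pfst_pair psnd_pair
      proof (intro conjI allI impI)
        show "j = k \<or> j < k \<and> q (Suc (prod_encode (j, 0))) = 0"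
          using qi[of j] \<open>j \<le> k\<close> z by (auto simp: le_less)
        fix i assume "i < j"
        then show "q (Suc (prod_encode (i, 0))) \<noteq> 0"
          using qi[of i] \<open>j \<le> k\<close> j_le[of i] by (auto simp: not_le[symmetric])
      qed (fact z)
      then have ex: "\<exists>e. good (p \<uplus> q) e" ..
      define e where "e = (LEAST e. good (p \<uplus> q) e)"
      have e: "good (p \<uplus> q) e" unfolding e_def using ex by (rule LeastI_ex)
      have We: "W p (pfst e) (psnd e)" using e by (simp add: good)
      \<comment> \<open>The witness found need not be the one that shows termination, but its size
        is at most the least convergent size, so its order also fits into \<open>A\<close>.\<close>
      have "pfst e \<le> j"
      proof (rule ccontr)
        assume "\<not> pfst e \<le> j"
        then have "j < pfst e" "pfst e \<le> k" using e by (auto simp: good)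
        then have "q (Suc (prod_encode (j, 0))) \<noteq> 0" "j < k" using e by (auto simp: good)
        then show False using qi[of j] j by simp
      qed
      then have card: "infinite A \<or> pfst e \<le> card A" using j_card by linarith
      have "convergent_part f \<psi> (pfst e) (pfst (psnd e)) (psnd (psnd (psnd e)))"
        using We unfolding W_def \<psi> f by (rule part_witness_convergent)
      from convergent_part_extends[OF wo_AR this card]
      obtain g where "g \<in> copies (A, R)" "evalt (f \<uplus> g) \<psi> 0 (psnd (psnd (psnd e)))" by blast
      then have "psnd (psnd (psnd e)) \<in> sol (first_order_part P) X"
        using x copies by (auto simp: first_order_part_def X_eq)
      moreover have "out_rep (first_order_part P) (\<Psi> (p \<uplus> q)) = Some (psnd (psnd (psnd e)))"
        by (simp add: first_order_part_def nat_rep_def \<Psi>_def e_def)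
      ultimately show ?thesis using ex by (simp add: E_def)
    qed
    then show "\<exists>z. in_rep (finite_parallelization LPO) (\<Phi> p) = Some z \<and>
      z \<in> pdom (finite_parallelization LPO) \<and>
      (\<forall>q y. out_rep (finite_parallelization LPO) q = Some y \<and> y \<in> sol (finite_parallelization LPO) z \<longrightarrow>
        p \<uplus> q \<in> E \<and>
        (\<exists>w. out_rep (first_order_part P) (\<Psi> (p \<uplus> q)) = Some w \<and> w \<in> sol (first_order_part P) X))"
      using xs dom by blast
  qed
qed

text \<open>The condition on a solution concerns the isomorphism types of the power and of its
  product with the rationals, and these depend only on the isomorphism type of the exponent.\<close>

lemma OG_le_LPO: "first_order_part OG_to_ordinal \<le>\<^sub>W finite_parallelization LPO"
proof (rule first_order_part_le_LPO)
  fix x and \<alpha> \<beta> :: "nat linord"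
  assume \<alpha>: "\<alpha> \<in> sol OG_to_ordinal x" and iso: "ord_iso \<alpha> \<beta>" and \<beta>: "well_ord \<beta>"
  note pow = int_pow_ord_iso[OF iso]
  note prod = ord_prod_ord_iso[OF pow ord_iso_refl[of rat_ord]]
  obtain G L where x: "x = (G, L)" by fastforce
  have "ord_iso (group_ord G L) (int_pow \<beta>) \<or> ord_iso (group_ord G L) (ord_prod (int_pow \<beta>) rat_ord)"
    using \<alpha> ord_iso_trans[OF _ pow, of "group_ord G L"] ord_iso_trans[OF _ prod, of "group_ord G L"]
    by (auto simp: OG_to_ordinal_def x)
  then show "\<beta> \<in> sol OG_to_ordinal x"
    using \<alpha> \<beta> by (simp add: OG_to_ordinal_def x)
qed (auto simp: OG_to_ordinal_def split: prod.splits)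


section \<open>Cantor's theorem on countable dense linear orders\<close>

lemma linear_ord_converse: "linear_ord (A, R) \<Longrightarrow> linear_ord (A, R\<inverse>)"
proof (rule linear_ordI)
  assume "linear_ord (A, R)"
  note R = linear_ordD[OF this]
  show "R\<inverse> \<subseteq> A \<times> A" using R(1) by blast
  show "(x, x) \<notin> R\<inverse>" for x using R(2) by blast
  show "(x, z) \<in> R\<inverse>" if "(x, y) \<in> R\<inverse>" "(y, z) \<in> R\<inverse>" for x y z using R(3) that by blast
  show "(x, y) \<in> R\<inverse> \<or> (y, x) \<in> R\<inverse>" if "x \<in> A" "y \<in> A" "x \<noteq> y" for x y using R(4)[OF that] by blast
qed

lemma linear_ord_finite_max:
  assumes "linear_ord (A, R)" "finite F" "F \<noteq> {}" "F \<subseteq> A"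
  shows "\<exists>m\<in>F. \<forall>x\<in>F. x \<noteq> m \<longrightarrow> (x, m) \<in> R"
  using assms(2-4)
proof (induction F rule: finite_ne_induct)
  case (insert a F)
  then obtain m where m: "m \<in> F" "\<And>x. x \<in> F \<Longrightarrow> x \<noteq> m \<Longrightarrow> (x, m) \<in> R" by auto
  have "a \<in> A" "m \<in> A" "a \<noteq> m" using insert m by auto
  then consider "(a, m) \<in> R" | "(m, a) \<in> R" using linear_ordD(4)[OF assms(1)] by blast
  then show ?case
  proof cases
    case 1
    then show ?thesis using m by (intro bexI[of _ m]) auto
  next
    case 2
    then have "(x, a) \<in> R" if "x \<in> F" for x
      using m(2)[OF that] linear_ordD(3)[OF assms(1)] by (cases "x = m") blast+
    then show ?thesis by (intro bexI[of _ a]) auto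
  qed
qed simp

definition dense_unbounded :: "'a linord \<Rightarrow> bool" where
  "dense_unbounded = (\<lambda>(A, R). linear_ord (A, R) \<and> A \<noteq> {} \<and>
     (\<forall>x y. (x, y) \<in> R \<longrightarrow> (\<exists>z. (x, z) \<in> R \<and> (z, y) \<in> R)) \<and>
     (\<forall>x\<in>A. (\<exists>y. (x, y) \<in> R) \<and> (\<exists>y. (y, x) \<in> R)))"

text \<open>The extension property behind back-and-forth. Density serves when both sets are
  inhabited, unboundedness when one is empty, and nonemptiness of \<open>B\<close> when both
  are.\<close>

lemma dense_unbounded_between:
  assumes B: "dense_unbounded (B, S)" and LU: "finite L" "L \<subseteq> B" "finite U" "U \<subseteq> B"
    "\<And>l u. l \<in> L \<Longrightarrow> u \<in> U \<Longrightarrow> (l, u) \<in> S"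
  shows "\<exists>y\<in>B. (\<forall>l\<in>L. (l, y) \<in> S) \<and> (\<forall>u\<in>U. (y, u) \<in> S)"
proof -
  have lin: "linear_ord (B, S)" and ne: "B \<noteq> {}"
    and dense: "\<And>x y. (x, y) \<in> S \<Longrightarrow> \<exists>z. (x, z) \<in> S \<and> (z, y) \<in> S"
    and unb: "\<And>x. x \<in> B \<Longrightarrow> (\<exists>y. (x, y) \<in> S) \<and> (\<exists>y. (y, x) \<in> S)"
    using B by (auto simp: dense_unbounded_def)
  note S = linear_ordD[OF lin]
  have max: "\<exists>m\<in>L. \<forall>l\<in>L. l \<noteq> m \<longrightarrow> (l, m) \<in> S" if "L \<noteq> {}"
    using linear_ord_finite_max[OF lin LU(1) that LU(2)] .
  have min: "\<exists>m\<in>U. \<forall>u\<in>U. u \<noteq> m \<longrightarrow> (m, u) \<in> S" if "U \<noteq> {}"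
    using linear_ord_finite_max[OF linear_ord_converse[OF lin] LU(3) that LU(4)] by simp
  have up: "(l, y) \<in> S" if "\<forall>l\<in>L. l \<noteq> m \<longrightarrow> (l, m) \<in> S" "(m, y) \<in> S" "l \<in> L" for m y l
    using that S(3) by (cases "l = m") blast+
  have down: "(y, u) \<in> S" if "\<forall>u\<in>U. u \<noteq> m \<longrightarrow> (m, u) \<in> S" "(y, m) \<in> S" "u \<in> U" for m y u
    using that S(3) by (cases "u = m") blast+
  consider "L = {}" "U = {}" | "L \<noteq> {}" "U = {}" | "L = {}" "U \<noteq> {}" | "L \<noteq> {}" "U \<noteq> {}" by blast
  then show ?thesis
  proof cases
    case 1
    then show ?thesis using ne by blast
  next
    case 2
    obtain m where m: "m \<in> L" "\<forall>l\<in>L. l \<noteq> m \<longrightarrow> (l, m) \<in> S" using max[OF 2(1)] by blast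
    obtain y where "(m, y) \<in> S" using m(1) LU(2) unb by blast
    then show ?thesis using up[OF m(2)] S(1) 2(2) by blast
  next
    case 3
    obtain m where m: "m \<in> U" "\<forall>u\<in>U. u \<noteq> m \<longrightarrow> (m, u) \<in> S" using min[OF 3(2)] by blast
    obtain y where "(y, m) \<in> S" using m(1) LU(4) unb by blast
    then show ?thesis using down[OF m(2)] S(1) 3(1) by blast
  next
    case 4
    obtain m where m: "m \<in> L" "\<forall>l\<in>L. l \<noteq> m \<longrightarrow> (l, m) \<in> S" using max[OF 4(1)] by blast
    obtain n where n: "n \<in> U" "\<forall>u\<in>U. u \<noteq> n \<longrightarrow> (n, u) \<in> S" using min[OF 4(2)] by blast
    obtain y where "(m, y) \<in> S" "(y, n) \<in> S" using dense[OF LU(5)[OF m(1) n(1)]] by blast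
    then show ?thesis using up[OF m(2)] down[OF n(2)] S(1) by blast
  qed
qed

definition partial_iso :: "'a linord \<Rightarrow> 'b linord \<Rightarrow> ('a \<times> 'b) set \<Rightarrow> bool" where
  "partial_iso X Y P \<longleftrightarrow> finite P \<and> P \<subseteq> fst X \<times> fst Y \<and>
     (\<forall>(x, y)\<in>P. \<forall>(x', y')\<in>P. (x = x' \<longleftrightarrow> y = y') \<and> ((x, x') \<in> snd X \<longleftrightarrow> (y, y') \<in> snd Y))"

lemma partial_isoD:
  assumes "partial_iso X Y P" "(x, y) \<in> P" "(x', y') \<in> P"
  shows "(x = x' \<longleftrightarrow> y = y') \<and> ((x, x') \<in> snd X \<longleftrightarrow> (y, y') \<in> snd Y)"
proof -
  have "\<forall>(x, y)\<in>P. \<forall>(x', y')\<in>P. (x = x' \<longleftrightarrow> y = y') \<and> ((x, x') \<in> snd X \<longleftrightarrow> (y, y') \<in> snd Y)"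
    using assms(1) by (simp add: partial_iso_def)
  from bspec[OF this assms(2)]
  have "\<forall>(x', y')\<in>P. (x = x' \<longleftrightarrow> y = y') \<and> ((x, x') \<in> snd X \<longleftrightarrow> (y, y') \<in> snd Y)" by simp
  from bspec[OF this assms(3)] show ?thesis by simp
qed

lemma partial_iso_converse: "partial_iso X Y P \<Longrightarrow> partial_iso Y X (P\<inverse>)"
  unfolding partial_iso_def by (auto 4 3)

text \<open>Density of the target supplies the step forth. The step back is the same statement for
  the converse.\<close>

lemma partial_iso_extend:
  assumes X: "linear_ord X" and Y: "dense_unbounded Y" and P: "partial_iso X Y P" and a: "a \<in> fst X"
  shows "\<exists>b. partial_iso X Y (insert (a, b) P)"
proof (cases "a \<in> Domain P")
  case True
  then show ?thesis using P by (metis DomainE insert_absorb)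
next
  case False
  obtain A R B S where XY: "X = (A, R)" "Y = (B, S)" by fastforce
  note R = linear_ordD[OF X[unfolded XY]]
  have linS: "linear_ord (B, S)" using Y unfolding XY dense_unbounded_def by simp
  note S = linear_ordD[OF linS]
  have P': "finite P" "P \<subseteq> A \<times> B"
    "\<And>x y x' y'. (x, y) \<in> P \<Longrightarrow> (x', y') \<in> P \<Longrightarrow> (x = x' \<longleftrightarrow> y = y') \<and> ((x, x') \<in> R \<longleftrightarrow> (y, y') \<in> S)"
    using P partial_isoD[OF P] unfolding XY partial_iso_def by simp_all
  define L U where "L = snd ` {(x, y). (x, y) \<in> P \<and> (x, a) \<in> R}"
    and "U = snd ` {(x, y). (x, y) \<in> P \<and> (a, x) \<in> R}"
  have "finite L" "finite U"
    unfolding L_def U_def using P'(1) by (auto intro!: finite_imageI intro: finite_subset[of _ P])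
  moreover have "L \<subseteq> B" "U \<subseteq> B" using P'(2) unfolding L_def U_def by auto
  moreover have "(l, u) \<in> S" if "l \<in> L" "u \<in> U" for l u
  proof -
    obtain x where "(x, l) \<in> P" "(x, a) \<in> R" using \<open>l \<in> L\<close> unfolding L_def by force
    moreover obtain x' where "(x', u) \<in> P" "(a, x') \<in> R" using \<open>u \<in> U\<close> unfolding U_def by force
    ultimately show ?thesis using P'(3) R(3) by blast
  qed
  ultimately obtain b where b: "b \<in> B" "\<And>l. l \<in> L \<Longrightarrow> (l, b) \<in> S" "\<And>u. u \<in> U \<Longrightarrow> (b, u) \<in> S"
    using dense_unbounded_between[OF Y[unfolded XY], of L U] by blast
  have aA: "a \<in> A" using a XY by simp
  have side: "((x, a) \<in> R \<longleftrightarrow> (y, b) \<in> S) \<and> ((a, x) \<in> R \<longleftrightarrow> (b, y) \<in> S) \<and> x \<noteq> a \<and> y \<noteq> b"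
    if "(x, y) \<in> P" for x y
  proof -
    have "x \<in> A" "x \<noteq> a" using that P'(2) False by auto
    then consider "(x, a) \<in> R" | "(a, x) \<in> R" using R(4)[OF \<open>x \<in> A\<close> aA] by blast
    then show ?thesis
    proof cases
      case 1
      then have "y \<in> L" using that unfolding L_def by force
      then have "(y, b) \<in> S" by (rule b(2))
      then show ?thesis using 1 R(2) R(3) S(2) S(3) \<open>x \<noteq> a\<close> by metis
    next
      case 2
      then have "y \<in> U" using that unfolding U_def by force
      then have "(b, y) \<in> S" by (rule b(3))
      then show ?thesis using 2 R(2) R(3) S(2) S(3) \<open>x \<noteq> a\<close> by metis
    qed
  qed
  have "partial_iso X Y (insert (a, b) P)"
    unfolding XY partial_iso_def fst_conv snd_conv
  proof (intro conjI ballI)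
    show "finite (insert (a, b) P)" "insert (a, b) P \<subseteq> A \<times> B" using P' aA b(1) by auto
    fix u assume u: "u \<in> insert (a, b) P"
    have "(x = x' \<longleftrightarrow> y = y') \<and> ((x, x') \<in> R \<longleftrightarrow> (y, y') \<in> S)"
      if "(x, y) \<in> insert (a, b) P" "(x', y') \<in> insert (a, b) P" for x y x' y'
      using that side[of x y] side[of x' y'] P'(3)[of x y x' y'] R(2) S(2) by auto
    then show "case u of (x, y) \<Rightarrow> \<forall>(x', y')\<in>insert (a, b) P. (x = x' \<longleftrightarrow> y = y') \<and> ((x, x') \<in> R \<longleftrightarrow> (y, y') \<in> S)"
      using u by auto
  qed
  then show ?thesis ..
qed

lemma cantor_ord_iso:
  assumes X: "dense_unbounded X" "countable (fst X)" and Y: "dense_unbounded Y" "countable (fst Y)"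
  shows "ord_iso X Y"
proof -
  define a b where "a = from_nat_into (fst X)" and "b = from_nat_into (fst Y)"
  have lin: "linear_ord X" "linear_ord Y" and ne: "fst X \<noteq> {}" "fst Y \<noteq> {}"
    using X(1) Y(1) by (auto simp: dense_unbounded_def)
  have ab: "range a = fst X" "range b = fst Y"
    unfolding a_def b_def using X(2) Y(2) ne by (simp_all add: range_from_nat_into)
  have "\<exists>P. \<forall>n. partial_iso X Y (P n) \<and> (P n \<subseteq> P (Suc n) \<and> a n \<in> Domain (P (Suc n)) \<and> b n \<in> Range (P (Suc n)))"
  proof (rule dependent_nat_choice)
    show "\<exists>P. partial_iso X Y P" by (rule exI[of _ "{}"]) (simp add: partial_iso_def)
    fix P n assume P: "partial_iso X Y P"
    have "a n \<in> fst X" "b n \<in> fst Y" using ab by blast+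
    obtain y where y: "partial_iso X Y (insert (a n, y) P)"
      using partial_iso_extend[OF lin(1) Y(1) P \<open>a n \<in> fst X\<close>] by blast
    obtain x where "partial_iso Y X (insert (b n, x) ((insert (a n, y) P)\<inverse>))"
      using partial_iso_extend[OF lin(2) X(1) partial_iso_converse[OF y] \<open>b n \<in> fst Y\<close>] by blast
    from partial_iso_converse[OF this]
    have "partial_iso X Y ((insert (b n, x) ((insert (a n, y) P)\<inverse>))\<inverse>)" .
    also have "(insert (b n, x) ((insert (a n, y) P)\<inverse>))\<inverse> = insert (x, b n) (insert (a n, y) P)" by auto
    finally have "partial_iso X Y (insert (x, b n) (insert (a n, y) P))" .
    then show "\<exists>Q. partial_iso X Y Q \<and> (P \<subseteq> Q \<and> a n \<in> Domain Q \<and> b n \<in> Range Q)" by blast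
  qed
  then obtain P where P: "\<And>n. partial_iso X Y (P n)" "\<And>n. P n \<subseteq> P (Suc n)"
    "\<And>n. a n \<in> Domain (P (Suc n))" "\<And>n. b n \<in> Range (P (Suc n))" by metis
  have mono: "P m \<subseteq> P n" if "m \<le> n" for m n using lift_Suc_mono_le[of P, OF P(2) that] .
  define U where "U = (\<Union>n. P n)"
  have iso: "(x = x' \<longleftrightarrow> y = y') \<and> ((x, x') \<in> snd X \<longleftrightarrow> (y, y') \<in> snd Y)"
    if xy: "(x, y) \<in> U" "(x', y') \<in> U" for x y x' y'
  proof -
    obtain m n where "(x, y) \<in> P m" "(x', y') \<in> P n" using xy unfolding U_def by blast
    then have "(x, y) \<in> P (max m n)" "(x', y') \<in> P (max m n)"
      using mono[of m "max m n"] mono[of n "max m n"] by auto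
    then show ?thesis by (rule partial_isoD[OF P(1)])
  qed
  have "P n \<subseteq> fst X \<times> fst Y" for n using P(1)[of n] by (simp add: partial_iso_def)
  then have sub: "U \<subseteq> fst X \<times> fst Y" unfolding U_def by blast
  have dom: "\<exists>y. (x, y) \<in> U" if x: "x \<in> fst X" for x
  proof -
    obtain n where "x = a n" using x unfolding ab(1)[symmetric] by auto
    then show ?thesis using P(3)[of n] unfolding U_def by blast
  qed
  have ran: "\<exists>x. (x, y) \<in> U" if y: "y \<in> fst Y" for y
  proof -
    obtain n where "y = b n" using y unfolding ab(2)[symmetric] by auto
    then show ?thesis using P(4)[of n] unfolding U_def by blast
  qed
  obtain h where h: "\<And>x. x \<in> fst X \<Longrightarrow> (x, h x) \<in> U" using dom by metis
  have "bij_betw h (fst X) (fst Y)"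
    unfolding bij_betw_def
  proof
    show "inj_on h (fst X)" using h iso by (metis inj_onI)
    show "h ` fst X = fst Y"
    proof
      show "h ` fst X \<subseteq> fst Y" using h sub by blast
      show "fst Y \<subseteq> h ` fst X"
      proof
        fix y assume "y \<in> fst Y"
        then obtain x where x: "(x, y) \<in> U" using ran by blast
        then have "x \<in> fst X" using sub by blast
        then have "h x = y" using h iso[OF x h[of x]] by blast
        then show "y \<in> h ` fst X" using \<open>x \<in> fst X\<close> by blast
      qed
    qed
  qed
  moreover have "(x, y) \<in> snd X \<longleftrightarrow> (h x, h y) \<in> snd Y" if "x \<in> fst X" "y \<in> fst X" for x y
    using iso[OF h[OF that(1)] h[OF that(2)]] by blast
  ultimately have "ord_iso (fst X, snd X) (fst Y, snd Y)" by (rule ord_isoI)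
  then show ?thesis by simp
qed

lemma dense_unbounded_rat: "dense_unbounded rat_ord"
proof -
  have "linear_ord rat_ord"
    unfolding rat_ord_def by (intro linear_ordI) auto
  moreover have "\<exists>z. x < z \<and> z < y" if "x < y" for x y :: rat using dense[OF that] .
  moreover have "\<exists>y. x < y" "\<exists>y. y < x" for x :: rat by (rule gt_ex lt_ex)+
  ultimately show ?thesis by (simp add: dense_unbounded_def rat_ord_def)
qed


section \<open>Finitely supported functions ordered lexicographically\<close>

lemma fin_supp_finite_diff:
  assumes "f \<in> fin_supp A" "g \<in> fin_supp A"
  shows "finite {x. f x \<noteq> g x}" "{x. f x \<noteq> g x} \<subseteq> A"
proof -
  have "{x. f x \<noteq> g x} \<subseteq> {x. f x \<noteq> 0} \<union> {x. g x \<noteq> 0}" by auto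
  moreover have "finite ({x. f x \<noteq> 0} \<union> {x. g x \<noteq> 0})" "{x. f x \<noteq> 0} \<union> {x. g x \<noteq> 0} \<subseteq> A"
    using assms by (auto simp: fin_supp_def)
  ultimately show "finite {x. f x \<noteq> g x}" "{x. f x \<noteq> g x} \<subseteq> A"
    by (auto dest: finite_subset)
qed

lemma int_less_total:
  assumes lin: "linear_ord (A, R)" and fg: "f \<in> fin_supp A" "g \<in> fin_supp A" "f \<noteq> g"
  shows "int_less A R f g \<or> int_less A R g f"
proof -
  have "{x. f x \<noteq> g x} \<noteq> {}" using fg(3) by auto
  from linear_ord_finite_max[OF lin fin_supp_finite_diff(1)[OF fg(1,2)] this fin_supp_finite_diff(2)[OF fg(1,2)]]
  obtain m where m: "f m \<noteq> g m" "\<And>x. f x \<noteq> g x \<Longrightarrow> x \<noteq> m \<Longrightarrow> (x, m) \<in> R" by blast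
  have "m \<in> A" using m(1) fin_supp_finite_diff(2)[OF fg(1,2)] by blast
  then show ?thesis
    using m unfolding int_less_def by (metis linorder_neqE_linordered_idom)
qed

lemma int_less_trans:
  assumes lin: "linear_ord (A, R)" and "int_less A R f g" "int_less A R g h"
  shows "int_less A R f h"
proof -
  note R = linear_ordD[OF lin]
  obtain x where x: "x \<in> A" "f x < g x" "\<And>w. w \<in> A \<Longrightarrow> f w \<noteq> g w \<Longrightarrow> w \<noteq> x \<Longrightarrow> (w, x) \<in> R"
    using assms(2) unfolding int_less_def by blast
  obtain y where y: "y \<in> A" "g y < h y" "\<And>w. w \<in> A \<Longrightarrow> g w \<noteq> h w \<Longrightarrow> w \<noteq> y \<Longrightarrow> (w, y) \<in> R"
    using assms(3) unfolding int_less_def by blast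
  consider "x = y" | "(x, y) \<in> R" | "(y, x) \<in> R" using R(4)[OF x(1) y(1)] by blast
  then show ?thesis
  proof cases
    case 1
    have "(w, x) \<in> R" if "w \<in> A" "f w \<noteq> h w" "w \<noteq> x" for w
      using x(3)[of w] y(3)[of w] that 1 by fastforce
    moreover have "f x < h x" using x(2) y(2) 1 by simp
    ultimately show ?thesis unfolding int_less_def using x(1) by (intro bexI[of _ x]) auto
  next
    case 2
    have "f y = g y" using x(3)[OF y(1)] R(2,3) 2 by blast
    have "(w, y) \<in> R" if "w \<in> A" "f w \<noteq> h w" "w \<noteq> y" for w
    proof (cases "f w = g w")
      case True
      then show ?thesis using y(3) that by metis
    next
      case False
      then have "w = x \<or> (w, x) \<in> R" using x(3) that(1) by blast
      then show ?thesis using 2 R(3) by blast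
    qed
    moreover have "f y < h y" using y(2) \<open>f y = g y\<close> by simp
    ultimately show ?thesis unfolding int_less_def using y(1) by (intro bexI[of _ y]) auto
  next
    case 3
    have "g x = h x" using y(3)[OF x(1)] R(2,3) 3 by blast
    have "(w, x) \<in> R" if "w \<in> A" "f w \<noteq> h w" "w \<noteq> x" for w
    proof (cases "g w = h w")
      case True
      then show ?thesis using x(3) that by metis
    next
      case False
      then have "w = y \<or> (w, y) \<in> R" using y(3) that(1) by blast
      then show ?thesis using 3 R(3) by blast
    qed
    moreover have "f x < h x" using x(2) \<open>g x = h x\<close> by simp
    ultimately show ?thesis unfolding int_less_def using x(1) by (intro bexI[of _ x]) auto
  qed
qed

lemma int_less_irrefl: "\<not> int_less A R f f"
  by (simp add: int_less_def)

lemma linear_ord_int_pow: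
  assumes "linear_ord (A, R)" shows "linear_ord (int_pow (A, R))"
  unfolding int_pow_eq
  using int_less_total[OF assms] int_less_trans[OF assms]
  by (intro linear_ordI) (auto simp: int_less_irrefl)

lemma int_less_add:
  "int_less A R (\<lambda>x. f x + h x) (\<lambda>x. g x + h x) \<longleftrightarrow> int_less A R f g"
  by (simp add: int_less_def)

lemma fin_supp_upd: "f \<in> fin_supp A \<Longrightarrow> a \<in> A \<Longrightarrow> f(a := i) \<in> fin_supp A"
proof -
  assume f: "f \<in> fin_supp A" and a: "a \<in> A"
  have "finite (insert a {x. f x \<noteq> 0})" "insert a {x. f x \<noteq> 0} \<subseteq> A"
    using f a by (auto simp: fin_supp_def)
  moreover have "{x. (f(a := i)) x \<noteq> 0} \<subseteq> insert a {x. f x \<noteq> 0}" by auto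
  ultimately show "f(a := i) \<in> fin_supp A"
    unfolding fin_supp_def by (blast dest: finite_subset)
qed

lemma int_less_upd: "a \<in> A \<Longrightarrow> i < j \<Longrightarrow> int_less A R (f(a := i)) (f(a := j))"
  unfolding int_less_def by (intro bexI[of _ a]) auto

text \<open>If the comparison of \<open>f\<close> with \<open>g\<close> is decided at
  \<open>x\<close>, raising \<open>f\<close> at a coordinate below \<open>x\<close> gives a function
  strictly between them. Such a coordinate exists because there is no least one.\<close>

lemma dense_unbounded_int_pow:
  assumes lin: "linear_ord (A, R)" and ne: "A \<noteq> {}" and no_min: "\<And>x. x \<in> A \<Longrightarrow> \<exists>y. (y, x) \<in> R"
  shows "dense_unbounded (int_pow (A, R))"
proof -
  note R = linear_ordD[OF lin]
  have unb: "\<exists>g\<in>fin_supp A. int_less A R f g" "\<exists>g\<in>fin_supp A. int_less A R g f" if "f \<in> fin_supp A" for f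
  proof -
    obtain a where a: "a \<in> A" using ne by blast
    show "\<exists>g\<in>fin_supp A. int_less A R f g"
      using fin_supp_upd[OF that a] int_less_upd[OF a, of "f a" "f a + 1" R f]
      by (intro bexI[of _ "f(a := f a + 1)"]) auto
    show "\<exists>g\<in>fin_supp A. int_less A R g f"
      using fin_supp_upd[OF that a] int_less_upd[OF a, of "f a - 1" "f a" R f]
      by (intro bexI[of _ "f(a := f a - 1)"]) auto
  qed
  have dense: "\<exists>h\<in>fin_supp A. int_less A R f h \<and> int_less A R h g"
    if fg: "f \<in> fin_supp A" "g \<in> fin_supp A" "int_less A R f g" for f g
  proof -
    obtain x where x: "x \<in> A" "f x < g x" "\<And>w. w \<in> A \<Longrightarrow> f w \<noteq> g w \<Longrightarrow> w \<noteq> x \<Longrightarrow> (w, x) \<in> R"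
      using fg(3) unfolding int_less_def by blast
    obtain y where y: "(y, x) \<in> R" using no_min[OF x(1)] by blast
    then have "y \<in> A" "y \<noteq> x" using R(1,2) by blast+
    have "int_less A R f (f(y := f y + 1))" using int_less_upd[OF \<open>y \<in> A\<close>, of "f y" "f y + 1" R f] by simp
    moreover have "int_less A R (f(y := f y + 1)) g"
      unfolding int_less_def using x y \<open>y \<noteq> x\<close> by (intro bexI[of _ x]) auto
    ultimately show ?thesis using fin_supp_upd[OF fg(1) \<open>y \<in> A\<close>] by blast
  qed
  have ne: "(\<lambda>x. 0) \<in> fin_supp A" by (simp add: fin_supp_def)
  show ?thesis
    unfolding int_pow_eq dense_unbounded_def prod.case
  proof (intro conjI ballI allI impI)
    show "linear_ord (fin_supp A, {(f, g). f \<in> fin_supp A \<and> g \<in> fin_supp A \<and> int_less A R f g})"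
      using linear_ord_int_pow[OF lin] by (simp add: int_pow_eq)
    show "fin_supp A \<noteq> {}" using ne by blast
  qed (use unb dense in blast)+
qed

definition val :: "nat \<Rightarrow> nat \<Rightarrow> int" where
  "val t i = int_decode (seq_of t i)"

lemma fin_supp_subset_range_val: "fin_supp A \<subseteq> range val"
proof
  fix f :: "nat \<Rightarrow> int" assume "f \<in> fin_supp A"
  then have "finite {i. int_encode (f i) \<noteq> int_encode 0}" by (simp add: fin_supp_def int_encode_eq)
  \<comment> \<open>The integer \<open>0\<close> has code \<open>0\<close>, so finite support
    survives the coding of values.\<close>
  then have "finite {i. int_encode (f i) \<noteq> 0}" by (simp add: int_encode_def sum_encode_def)
  from seq_of_finite_support[OF this]
  obtain t where "seq_of t = (\<lambda>i. int_encode (f i))" by blast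
  then have "f = val t" by (simp add: val_def fun_eq_iff)
  then show "f \<in> range val" by blast
qed

lemma countable_fin_supp: "countable (fin_supp (A :: nat set))"
  using fin_supp_subset_range_val by (rule countable_subset) simp

text \<open>A function is the pair of its restrictions. The coordinates in \<open>C\<close> lie
  above those in \<open>B\<close> and are compared first, hence \<open>C\<close> gives the more
  significant factor.\<close>

lemma int_pow_split:
  assumes lin: "linear_ord (A, R)" and A: "A = B \<union> C" and BC: "\<And>b c. b \<in> B \<Longrightarrow> c \<in> C \<Longrightarrow> (b, c) \<in> R"
  shows "ord_iso (int_pow (A, R)) (ord_prod (int_pow (B, R \<inter> B \<times> B)) (int_pow (C, R \<inter> C \<times> C)))"
proof -
  note R = linear_ordD[OF lin]
  define T where "T B f = (\<lambda>x. if x \<in> B then f x else (0::int))" for B :: "'a set" and f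
  have disj: "B \<inter> C = {}" using BC R(2) by blast
  have T: "T D f \<in> fin_supp D" if "f \<in> fin_supp A" for D f
  proof -
    have "{x. T D f x \<noteq> 0} \<subseteq> {x. f x \<noteq> 0}" by (auto simp: T_def)
    moreover have "finite {x. f x \<noteq> 0}" using that by (simp add: fin_supp_def)
    ultimately have "finite {x. T D f x \<noteq> 0}" by (rule finite_subset)
    then show ?thesis by (auto simp: fin_supp_def T_def)
  qed
  have add: "(\<lambda>x. f x + g x) \<in> fin_supp A" if "f \<in> fin_supp B" "g \<in> fin_supp C" for f g
  proof -
    have "{x. f x + g x \<noteq> 0} \<subseteq> {x. f x \<noteq> 0} \<union> {x. g x \<noteq> 0}" by auto
    moreover have "finite ({x. f x \<noteq> 0} \<union> {x. g x \<noteq> 0})" "{x. f x \<noteq> 0} \<union> {x. g x \<noteq> 0} \<subseteq> A"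
      using that A by (auto simp: fin_supp_def)
    ultimately show ?thesis unfolding fin_supp_def by (auto dest: finite_subset)
  qed
  have bij: "bij_betw (\<lambda>f. (T B f, T C f)) (fin_supp A) (fin_supp B \<times> fin_supp C)"
  proof (rule bij_betw_byWitness[where f' = "\<lambda>(f, g) x. f x + g x"])
    show "\<forall>f\<in>fin_supp A. (case (T B f, T C f) of (f, g) \<Rightarrow> \<lambda>x. f x + g x) = f"
      using disj A by (auto simp: T_def fin_supp_def fun_eq_iff)
    show "\<forall>p\<in>fin_supp B \<times> fin_supp C. (T B (case p of (f, g) \<Rightarrow> \<lambda>x. f x + g x),
        T C (case p of (f, g) \<Rightarrow> \<lambda>x. f x + g x)) = p"
      using disj by (fastforce simp: T_def fin_supp_def fun_eq_iff)
  qed (use T add in auto)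
  have less: "int_less A R f g \<longleftrightarrow> int_less C (R \<inter> C \<times> C) (T C f) (T C g) \<or>
      T C f = T C g \<and> int_less B (R \<inter> B \<times> B) (T B f) (T B g)" for f g
  proof
    assume "int_less A R f g"
    then obtain x where x: "x \<in> A" "f x < g x" "\<And>w. w \<in> A \<Longrightarrow> f w \<noteq> g w \<Longrightarrow> w \<noteq> x \<Longrightarrow> (w, x) \<in> R"
      unfolding int_less_def by blast
    show "int_less C (R \<inter> C \<times> C) (T C f) (T C g) \<or>
      T C f = T C g \<and> int_less B (R \<inter> B \<times> B) (T B f) (T B g)"
    proof (cases "x \<in> C")
      case True
      then have "int_less C (R \<inter> C \<times> C) (T C f) (T C g)"
        unfolding int_less_def using x A by (intro bexI[of _ x]) (auto simp: T_def)
      then show ?thesis ..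
    next
      case False
      then have "x \<in> B" using x(1) A by blast
      then have "int_less B (R \<inter> B \<times> B) (T B f) (T B g)"
        unfolding int_less_def using x A by (intro bexI[of _ x]) (auto simp: T_def)
      moreover have "f c = g c" if "c \<in> C" for c
        using x(3)[of c] that A BC[OF \<open>x \<in> B\<close> that] R(2,3) False by blast
      then have "T C f = T C g" by (auto simp: T_def)
      ultimately show ?thesis by blast
    qed
  next
    assume "int_less C (R \<inter> C \<times> C) (T C f) (T C g) \<or>
      T C f = T C g \<and> int_less B (R \<inter> B \<times> B) (T B f) (T B g)"
    then show "int_less A R f g"
    proof (elim disjE conjE)
      assume "int_less C (R \<inter> C \<times> C) (T C f) (T C g)"
      then obtain x where x: "x \<in> C" "f x < g x" "\<And>w. w \<in> C \<Longrightarrow> f w \<noteq> g w \<Longrightarrow> w \<noteq> x \<Longrightarrow> (w, x) \<in> R"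
        unfolding int_less_def T_def by auto
      then show ?thesis unfolding int_less_def using A BC by (intro bexI[of _ x]) auto
    next
      assume eq: "T C f = T C g" and "int_less B (R \<inter> B \<times> B) (T B f) (T B g)"
      then obtain x where x: "x \<in> B" "f x < g x" "\<And>w. w \<in> B \<Longrightarrow> f w \<noteq> g w \<Longrightarrow> w \<noteq> x \<Longrightarrow> (w, x) \<in> R"
        unfolding int_less_def T_def by auto
      have "f c = g c" if "c \<in> C" for c using fun_cong[OF eq, of c] that by (simp add: T_def)
      then show ?thesis unfolding int_less_def using A x by (intro bexI[of _ x]) auto
    qed
  qed
  show ?thesis
    unfolding int_pow_eq ord_prod_def prod.case
    by (rule ord_isoI[OF bij]) (use T in \<open>simp add: less; blast\<close>)
qed


section \<open>The exponent is determined by the order type\<close>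

definition between :: "'a linord \<Rightarrow> 'a \<Rightarrow> 'a \<Rightarrow> 'a \<Rightarrow> bool" where
  "between X x y z \<longleftrightarrow>
     (z = x \<or> (x, z) \<in> snd X) \<and> (z = y \<or> (z, y) \<in> snd X) \<or>
     (z = y \<or> (y, z) \<in> snd X) \<and> (z = x \<or> (z, x) \<in> snd X)"

text \<open>The iterated finite condensation: on \<open>\<int>\<^sup>\<alpha>\<rat>\<^sup>\<epsilon>\<close>, stage \<open>j\<close> identifies the functions that differ only
  in the \<open>j\<close> lowest coordinates, so for finite \<open>\<alpha>\<close> it first becomes stationary at stage \<open>|\<alpha>|\<close>.\<close>

primrec condensed :: "nat \<Rightarrow> 'a linord \<Rightarrow> 'a \<Rightarrow> 'a \<Rightarrow> bool" where
  "condensed 0 X x y \<longleftrightarrow> x = y"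
| "condensed (Suc j) X x y \<longleftrightarrow> (\<exists>F. finite F \<and> F \<subseteq> fst X \<and>
     (\<forall>z\<in>fst X. between X x y z \<longrightarrow> (\<exists>w\<in>F. condensed j X z w)))"

text \<open>Asks whether stage \<open>j + 1\<close> still identifies something new. On the orders
  considered the answer is yes for every \<open>j\<close> less than the size of the exponent and no
  at that size if it is finite, which separates the sizes.\<close>

definition gap :: "nat \<Rightarrow> 'a linord \<Rightarrow> bool" where
  "gap j X \<longleftrightarrow> (\<exists>x\<in>fst X. \<exists>y\<in>fst X. condensed (Suc j) X x y \<and> \<not> condensed j X x y)"

lemma between_commute: "between X x y z \<longleftrightarrow> between X y x z"
  unfolding between_def by blast

lemma condensed_commute: "condensed j X x y \<longleftrightarrow> condensed j X y x"
  by (cases j) (auto simp: between_commute[of X x y])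

lemma condensed_map:
  assumes h: "bij_betw h A B" "\<And>x y. x \<in> A \<Longrightarrow> y \<in> A \<Longrightarrow> (x, y) \<in> R \<longleftrightarrow> (h x, h y) \<in> S"
  shows "x \<in> A \<Longrightarrow> y \<in> A \<Longrightarrow> condensed j (A, R) x y \<Longrightarrow> condensed j (B, S) (h x) (h y)"
proof (induction j arbitrary: x y)
  case (Suc j)
  then obtain F where F: "finite F" "F \<subseteq> A"
    "\<And>z. z \<in> A \<Longrightarrow> between (A, R) x y z \<Longrightarrow> \<exists>w\<in>F. condensed j (A, R) z w"
    by auto
  have hA: "h z \<in> B" if "z \<in> A" for z using h(1) that by (simp add: bij_betw_apply)
  have eq: "h z = h w \<longleftrightarrow> z = w" if "z \<in> A" "w \<in> A" for z w
    using h(1) that by (meson bij_betw_imp_inj_on inj_onD)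
  have "\<exists>w\<in>h ` F. condensed j (B, S) z w" if z: "z \<in> B" "between (B, S) (h x) (h y) z" for z
  proof -
    obtain z' where z': "z' \<in> A" "z = h z'" using h(1) z(1) by (auto simp: bij_betw_def)
    have "between (A, R) x y z'"
      using z(2) Suc.prems(1,2) z'(1) unfolding between_def z'(2) by (simp add: eq h(2))
    then obtain w where "w \<in> F" "condensed j (A, R) z' w" using F(3)[OF z'(1)] by blast
    then show ?thesis using Suc.IH[OF z'(1)] F(2) z'(2) by blast
  qed
  moreover have "finite (h ` F)" "h ` F \<subseteq> B" using F hA by auto
  ultimately show ?case unfolding condensed.simps fst_conv by blast
qed simp

text \<open>The failure of stage \<open>j\<close> is carried over by the inverse isomorphism, since
  \<open>condensed_map\<close> preserves positive facts only.\<close>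

lemma gap_ord_iso:
  assumes "ord_iso X Y" "gap j X" shows "gap j Y"
proof -
  obtain A R B S where XY: "X = (A, R)" "Y = (B, S)" by fastforce
  obtain h where h: "bij_betw h A B" "\<And>x y. x \<in> A \<Longrightarrow> y \<in> A \<Longrightarrow> (x, y) \<in> R \<longleftrightarrow> (h x, h y) \<in> S"
    using assms(1) unfolding XY by (rule ord_isoE) (rule that; simp)
  define k where "k = inv_into A h"
  have k: "bij_betw k B A" unfolding k_def by (rule bij_betw_inv_into[OF h(1)])
  have k': "(x, y) \<in> S \<longleftrightarrow> (k x, k y) \<in> R" if "x \<in> B" "y \<in> B" for x y
    using h(2)[of "k x" "k y"] that k bij_betw_inv_into_right[OF h(1)] by (simp add: k_def bij_betw_apply)
  have kh: "k (h x) = x" "h x \<in> B" if "x \<in> A" for x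
    using that h(1) by (simp_all add: k_def bij_betw_inv_into_left bij_betw_apply)
  obtain x y where xy: "x \<in> A" "y \<in> A" "condensed (Suc j) (A, R) x y" "\<not> condensed j (A, R) x y"
    using assms(2) unfolding gap_def XY fst_conv by blast
  have "condensed (Suc j) (B, S) (h x) (h y)" by (rule condensed_map[OF h xy(1-3)])
  moreover have "\<not> condensed j (B, S) (h x) (h y)"
  proof
    assume "condensed j (B, S) (h x) (h y)"
    from condensed_map[OF k k' kh(2)[OF xy(1)] kh(2)[OF xy(2)] this]
    show False using xy kh(1) by simp
  qed
  ultimately show ?thesis unfolding gap_def XY fst_conv using kh(2) xy by blast
qed

definition initial_enum :: "'a linord \<Rightarrow> (nat \<Rightarrow> 'a) \<Rightarrow> nat \<Rightarrow> bool" where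
  "initial_enum X a n \<longleftrightarrow> (\<forall>i<n. a i \<in> fst X \<and> a i \<notin> a ` {..<i} \<and>
     (\<forall>x\<in>fst X. x \<notin> a ` {..<Suc i} \<longrightarrow> (a i, x) \<in> snd X))"

text \<open>Well-foundedness enters here: the remainder always has a least element. An infinite
  well-order has such an initial segment of every finite length.\<close>

lemma initial_enum_exists:
  assumes wo: "well_ord (A, R)" and n: "infinite A \<or> n \<le> card A"
  shows "\<exists>a. initial_enum (A, R) a n"
  using n
proof (induction n)
  case 0
  then show ?case by (simp add: initial_enum_def)
next
  case (Suc n)
  then obtain a where a: "initial_enum (A, R) a n" by auto
  have "A - a ` {..<n} \<noteq> {}"
  proof
    assume "A - a ` {..<n} = {}"
    then have "A \<subseteq> a ` {..<n}" by blast
    then have "finite A" "card A \<le> n"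
      using finite_subset[of A "a ` {..<n}"] surj_card_le[of "{..<n}" A a] by auto
    then show False using Suc.prems by simp
  qed
  moreover have "wf R" and lin: "linear_ord (A, R)" using wo by (simp_all add: well_ord_def)
  ultimately obtain m where m: "m \<in> A - a ` {..<n}" "\<And>y. (y, m) \<in> R \<Longrightarrow> y \<notin> A - a ` {..<n}"
    using wfE_min'[of R "A - a ` {..<n}"] by blast
  have least: "(m, x) \<in> R" if "x \<in> A" "x \<noteq> m" "x \<notin> a ` {..<n}" for x
    using linear_ordD(4)[OF lin, of m x] m that by blast
  have img: "(a(n := m)) ` {..<i} = a ` {..<i}" if "i \<le> n" for i
    using that by (intro image_cong) auto
  have "initial_enum (A, R) (a(n := m)) (Suc n)"
    unfolding initial_enum_def
  proof (intro allI impI)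
    fix i assume "i < Suc n"
    then consider "i < n" | "i = n" by linarith
    then show "(a(n := m)) i \<in> fst (A, R) \<and> (a(n := m)) i \<notin> (a(n := m)) ` {..<i} \<and>
      (\<forall>x\<in>fst (A, R). x \<notin> (a(n := m)) ` {..<Suc i} \<longrightarrow> ((a(n := m)) i, x) \<in> snd (A, R))"
    proof cases
      case 1
      then show ?thesis using a img[of i] img[of "Suc i"] by (simp add: initial_enum_def)
    next
      case 2
      have "(a(n := m)) ` {..<Suc n} = insert m (a ` {..<n})"
        unfolding lessThan_Suc image_insert img[OF order.refl] by simp
      then show ?thesis using 2 img[of n] m(1) least by simp
    qed
  qed
  then show ?case by blast
qed

text \<open>If the two functions differ at \<open>p\<close>, agreement above \<open>p\<close> makes
  \<open>p\<close> the deciding coordinate.\<close>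

lemma int_le_at:
  assumes lin: "linear_ord (A, R)" and le: "h = f \<or> int_less A R f h" and p: "p \<in> A"
    and agree: "\<And>y. y \<in> A \<Longrightarrow> (p, y) \<in> R \<Longrightarrow> f y = h y"
  shows "f p \<le> h p"
proof (cases "h = f")
  case False
  then obtain x where x: "x \<in> A" "f x < h x" "\<And>w. w \<in> A \<Longrightarrow> f w \<noteq> h w \<Longrightarrow> w \<noteq> x \<Longrightarrow> (w, x) \<in> R"
    using le unfolding int_less_def by blast
  then show ?thesis using p agree by (metis less_irrefl less_imp_le order.refl)
qed simp

text \<open>The factor \<open>(B, S)\<close> stands for the rationals or for a single point. Both
  have only infinite intervals between distinct points, so condensation never identifies different
  second components. This treats both values of \<epsilon> at once.\<close>

locale int_pow_prod =
  fixes A :: "'a set" and R :: "'a rel" and B :: "'b set" and S :: "'b rel"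
  assumes wo: "well_ord (A, R)"
    and linS: "linear_ord (B, S)"
    and B_ne: "B \<noteq> {}"
    and inf: "\<And>b c. (b, c) \<in> S \<Longrightarrow> infinite {d. (b, d) \<in> S \<and> (d, c) \<in> S}"
begin

abbreviation X :: "(('a \<Rightarrow> int) \<times> 'b) linord" where
  "X \<equiv> ord_prod (int_pow (A, R)) (B, S)"

lemma linR: "linear_ord (A, R)"
  using wo by (simp add: well_ord_def)

lemma fst_X: "fst X = fin_supp A \<times> B"
  by (simp add: ord_prod_def int_pow_eq)

lemma snd_X: "((f, b), (g, c)) \<in> snd X \<longleftrightarrow> f \<in> fin_supp A \<and> g \<in> fin_supp A \<and> b \<in> B \<and> c \<in> B \<and>
    ((b, c) \<in> S \<or> b = c \<and> int_less A R f g)"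
  by (auto simp: ord_prod_def int_pow_eq)

text \<open>If \<open>f\<close> and \<open>g\<close> agree outside \<open>a 0, ..., a j\<close> and
  \<open>b = c\<close>, whatever lies between is determined modulo stage \<open>j\<close> by its
  value at \<open>p = a j\<close>, an integer between \<open>f p\<close> and \<open>g p\<close>:
  finitely many classes. Otherwise all functions obtained by raising the lower one at
  \<open>p\<close> lie between: infinitely many classes.\<close>

lemma condensed_iff:
  assumes a: "initial_enum (A, R) a n"
  shows "j \<le> n \<Longrightarrow> f \<in> fin_supp A \<Longrightarrow> g \<in> fin_supp A \<Longrightarrow> b \<in> B \<Longrightarrow> c \<in> B \<Longrightarrow>
    condensed j X (f, b) (g, c) \<longleftrightarrow> b = c \<and> (\<forall>x\<in>A - a ` {..<j}. f x = g x)"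
proof (induction j arbitrary: f g b c)
  case 0
  then show ?case by (auto simp: fin_supp_def fun_eq_iff subset_iff) metis
next
  case (Suc j)
  note R = linear_ordD[OF linR] and S = linear_ordD[OF linS]
  define p where "p = a j"
  have p: "p \<in> A" "p \<notin> a ` {..<j}" and p_least: "\<And>x. x \<in> A \<Longrightarrow> x \<notin> a ` {..<j} \<Longrightarrow> x \<noteq> p \<Longrightarrow> (p, x) \<in> R"
    using a Suc.prems(1) by (auto simp: initial_enum_def p_def lessThan_Suc)
  have I: "a ` {..<Suc j} = insert p (a ` {..<j})" by (simp add: lessThan_Suc p_def)
  have up: "y \<notin> a ` {..<Suc j}" if "x \<in> A" "x \<notin> a ` {..<Suc j}" "(x, y) \<in> R" for x y
  proof
    assume "y \<in> a ` {..<Suc j}"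
    then obtain i where i: "i < Suc j" "y = a i" by blast
    then have "x \<notin> a ` {..<Suc i}" using that(2) by force
    then have "(y, x) \<in> R" using a that(1) i Suc.prems(1) by (simp add: initial_enum_def)
    then show False using that(3) R(2,3) by blast
  qed
  have IH: "condensed j X (f, b) (g, c) \<longleftrightarrow> b = c \<and> (\<forall>x\<in>A - a ` {..<j}. f x = g x)"
    if "f \<in> fin_supp A" "g \<in> fin_supp A" "b \<in> B" "c \<in> B" for f g b c
    using Suc.IH[OF _ that] Suc.prems(1) by simp
  have agree: "d = b \<and> (\<forall>x\<in>A - a ` {..<Suc j}. h x = f x) \<and> f p \<le> h p \<and> h p \<le> g p"
    if fg: "f \<in> fin_supp A" "g \<in> fin_supp A" "h \<in> fin_supp A" "b \<in> B"
      "\<forall>x\<in>A - a ` {..<Suc j}. f x = g x"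
      and z: "(h, d) = (f, b) \<or> ((f, b), (h, d)) \<in> snd X" "(h, d) = (g, b) \<or> ((h, d), (g, b)) \<in> snd X"
    for f g h b d
  proof -
    have d: "d = b" using z S(2,3) by (auto simp: snd_X)
    then have le: "h = f \<or> int_less A R f h" "g = h \<or> int_less A R h g"
      using z S(2) by (auto simp: snd_X)
    have out: "h x = f x" if "x \<in> A - a ` {..<Suc j}" for x
    proof (rule ccontr)
      \<comment> \<open>At the topmost coordinate outside the segment where \<open>h\<close> leaves
        \<open>f\<close>, it is squeezed between \<open>f\<close> and \<open>g\<close>, which
        coincide there.\<close>
      define D where "D = {x. h x \<noteq> f x} \<inter> (A - a ` {..<Suc j})"
      assume "h x \<noteq> f x"
      then have "D \<noteq> {}" using that by (auto simp: D_def)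
      moreover have "finite D" "D \<subseteq> A"
        using fin_supp_finite_diff[OF fg(3,1)] by (auto simp: D_def)
      ultimately obtain m where m: "m \<in> D" "\<And>y. y \<in> D \<Longrightarrow> y \<noteq> m \<Longrightarrow> (y, m) \<in> R"
        using linear_ord_finite_max[OF linR, of D] by blast
      have mA: "m \<in> A" "m \<notin> a ` {..<Suc j}" "h m \<noteq> f m" using m(1) by (auto simp: D_def)
      have above: "h y = f y" if y: "y \<in> A" "(m, y) \<in> R" for y
      proof (rule ccontr)
        assume "h y \<noteq> f y"
        then have "y \<in> D" using y up[OF mA(1,2) y(2)] by (simp add: D_def)
        then show False using m(2)[of y] y(2) R(2,3) by blast
      qed
      have above': "f y = g y" if "y \<in> A" "(m, y) \<in> R" for y
        using fg(5) up[OF mA(1,2) that(2)] that(1) by blast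
      have "f m \<le> h m" using above by (intro int_le_at[OF linR le(1) mA(1)]) simp
      moreover have "h m \<le> g m" using above above' by (intro int_le_at[OF linR le(2) mA(1)]) simp
      moreover have "g m = f m" using fg(5) mA by simp
      ultimately show False using mA(3) by simp
    qed
    have above: "h y = f y" "h y = g y" if "y \<in> A" "(p, y) \<in> R" for y
    proof -
      have "y \<notin> a ` {..<Suc j}"
      proof
        assume "y \<in> a ` {..<Suc j}"
        then have "y \<in> a ` {..<j}" using that(2) R(2)[of p] unfolding I by blast
        then obtain i where i: "i < j" "y = a i" by blast
        then have "p \<notin> a ` {..<Suc i}" using p(2) by force
        then have "(y, p) \<in> R" using a p(1) i Suc.prems(1) by (simp add: initial_enum_def)
        then show False using that(2) R(2,3) by blast
      qed
      then show "h y = f y" "h y = g y" using out fg(5) that(1) by auto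
    qed
    have "f p \<le> h p" using above(1) by (intro int_le_at[OF linR le(1) p(1)]) simp
    moreover have "h p \<le> g p" using above(2) by (intro int_le_at[OF linR le(2) p(1)]) simp
    ultimately show ?thesis using d out by blast
  qed
  have far: "\<not> condensed (Suc j) X (f, b) (g, c)"
    if fg: "f \<in> fin_supp A" "g \<in> fin_supp A" "b \<in> B" "c \<in> B" and less: "((f, b), (g, c)) \<in> snd X"
      and ne: "\<not> (b = c \<and> (\<forall>x\<in>A - a ` {..<Suc j}. f x = g x))" for f g b c
  proof
    assume "condensed (Suc j) X (f, b) (g, c)"
    then obtain F where F: "finite F" "F \<subseteq> fin_supp A \<times> B"
      "\<And>z. z \<in> fin_supp A \<times> B \<Longrightarrow> between X (f, b) (g, c) z \<Longrightarrow> \<exists>w\<in>F. condensed j X z w"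
      unfolding condensed.simps fst_X by blast
    \<comment> \<open>Each \<open>z i\<close> stays below the upper end, because the comparison is
      decided by the second components or at a coordinate above \<open>p\<close>. Different
      \<open>i\<close> give different values at \<open>p\<close>, hence different classes of stage
      \<open>j\<close>.\<close>
    define z where "z i = f(p := f p + int i)" for i
    have z: "z i \<in> fin_supp A" for i unfolding z_def by (rule fin_supp_upd[OF fg(1) p(1)])
    have lower: "z i = f \<or> int_less A R f (z i)" for i
      using int_less_upd[OF p(1), of "f p" "f p + int i" R f] by (cases "i = 0") (simp_all add: z_def)
    have upper: "(b, c) \<in> S \<or> b = c \<and> int_less A R (z i) g" for i
    proof (cases "(b, c) \<in> S")
      case False
      then have "b = c" "int_less A R f g" using less by (auto simp: snd_X)
      then obtain x where x: "x \<in> A" "f x < g x" "\<And>w. w \<in> A \<Longrightarrow> f w \<noteq> g w \<Longrightarrow> w \<noteq> x \<Longrightarrow> (w, x) \<in> R"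
        unfolding int_less_def by blast
      obtain y where y: "y \<in> A" "y \<notin> a ` {..<Suc j}" "f y \<noteq> g y" using ne \<open>b = c\<close> by blast
      have "x \<notin> a ` {..<Suc j}" using x(3)[OF y(1,3)] up[OF y(1,2), of x] y(2) by blast
      then have "x \<noteq> p" "(p, x) \<in> R" using p_least[OF x(1)] I by auto
      then have "int_less A R (z i) g"
        unfolding int_less_def z_def using x by (intro bexI[of _ x]) auto
      then show ?thesis using \<open>b = c\<close> by blast
    qed simp
    have "\<exists>w\<in>F. condensed j X (z i, b) w" for i
    proof (rule F(3))
      show "between X (f, b) (g, c) (z i, b)"
        using lower[of i] upper[of i] z fg by (auto simp: between_def snd_X)
    qed (simp add: z fg)
    then obtain w where w: "\<And>i. w i \<in> F" "\<And>i. condensed j X (z i, b) (w i)" by metis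
    have "fst (w i) p = f p + int i" for i
    proof -
      obtain h d where hd: "w i = (h, d)" by fastforce
      then have "h \<in> fin_supp A" "d \<in> B" using w(1)[of i] F(2) by auto
      then have "z i p = h p" using w(2)[of i] IH[OF z] fg(3) p unfolding hd by blast
      then show ?thesis by (simp add: hd z_def)
    qed
    then have "inj w" by (intro injI) (metis add_left_imp_eq of_nat_eq_iff)
    then have "infinite (range w)" using finite_imageD by blast
    then show False using F(1) w(1) by (meson finite_subset image_subsetI)
  qed
  show ?case
  proof
    assume *: "b = c \<and> (\<forall>x\<in>A - a ` {..<Suc j}. f x = g x)"
    define m M where "m = min (f p) (g p)" and "M = max (f p) (g p)"
    define F where "F = (\<lambda>i. (f(p := i), b)) ` {m..M}"
    have "\<exists>w\<in>F. condensed j X z w" if z: "z \<in> fin_supp A \<times> B" "between X (f, b) (g, c) z" for z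
    proof -
      obtain h d where hd: "z = (h, d)" by fastforce
      have h: "h \<in> fin_supp A" using z(1) hd by simp
      have eq: "c = b" using * by simp
      have fg: "\<forall>x\<in>A - a ` {..<Suc j}. f x = g x" "\<forall>x\<in>A - a ` {..<Suc j}. g x = f x" using * by auto
      have "d = b \<and> (\<forall>x\<in>A - a ` {..<Suc j}. h x = f x) \<and> h p \<in> {m..M}"
      proof -
        consider "(h, d) = (f, b) \<or> ((f, b), (h, d)) \<in> snd X" "(h, d) = (g, b) \<or> ((h, d), (g, b)) \<in> snd X"
          | "(h, d) = (g, b) \<or> ((g, b), (h, d)) \<in> snd X" "(h, d) = (f, b) \<or> ((h, d), (f, b)) \<in> snd X"
          using z(2) unfolding between_def hd eq by blast
        then show ?thesis
        proof cases
          case 1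
          from agree[OF Suc.prems(2,3) h Suc.prems(4) fg(1) 1] show ?thesis
            by (auto simp: m_def M_def)
        next
          case 2
          from agree[OF Suc.prems(3,2) h Suc.prems(4) fg(2) 2] fg(2) show ?thesis
            by (auto simp: m_def M_def)
        qed
      qed
      then have "condensed j X (h, d) (f(p := h p), b)" "(f(p := h p), b) \<in> F"
        using IH[OF h fin_supp_upd[OF Suc.prems(2) p(1)] Suc.prems(4) Suc.prems(4)] I
        by (auto simp: F_def)
      then show ?thesis unfolding hd by blast
    qed
    moreover have "finite F" "F \<subseteq> fin_supp A \<times> B"
      using fin_supp_upd[OF Suc.prems(2) p(1)] Suc.prems(4) by (auto simp: F_def)
    ultimately show "condensed (Suc j) X (f, b) (g, c)"
      unfolding condensed.simps fst_X by blast
  next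
    assume c: "condensed (Suc j) X (f, b) (g, c)"
    show "b = c \<and> (\<forall>x\<in>A - a ` {..<Suc j}. f x = g x)"
    proof (rule ccontr)
      assume ne: "\<not> (b = c \<and> (\<forall>x\<in>A - a ` {..<Suc j}. f x = g x))"
      then have ne': "\<not> (c = b \<and> (\<forall>x\<in>A - a ` {..<Suc j}. g x = f x))" by metis
      have "((f, b), (g, c)) \<in> snd X \<or> ((g, c), (f, b)) \<in> snd X"
        using Suc.prems ne S(4)[OF Suc.prems(4,5)] int_less_total[OF linR Suc.prems(2,3)]
        by (auto simp: snd_X)
      then show False
        using far[OF Suc.prems(2-5) _ ne] far[OF Suc.prems(3,2,5,4) _ ne'] c
          condensed_commute[of "Suc j" X "(f, b)" "(g, c)"] by blast
    qed
  qed
qed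

text \<open>The zero function and the unit vector at \<open>a j\<close> differ in exactly the
  coordinate that stage \<open>j + 1\<close> starts to ignore.\<close>

lemma gap_below:
  assumes "infinite A \<or> j < card A" shows "gap j X"
proof -
  obtain a where a: "initial_enum (A, R) a (Suc j)"
    using initial_enum_exists[OF wo, of "Suc j"] assms by auto
  then have aj: "a j \<in> A" "a j \<notin> a ` {..<j}" by (simp_all add: initial_enum_def)
  obtain b where b: "b \<in> B" using B_ne by blast
  define f :: "'a \<Rightarrow> int" where "f = (\<lambda>x. 0)"
  have f: "f \<in> fin_supp A" by (simp add: f_def fin_supp_def)
  note g = fin_supp_upd[OF f aj(1), of 1]
  have "condensed (Suc j) X (f, b) (f(a j := 1), b)"
    using condensed_iff[OF a _ f g b b, of "Suc j"] by (auto simp del: condensed.simps)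
  moreover have "\<not> condensed j X (f, b) (f(a j := 1), b)"
    using condensed_iff[OF a _ f g b b, of j] aj by (auto simp: f_def)
  ultimately show ?thesis unfolding gap_def fst_X using f g b by blast
qed

text \<open>With all coordinates used up, the classes are the fibres over \<open>B\<close>. A
  further identification would leave only finitely many points of \<open>B\<close> between two
  distinct ones.\<close>

lemma no_gap_at:
  assumes "finite A" shows "\<not> gap (card A) X"
proof
  define n where "n = card A"
  obtain a where a: "initial_enum (A, R) a n"
    using initial_enum_exists[OF wo, of n] by (auto simp: n_def)
  have aA: "a i \<in> A" "a i \<notin> a ` {..<i}" if "i < n" for i
    using a that by (simp_all add: initial_enum_def)
  have "inj_on a {..<n}" 
  proof (rule linorder_inj_onI)
    show "a x \<noteq> a y" if "x < y" "x \<in> {..<n}" "y \<in> {..<n}" for x y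
      using aA(2)[of y] that by (metis imageI lessThan_iff)
  qed auto
  then have "a ` {..<n} = A"
    using aA(1) assms by (intro card_subset_eq) (auto simp: card_image n_def)
  then have iff: "condensed n X (f, b) (g, c) \<longleftrightarrow> b = c"
    if "f \<in> fin_supp A" "g \<in> fin_supp A" "b \<in> B" "c \<in> B" for f g b c
    using condensed_iff[OF a order.refl that] by simp
  have no: False
    if fg: "f \<in> fin_supp A" "g \<in> fin_supp A" "b \<in> B" "c \<in> B" and bc: "(b, c) \<in> S"
      and cond: "condensed (Suc n) X (f, b) (g, c)" for f g b c
  proof -
    obtain F where F: "finite F" "F \<subseteq> fin_supp A \<times> B"
      "\<And>z. z \<in> fin_supp A \<times> B \<Longrightarrow> between X (f, b) (g, c) z \<Longrightarrow> \<exists>w\<in>F. condensed n X z w"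
      using cond unfolding condensed.simps fst_X by blast
    have "{d. (b, d) \<in> S \<and> (d, c) \<in> S} \<subseteq> snd ` F"
    proof safe
      fix d assume d: "(b, d) \<in> S" "(d, c) \<in> S"
      then have "d \<in> B" using linear_ordD(1)[OF linS] by blast
      have "between X (f, b) (g, c) (f, d)" using d fg \<open>d \<in> B\<close> by (simp add: between_def snd_X)
      then obtain h e where w: "(h, e) \<in> F" "condensed n X (f, d) (h, e)"
        using F(3)[of "(f, d)"] fg(1) \<open>d \<in> B\<close> by auto
      then have "d = e" using iff[OF fg(1) _ \<open>d \<in> B\<close>, of h e] F(2) by blast
      then show "d \<in> snd ` F" using w(1) by force
    qed
    then show False using inf[OF bc] F(1) finite_subset by blast
  qed
  assume "gap (card A) X"
  then obtain f b g c where fg: "f \<in> fin_supp A" "g \<in> fin_supp A" "b \<in> B" "c \<in> B"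
    "condensed (Suc n) X (f, b) (g, c)" "\<not> condensed n X (f, b) (g, c)"
    unfolding gap_def fst_X n_def by (auto simp del: condensed.simps)
  then have "b \<noteq> c" using iff by blast
  then consider "(b, c) \<in> S" | "(c, b) \<in> S" using linear_ordD(4)[OF linS fg(3,4)] by blast
  then show False
    using no[OF fg(1-4) _ fg(5)] no[OF fg(2,1,4,3) _ fg(5)[unfolded condensed_commute[of "Suc n" X "(f, b)"]]]
    by cases blast+
qed

end

text \<open>If the sizes differ, the smaller one is finite, and at that stage the larger exponent
  still has a gap while the smaller has none.\<close>

lemma card_determined_by_order_type:
  assumes X: "int_pow_prod A R B S" and Y: "int_pow_prod A' R' B' S'"
    and iso: "ord_iso (ord_prod (int_pow (A, R)) (B, S)) (ord_prod (int_pow (A', R')) (B', S'))"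
    and fin: "finite A"
  shows "finite A' \<and> card A' = card A"
proof (rule ccontr)
  assume ne: "\<not> (finite A' \<and> card A' = card A)"
  show False
  proof (cases "infinite A' \<or> card A < card A'")
    case True
    then show False
      using gap_ord_iso[OF ord_iso_sym[OF iso] int_pow_prod.gap_below[OF Y True]]
        int_pow_prod.no_gap_at[OF X fin] by blast
  next
    case False
    then have fin': "finite A'" and "infinite A \<or> card A' < card A" using ne by auto
    then show False
      using gap_ord_iso[OF iso int_pow_prod.gap_below[OF X]] int_pow_prod.no_gap_at[OF Y fin'] by blast
  qed
qed

lemma int_pow_prod_rat: "well_ord (A, R) \<Longrightarrow> int_pow_prod A R UNIV {(x, y). x < (y :: rat)}"
proof
  fix b c :: rat assume "(b, c) \<in> {(x, y). x < y}"
  then show "infinite {d. (b, d) \<in> {(x, y). x < y} \<and> (d, c) \<in> {(x, y). x < y}}"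
    using infinite_Ioo[of b c] by (simp add: greaterThanLessThan_def greaterThan_def lessThan_def Int_def)
qed (use dense_unbounded_rat in \<open>simp_all add: dense_unbounded_def rat_ord_def\<close>)

lemma int_pow_prod_unit: "well_ord (A, R) \<Longrightarrow> int_pow_prod A R {()} {}"
  by unfold_locales (auto intro: linear_ordI)

lemma ord_iso_prod_unit: "ord_iso (A, R) (ord_prod (A, R) ({()}, {}))" if "R \<subseteq> A \<times> A"
  unfolding ord_prod_def using that
  by (auto intro!: ord_isoI[of "\<lambda>x. (x, ())"] bij_betw_byWitness[of _ fst])


section \<open>The ordered group of finitely supported functions\<close>

text \<open>The insertion of indices in stages is encoded by one block number per index. A
  comparison consults \<open>b\<close> at two places and never has to be revised, so the finished
  order is computable from \<open>b\<close>.\<close>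

definition index_rel :: "(nat \<Rightarrow> nat) \<Rightarrow> nat rel" where
  "index_rel b = {(x, y). b x < b y \<or> b x = b y \<and> y < x}"

lemma linear_ord_index: "linear_ord (UNIV, index_rel b)"
  by (intro linear_ordI) (auto simp: index_rel_def)

text \<open>Above the points \<open>0 < 1 < \<dots> < m - 1\<close>, the index order has no least element as soon as
  infinitely many indices lie in the block \<open>m\<close>, because a block is ordered downwards.\<close>

lemma int_pow_index_iso:
  assumes b: "\<And>i. i < m \<Longrightarrow> b i = i" "\<And>x. x \<ge> m \<Longrightarrow> b x \<ge> m" "\<And>n. \<exists>x>n. b x = m"
  shows "ord_iso (int_pow (UNIV, index_rel b))
    (ord_prod (int_pow ({..<m}, index_rel b \<inter> {..<m} \<times> {..<m})) rat_ord)"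
proof -
  define C where "C = {m..}"
  define S where "S = index_rel b \<inter> C \<times> C"
  have "ord_iso (int_pow (UNIV, index_rel b))
      (ord_prod (int_pow ({..<m}, index_rel b \<inter> {..<m} \<times> {..<m})) (int_pow (C, S)))"
    unfolding S_def
  proof (rule int_pow_split[OF linear_ord_index])
    show "UNIV = {..<m} \<union> C" by (auto simp: C_def)
    show "(x, y) \<in> index_rel b" if "x \<in> {..<m}" "y \<in> C" for x y
      using b(1)[of x] b(2)[of y] that by (simp add: index_rel_def C_def)
  qed
  moreover have "ord_iso (int_pow (C, S)) rat_ord"
  proof (rule cantor_ord_iso)
    show "dense_unbounded (int_pow (C, S))"
    proof (rule dense_unbounded_int_pow)
      show "linear_ord (C, S)" unfolding S_def by (rule linear_ord_restrict[OF linear_ord_index]) simp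
      show "C \<noteq> {}" by (simp add: C_def)
      fix x assume "x \<in> C"
      obtain y where y: "y > x" "b y = m" using b(3) by blast
      have "y \<in> C" using y(2) b(1)[of y] by (cases "y < m") (auto simp: C_def)
      then have "(y, x) \<in> S" using \<open>x \<in> C\<close> y b(2)[of x] by (auto simp: S_def C_def index_rel_def)
      then show "\<exists>y. (y, x) \<in> S" ..
    qed
    show "countable (fst (int_pow (C, S)))" by (simp add: int_pow_eq countable_fin_supp)
    show "dense_unbounded rat_ord" by (rule dense_unbounded_rat)
    show "countable (fst rat_ord)" by simp
  qed
  ultimately show ?thesis
    by (rule ord_iso_trans[OF _ ord_prod_ord_iso[OF ord_iso_refl]])
qed

section \<open>Arithmetic on codes and the group it defines\<close>

lemma int_decode_parity: "int_decode n = (if even n then int (n div 2) else - int (n div 2) - 1)"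
  by (simp add: int_decode_def sum_decode_def)

lemma val_eq_iff: "val x i = val y i \<longleftrightarrow> seq_of x i = seq_of y i"
  by (simp add: val_def int_decode_eq)

lemma bij_val: "bij_betw val UNIV (fin_supp UNIV)"
  unfolding bij_betw_def
proof
  show "inj val"
  proof (rule injI)
    fix x y assume "val x = val y"
    then have "seq_of x = seq_of y" using val_eq_iff by (metis ext)
    then show "x = y" by (rule inj_seq_of)
  qed
  have "val t \<in> fin_supp UNIV" for t
  proof -
    have "{i. val t i \<noteq> 0} \<subseteq> {..<t}"
    proof (rule subsetI, rule ccontr)
      fix i assume i: "i \<in> {i. val t i \<noteq> 0}" "i \<notin> {..<t}"
      then have "seq_of t i = 0" using seq_of_support[of t i] by auto
      then show False using i(1) by (simp add: val_def int_decode_parity)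
    qed
    then show ?thesis by (auto simp: fin_supp_def intro: finite_subset)
  qed
  then show "range val = fin_supp UNIV" using fin_supp_subset_range_val by blast
qed

lemma val_inj: "val x = val y \<longleftrightarrow> x = y"
  using bij_val by (auto simp: bij_betw_def inj_on_def)

text \<open>Codes \<open>2 * n\<close> and \<open>2 * n + 1\<close> stand for the integers
  \<open>n\<close> and \<open>- n - 1\<close>. The cases follow the signs and stay within operations
  already known to be computable.\<close>

definition int_code_add :: "nat \<Rightarrow> nat \<Rightarrow> nat" where
  "int_code_add a b =
     (if even a then
        if even b then a + b
        else if b div 2 < a div 2 then 2 * (a div 2 - b div 2 - 1) else Suc (2 * (b div 2 - a div 2))
      else if even b then
        if a div 2 < b div 2 then 2 * (b div 2 - a div 2 - 1) else Suc (2 * (a div 2 - b div 2))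
      else Suc (2 * Suc (a div 2 + b div 2)))"

lemma int_decode_add: "int_decode (int_code_add a b) = int_decode a + int_decode b"
  by (cases "even a"; cases "even b")
    (auto elim!: evenE oddE simp: int_code_add_def int_decode_parity of_nat_diff)

text \<open>A code nests its tail, so the sum is built from the last entry to the first. Entries
  from \<open>x + y\<close> on vanish in both arguments.\<close>

definition code_add :: "nat \<Rightarrow> nat \<Rightarrow> nat" where
  "code_add x y = rec_nat 0
     (\<lambda>i r. prod_encode (r, int_code_add (seq_of x (x + y - Suc i)) (seq_of y (x + y - Suc i)))) (x + y)"

lemma seq_of_rec:
  assumes "j \<le> n"
  shows "seq_of (rec_nat 0 (\<lambda>i r. prod_encode (r, f (n - Suc i))) j) l = (if l < j then f (n - j + l) else 0)"
  using assms
proof (induction j arbitrary: l)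
  case (Suc j)
  then show ?case
  proof (cases l)
    case (Suc l')
    have "n - Suc j + Suc l' = n - j + l'" using Suc.prems by simp
    then show ?thesis using Suc.IH[of l'] Suc.prems Suc by simp
  qed simp
qed simp

lemma val_code_add: "val (code_add x y) i = val x i + val y i"
proof (cases "i < x + y")
  case True
  then show ?thesis
    using seq_of_rec[of "x + y" "x + y" "\<lambda>i. int_code_add (seq_of x i) (seq_of y i)" i]
    by (simp add: val_def code_add_def int_decode_add)
next
  case False
  then have "seq_of x i = 0" "seq_of y i = 0"
    using seq_of_support[of x i] seq_of_support[of y i] by auto
  moreover have "seq_of (code_add x y) i = 0"
    using False seq_of_rec[of "x + y" "x + y" "\<lambda>i. int_code_add (seq_of x i) (seq_of y i)" i]
    by (simp add: code_add_def)
  ultimately show ?thesis by (simp add: val_def int_decode_parity)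
qed

definition code_less :: "(nat \<Rightarrow> nat) \<Rightarrow> nat \<Rightarrow> nat \<Rightarrow> bool" where
  "code_less b x y \<longleftrightarrow> int_less UNIV (index_rel b) (val x) (val y)"

definition code_le :: "(nat \<Rightarrow> nat) \<Rightarrow> nat rel" where
  "code_le b = {(x, y). x = y \<or> code_less b x y}"

text \<open>Formed by \<open>mk_group\<close> so that it is literally the group that
  \<open>og_rep\<close> decodes, including the choice of the neutral element.\<close>

definition code_group :: "nat monoid" where
  "code_group = mk_group UNIV code_add"

lemma code_group_simps [simp]:
  "carrier code_group = UNIV" "mult code_group = code_add"
  by (simp_all add: code_group_def mk_group_def restrict_def)

lemma group_code_group: "group code_group"
proof -
  have assoc: "code_add (code_add x y) z = code_add x (code_add y z)" for x y z
    by (subst val_inj[symmetric]) (simp add: fun_eq_iff val_code_add)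
  have val_0: "val 0 i = 0" for i by (simp add: val_def int_decode_parity)
  have zero: "code_add 0 x = x" "code_add x 0 = x" for x
    by (subst val_inj[symmetric], simp add: fun_eq_iff val_code_add val_0)+
  have one: "\<one>\<^bsub>code_group\<^esub> = 0"
    unfolding code_group_def mk_group_def monoid.simps
    using zero by (intro the_equality) (simp, metis UNIV_I)
  \<comment> \<open>A name contains only the operation, so existence of the inverse suffices, and it
    follows from surjectivity of \<open>val\<close>.\<close>
  have inverse: "\<exists>y. code_add y x = 0" for x
  proof -
    have "(\<lambda>i. - val x i) \<in> fin_supp UNIV" using bij_val by (auto simp: bij_betw_def fin_supp_def)
    then obtain y where "val y = (\<lambda>i. - val x i)" using bij_val by (metis bij_betw_imp_surj_on imageE)
    then have "code_add y x = 0" by (subst val_inj[symmetric]) (simp add: fun_eq_iff val_code_add val_0)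
    then show ?thesis ..
  qed
  show ?thesis
    by (rule groupI) (simp_all add: one assoc zero inverse)
qed

text \<open>Comparison depends only on coordinatewise differences, hence is invariant under
  translation. This holds for every \<open>b\<close>, so the blocks can be chosen freely.\<close>

lemma ordered_group_code: "ordered_group code_group (code_le b)"
proof -
  have fin: "val x \<in> fin_supp UNIV" for x using bij_val by (auto simp: bij_betw_def)
  have trans: "code_less b x y \<Longrightarrow> code_less b y z \<Longrightarrow> code_less b x z" for x y z
    unfolding code_less_def by (rule int_less_trans[OF linear_ord_index])
  have irrefl: "\<not> code_less b x x" for x by (simp add: code_less_def int_less_irrefl)
  have total: "x \<noteq> y \<Longrightarrow> code_less b x y \<or> code_less b y x" for x y
    unfolding code_less_def using int_less_total[OF linear_ord_index fin fin] by (simp add: val_inj)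
  have val_add: "val (code_add x y) = (\<lambda>i. val x i + val y i)" for x y
    by (simp add: fun_eq_iff val_code_add)
  have mono: "code_less b (code_add x g) (code_add y g)" "code_less b (code_add g x) (code_add g y)"
    if "code_less b x y" for x y g
    using that unfolding code_less_def val_add by (simp_all add: int_less_add add.commute[of "val g _"])
  have "linear_order_on UNIV (code_le b)"
    unfolding linear_order_on_def partial_order_on_def preorder_on_def total_on_def
    using total
    by (auto simp: code_le_def refl_on_def intro!: transI antisymI dest: trans)
      (metis irrefl trans)
  then show ?thesis
    using group_code_group mono by (auto simp: ordered_group_def code_le_def)
qed

lemma group_ord_code_iso: "ord_iso (group_ord code_group (code_le b)) (int_pow (UNIV, index_rel b))"
proof -
  have "(x, y) \<in> code_le b - Id \<longleftrightarrow> code_less b x y" for x y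
    by (auto simp: code_le_def code_less_def int_less_irrefl)
  then show ?thesis
    unfolding group_ord_def int_pow_eq using bij_val
    by (intro ord_isoI[of val]) (auto simp: code_less_def bij_betw_def)
qed

text \<open>The functions differ only below \<open>x + y\<close>, which bounds the search for the
  deciding coordinate. Among codes of integers, the odd ones are negative and run in
  reverse.\<close>

lemma code_less_bounded:
  "code_less b x y \<longleftrightarrow> (\<exists>i<x + y. seq_of x i \<noteq> seq_of y i \<and>
     (\<forall>j<x + y. seq_of x j \<noteq> seq_of y j \<and> j \<noteq> i \<longrightarrow> b j < b i \<or> b j = b i \<and> i < j) \<and>
     (even (seq_of x i) \<and> even (seq_of y i) \<and> seq_of x i < seq_of y i \<or>
      \<not> even (seq_of x i) \<and> even (seq_of y i) \<or>
      \<not> even (seq_of x i) \<and> \<not> even (seq_of y i) \<and> seq_of y i < seq_of x i))"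
proof -
  have less: "int_decode m < int_decode n \<longleftrightarrow>
    even m \<and> even n \<and> m < n \<or> \<not> even m \<and> even n \<or> \<not> even m \<and> \<not> even n \<and> n < m" for m n
    unfolding int_decode_parity by (auto elim!: evenE oddE)
  have bound: "i < x + y" if "seq_of x i \<noteq> seq_of y i" for i
    using seq_of_support[of x i] seq_of_support[of y i] that by (metis trans_less_add1 trans_less_add2)
  show ?thesis
    unfolding code_less_def int_less_def val_eq_iff less[symmetric] val_def[symmetric] index_rel_def
    using bound by auto
qed

text \<open>The layout is dictated by \<open>prod_rep\<close>: the universe at the even places, the
  operation and the order at the odd ones, again split by parity.\<close>

definition group_name :: "(nat \<Rightarrow> nat) \<Rightarrow> baire" where
  "group_name b n =
     (if even n then 1
      else if even (n div 2) then code_add (pfst (n div 2 div 2)) (psnd (n div 2 div 2))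
      else of_bool (pfst (n div 2 div 2) = psnd (n div 2 div 2) \<or>
        code_less b (pfst (n div 2 div 2)) (psnd (n div 2 div 2))))"

lemma og_rep_group_name: "og_rep (group_name b) = Some (code_group, code_le b)"
proof -
  have "prod_rep set_rep (prod_rep baire_rep rel_rep) (group_name b) =
    Some (UNIV, (\<lambda>n. code_add (pfst n) (psnd n)), code_le b)"
    by (simp add: prod_rep_def set_rep_def baire_rep_def rel_rep_def group_name_def code_le_def)
  then show ?thesis
    using ordered_group_code[of b] by (simp add: og_rep_def Let_def flip: code_group_def)
qed

lemma computable_on_group_name:
  assumes b: "computable_on D b" shows "computable_on D (\<lambda>p. group_name (b p))"
proof -
  have add: "computable_on D (\<lambda>p x. code_add (F p x) (G p x))"
    if "computable_on D F" "computable_on D G" for F G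
    unfolding code_add_def int_code_add_def
    by (intro comp_intros that computable_on_compose[OF that(1)] computable_on_compose[OF that(2)])
  have less: "decidable_on D (\<lambda>p x. code_less (b p) (F p x) (G p x))"
    if "computable_on D F" "computable_on D G" for F G
    unfolding code_less_bounded
    by (intro comp_intros that computable_on_compose[OF b]
        computable_on_compose[OF that(1)] computable_on_compose[OF that(2)])
  show ?thesis unfolding group_name_def by (intro comp_intros add less)
qed


section \<open>Reducing finitely many instances of LPO to the first-order part\<close>

text \<open>In the limit, the block of a late index is the number of sequences without a zero;
  \<open>p 0\<close> is the length of the list of sequences named by \<open>p\<close>.\<close>

definition zeros_found :: "baire \<Rightarrow> nat \<Rightarrow> nat" where
  "zeros_found p s = card {i. i < p 0 \<and> (\<exists>n<s. p (Suc (prod_encode (i, n))) = 0)}"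

text \<open>Index \<open>p 0 + s\<close> enters at stage \<open>s\<close>: its block is the current
  guess, and being the latest it goes to the bottom of that block.\<close>

definition block :: "baire \<Rightarrow> nat \<Rightarrow> nat" where
  "block p x = (if x < p 0 then x else p 0 - zeros_found p (x - p 0))"

definition zero_free :: "baire \<Rightarrow> nat" where
  "zero_free p = p 0 - card {i. i < p 0 \<and> (\<exists>n. p (Suc (prod_encode (i, n))) = 0)}"

lemma zeros_found_le: "zeros_found p s \<le> card {i. i < p 0 \<and> (\<exists>n. p (Suc (prod_encode (i, n))) = 0)}"
  unfolding zeros_found_def by (rule card_mono) auto

lemma zeros_found_eventually:
  "\<exists>s0. \<forall>s\<ge>s0. {i. i < p 0 \<and> (\<exists>n<s. p (Suc (prod_encode (i, n))) = 0)} =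
     {i. i < p 0 \<and> (\<exists>n. p (Suc (prod_encode (i, n))) = 0)}"
proof -
  define N where "N i = (SOME n. p (Suc (prod_encode (i, n))) = 0)" for i
  have N: "p (Suc (prod_encode (i, N i))) = 0" if "p (Suc (prod_encode (i, m))) = 0" for i m
    unfolding N_def using that by (rule someI)
  have le: "N i \<le> (\<Sum>i<p 0. N i)" if "i < p 0" for i
    using that by (intro member_le_sum) auto
  have "\<exists>n<s. p (Suc (prod_encode (i, n))) = 0"
    if "s \<ge> Suc (\<Sum>i<p 0. N i)" "i < p 0" "p (Suc (prod_encode (i, m))) = 0" for s i m
    using N[OF that(3)] le[OF that(2)] that(1) by (intro exI[of _ "N i"]) linarith
  then show ?thesis by (intro exI[of _ "Suc (\<Sum>i<p 0. N i)"]) blast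
qed

lemma block_small: "i < zero_free p \<Longrightarrow> block p i = i"
  using diff_le_self[of "p 0"] unfolding block_def zero_free_def by (simp add: less_le_trans)

text \<open>A stage never finds more sequences with a zero than there are, so no guess drops below
  the limit.\<close>

lemma block_large: "zero_free p \<le> x \<Longrightarrow> zero_free p \<le> block p x"
  using zeros_found_le[of p "x - p 0"] by (auto simp: block_def zero_free_def)

lemma block_limit: "\<exists>x>n. block p x = zero_free p"
proof -
  obtain s0 where "\<And>s. s \<ge> s0 \<Longrightarrow> {i. i < p 0 \<and> (\<exists>n<s. p (Suc (prod_encode (i, n))) = 0)} =
     {i. i < p 0 \<and> (\<exists>n. p (Suc (prod_encode (i, n))) = 0)}"
    using zeros_found_eventually[of p] by blast
  then have "block p (p 0 + s0 + Suc n) = zero_free p"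
    by (simp add: block_def zero_free_def zeros_found_def)
  then show ?thesis by (intro exI[of _ "p 0 + s0 + Suc n"]) simp
qed

lemma computable_on_zeros_found:
  assumes p: "computable_on D f" and S: "computable_on D S"
  shows "computable_on D (\<lambda>p x. zeros_found (f p) (S p x))"
  unfolding zeros_found_def
  by (intro comp_intros S computable_on_compose[OF p] computable_on_compose[OF S])

lemma computable_on_block: "computable_on D block"
  unfolding block_def by (intro comp_intros computable_on_zeros_found)

lemma solution_exists:
  "({..<zero_free p}, index_rel (block p) \<inter> {..<zero_free p} \<times> {..<zero_free p})
    \<in> sol OG_to_ordinal (code_group, code_le (block p))"
proof -
  have "well_ord ({..<zero_free p}, index_rel (block p) \<inter> {..<zero_free p} \<times> {..<zero_free p})"
    by (intro finite_linear_ord_well_ord linear_ord_restrict[OF linear_ord_index]) simp_all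
  moreover have "ord_iso (group_ord code_group (code_le (block p)))
      (ord_prod (int_pow ({..<zero_free p}, index_rel (block p) \<inter> {..<zero_free p} \<times> {..<zero_free p})) rat_ord)"
    by (rule ord_iso_trans[OF group_ord_code_iso int_pow_index_iso])
      (simp_all add: block_small block_large block_limit)
  ultimately show ?thesis by (simp add: OG_to_ordinal_def ordered_group_code)
qed

text \<open>An arbitrary solution is compared with the one just exhibited through the order type of
  the group. The case \<epsilon> = 0 is compared as a product with one point.\<close>

lemma solution_card:
  assumes "(A, R) \<in> sol OG_to_ordinal (code_group, code_le (block p))"
  shows "finite A \<and> card A = zero_free p"
proof -
  define M where "M = {..<zero_free p}"
  define T where "T = index_rel (block p) \<inter> M \<times> M"
  have MT: "(M, T) \<in> sol OG_to_ordinal (code_group, code_le (block p))"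
    unfolding M_def T_def by (rule solution_exists)
  then have wo: "well_ord (M, T)" "well_ord (A, R)" using assms by (simp_all add: OG_to_ordinal_def)
  have fin: "finite M" "card M = zero_free p" by (simp_all add: M_def)
  have iso: "ord_iso (ord_prod (int_pow (M, T)) rat_ord) (group_ord code_group (code_le (block p)))"
    unfolding M_def T_def
    by (rule ord_iso_sym, rule ord_iso_trans[OF group_ord_code_iso int_pow_index_iso])
      (simp_all add: block_small block_large block_limit)
  consider "ord_iso (group_ord code_group (code_le (block p))) (int_pow (A, R))"
    | "ord_iso (group_ord code_group (code_le (block p))) (ord_prod (int_pow (A, R)) rat_ord)"
    using assms by (auto simp: OG_to_ordinal_def)
  then show ?thesis
  proof cases
    case 1
    have "ord_iso (int_pow (A, R)) (ord_prod (int_pow (A, R)) ({()}, {}))"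
      unfolding int_pow_eq by (rule ord_iso_prod_unit) auto
    from ord_iso_trans[OF iso ord_iso_trans[OF 1 this]]
    show ?thesis
      using card_determined_by_order_type[OF int_pow_prod_rat[OF wo(1)] int_pow_prod_unit[OF wo(2)] _ fin(1)] fin(2)
      by (simp add: rat_ord_def)
  next
    case 2
    from ord_iso_trans[OF iso 2] show ?thesis
      using card_determined_by_order_type[OF int_pow_prod_rat[OF wo(1)] int_pow_prod_rat[OF wo(2)] _ fin(1)] fin(2)
      by (simp add: rat_ord_def)
  qed
qed

text \<open>On \<open>p \<uplus> g\<close>, the left side is the number of sequences. Both summands
  are lower bounds, for the number of sequences with a zero and for the size of the copy, and they
  reach the total only when both are final.\<close>

definition enough :: "baire \<Rightarrow> nat \<Rightarrow> bool" where
  "enough r s \<longleftrightarrow> r 0 \<le> zeros_found (\<lambda>n. r (2 * n)) s + card {n. n < s \<and> r (Suc (2 * (2 * n))) \<noteq> 0}"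

lemma enough_join:
  "enough (p \<uplus> g) s \<longleftrightarrow> p 0 \<le> zeros_found p s + card {n. n < s \<and> n \<in> named_set g}"
proof -
  have "(p \<uplus> g) 0 = p 0" using join_even[of p g 0] by simp
  then show ?thesis by (simp only: enough_def join_even join_odd named_set_def mem_Collect_eq)
qed

text \<open>Different copies may yield different stages. Each of them bounds the search for zeros,
  so the outer functional gets by with the stage and \<open>p\<close>.\<close>

lemma LPO_le_OG: "finite_parallelization LPO \<le>\<^sub>W first_order_part OG_to_ordinal"
proof -
  define E where "E = {r. \<exists>s. enough r s}"
  have "computable_on UNIV (\<lambda>p. group_name (block p))"
    by (intro computable_on_group_name computable_on_block)
  then obtain \<phi> where \<phi>: "\<And>p. computes \<phi> p (group_name (block p))"
    unfolding computable_on_def computes_def by blast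
  have even: "computable_on D (\<lambda>r n. r (2 * n))" for D by (intro comp_intros)
  have "computable_on E (\<lambda>r x. LEAST s. enough r s)"
    by (intro computable_on_Least, unfold enough_def)
      (intro comp_intros computable_on_zeros_found even, auto simp: E_def enough_def)
  then obtain \<psi> where \<psi>: "\<And>r x. r \<in> E \<Longrightarrow> evalt r \<psi> x (LEAST s. enough r s)"
    unfolding computable_on_def by blast
  define \<Phi> where "\<Phi> p n = (if even n then p (n div 2) else if even (n div 2) then tf_code \<phi> else tf_code \<psi>)"
    for p :: baire and n
  \<comment> \<open>\<open>r 1\<close> is the stage returned by the first-order problem,
    \<open>r 0\<close> the length of the list, and the even places of \<open>r\<close> hold
    \<open>p\<close>.\<close>
  define \<Psi> where "\<Psi> r n = (if n = 0 then r 0 else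
    of_bool (\<not> (\<exists>l<r 1. r (2 * Suc (prod_encode (pfst (n - 1), l))) = 0)))" for r :: baire and n
  have \<Phi>: "computable_on UNIV \<Phi>" unfolding \<Phi>_def by (intro comp_intros)
  have \<Psi>: "computable_on UNIV \<Psi>" unfolding \<Psi>_def by (intro comp_intros)
  show ?thesis
  proof (rule weihrauch_leI[OF \<Phi> \<Psi>])
    fix p xs assume "in_rep (finite_parallelization LPO) p = Some xs"
    then have xs: "length xs = p 0" "\<And>i. i < p 0 \<Longrightarrow> xs ! i = (\<lambda>n. p (Suc (prod_encode (i, n))))"
      by (auto simp: finite_parallelization_def LPO_def list_rep_eq_Some baire_rep_def)
    define G where "G = (code_group, code_le (block p))"
    have tf: "tf_rep (\<lambda>n. tf_code c) = Some c" for c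
      using inj_tf_code by (simp add: tf_rep_def)
    have rep: "in_rep (first_order_part OG_to_ordinal) (\<Phi> p) = Some (p, \<phi>, \<psi>)"
      by (simp add: first_order_part_def prod_rep_def baire_rep_def tf \<Phi>_def)
    have og: "in_rep OG_to_ordinal (group_name (block p)) = Some G"
      by (simp add: OG_to_ordinal_def og_rep_group_name G_def)
    have names: "finite (named_set g) \<and> card (named_set g) = zero_free p" if "g \<in> sol_names OG_to_ordinal G" for g
    proof -
      obtain A R where AR: "wo_rep g = Some (A, R)" "(A, R) \<in> sol OG_to_ordinal G"
        using \<open>g \<in> sol_names OG_to_ordinal G\<close> by (auto simp: sol_names_def OG_to_ordinal_def)
      then have "named_set g = A" by (simp add: wo_rep_eq split: if_splits)
      then show ?thesis using solution_card AR(2) unfolding G_def by simp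
    qed
    obtain s0 where s0: "\<And>s. s \<ge> s0 \<Longrightarrow> {i. i < p 0 \<and> (\<exists>n<s. p (Suc (prod_encode (i, n))) = 0)} =
       {i. i < p 0 \<and> (\<exists>n. p (Suc (prod_encode (i, n))) = 0)}"
      using zeros_found_eventually[of p] by blast
    have stops: "\<exists>s. enough (p \<uplus> g) s" if "g \<in> sol_names OG_to_ordinal G" for g
    proof -
      note g = names[OF that]
      obtain u where u: "\<And>n. n \<in> named_set g \<Longrightarrow> n < u"
        using g by (auto simp: finite_nat_set_iff_bounded)
      have "{n. n < max s0 u \<and> n \<in> named_set g} = named_set g" using u by fastforce
      then have "enough (p \<uplus> g) (max s0 u)"
        using g s0[of "max s0 u"] by (simp add: enough_join zeros_found_def zero_free_def)
      then show ?thesis ..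
    qed
    \<comment> \<open>\<open>\<phi>\<close> is single-valued, so \<open>G\<close> is the sole
      instance that the triple can refer to.\<close>
    have inst: "fop_instance OG_to_ordinal (p, \<phi>, \<psi>) x \<longleftrightarrow> x = G" for x
    proof
      assume "fop_instance OG_to_ordinal (p, \<phi>, \<psi>) x"
      then obtain r where "computes \<phi> p r" "in_rep OG_to_ordinal r = Some x"
        by (auto simp: fop_instance_def)
      moreover from this(1) have "r = group_name (block p)"
        using \<phi>[of p] evalt_functional unfolding computes_def by blast
      ultimately show "x = G" using og by simp
    next
      assume x: "x = G"
      have "\<exists>y. evalt (p \<uplus> g) \<psi> 0 y" if "g \<in> sol_names OG_to_ordinal G" for g
        using \<psi>[of "p \<uplus> g" 0] stops[OF that] by (auto simp: E_def)
      moreover have "G \<in> pdom OG_to_ordinal"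
        using solution_exists[of p] by (auto simp: pdom_def G_def)
      ultimately show "fop_instance OG_to_ordinal (p, \<phi>, \<psi>) x"
        using og \<phi>[of p] by (auto simp: fop_instance_def x)
    qed
    \<comment> \<open>An actual name of the known solution: membership in the domain asks for a
      value, not only for convergence on all names.\<close>
    obtain g0 where "wo_rep g0 = Some ({..<zero_free p}, index_rel (block p) \<inter> {..<zero_free p} \<times> {..<zero_free p})"
      using wo_rep_splice[of "{..<zero_free p}" _ 0] solution_exists[of p]
      by (auto simp: OG_to_ordinal_def)
    then have "g0 \<in> sol_names OG_to_ordinal G"
      using solution_exists[of p] by (auto simp: sol_names_def G_def OG_to_ordinal_def)
    moreover from this have "evalt (p \<uplus> g0) \<psi> 0 (LEAST s. enough (p \<uplus> g0) s)"
      using stops by (intro \<psi>) (simp add: E_def)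
    ultimately have "(LEAST s. enough (p \<uplus> g0) s) \<in> sol (first_order_part OG_to_ordinal) (p, \<phi>, \<psi>)"
      unfolding first_order_part_def problem.simps prod.case mem_Collect_eq inst by blast
    then have dom: "(p, \<phi>, \<psi>) \<in> pdom (first_order_part OG_to_ordinal)"
      unfolding pdom_def by blast
    have "\<exists>w. out_rep (finite_parallelization LPO) (\<Psi> (p \<uplus> q)) = Some w \<and> w \<in> sol (finite_parallelization LPO) xs"
      if q: "out_rep (first_order_part OG_to_ordinal) q = Some y"
        "y \<in> sol (first_order_part OG_to_ordinal) (p, \<phi>, \<psi>)" for q y
    proof -
      have q0: "(p \<uplus> q) 1 = y" "(p \<uplus> q) 0 = p 0"
        using q(1) join_odd[of p q 0] join_even[of p q 0] by (simp_all add: first_order_part_def nat_rep_def)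
      obtain g where g: "g \<in> sol_names OG_to_ordinal G" "evalt (p \<uplus> g) \<psi> 0 y"
        using q(2) by (auto simp: first_order_part_def inst)
      have "y = (LEAST s. enough (p \<uplus> g) s)"
        using evalt_functional[OF g(2)] \<psi> stops[OF g(1)] by (auto simp: E_def)
      then have "enough (p \<uplus> g) y" using LeastI_ex[OF stops[OF g(1)]] by simp
      moreover have "card {n. n < y \<and> n \<in> named_set g} \<le> zero_free p"
        using names[OF g(1)] card_mono[of "named_set g" "{n. n < y \<and> n \<in> named_set g}"] by auto
      ultimately have le: "p 0 \<le> zeros_found p y + zero_free p" by (simp add: enough_join)
      \<comment> \<open>The count cannot exceed \<open>p 0\<close>, so the truncated subtraction in
        \<open>zero_free\<close> is exact, and all sequences with a zero have been recognized by
        stage \<open>y\<close>.\<close>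
      have "card {i. i < p 0 \<and> (\<exists>n. p (Suc (prod_encode (i, n))) = 0)} \<le> card {..<p 0}"
        by (rule card_mono) auto
      then have "card {i. i < p 0 \<and> (\<exists>n. p (Suc (prod_encode (i, n))) = 0)} \<le> zeros_found p y"
        using le by (simp add: zero_free_def)
      then have eq: "{i. i < p 0 \<and> (\<exists>n<y. p (Suc (prod_encode (i, n))) = 0)} =
          {i. i < p 0 \<and> (\<exists>n. p (Suc (prod_encode (i, n))) = 0)}"
        unfolding zeros_found_def by (intro card_seteq) auto
      define ys where "ys = map (\<lambda>i. of_bool (\<not> (\<exists>l<y. p (Suc (prod_encode (i, l))) = 0)) :: nat) [0..<p 0]"
      have "out_rep (finite_parallelization LPO) (\<Psi> (p \<uplus> q)) = Some ys"
        unfolding \<Psi>_def q0 join_even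
        by (simp add: finite_parallelization_def LPO_def list_rep_eq_Some nat_rep_def ys_def)
      moreover have "(\<exists>l<y. p (Suc (prod_encode (i, l))) = 0) \<longleftrightarrow> (\<exists>l. p (Suc (prod_encode (i, l))) = 0)"
        if "i < p 0" for i
        using eq that by blast
      then have "ys \<in> sol (finite_parallelization LPO) xs"
        using xs by (auto simp: finite_parallelization_def LPO_def list_all2_conv_all_nth ys_def)
      ultimately show ?thesis by blast
    qed
    then show "\<exists>z. in_rep (first_order_part OG_to_ordinal) (\<Phi> p) = Some z \<and>
      z \<in> pdom (first_order_part OG_to_ordinal) \<and>
      (\<forall>q y. out_rep (first_order_part OG_to_ordinal) q = Some y \<and> y \<in> sol (first_order_part OG_to_ordinal) z \<longrightarrow>
        p \<uplus> q \<in> UNIV \<and> (\<exists>w. out_rep (finite_parallelization LPO) (\<Psi> (p \<uplus> q)) = Some w \<and>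
          w \<in> sol (finite_parallelization LPO) xs))"
      using rep dom by blast
  qed simp
qed

theorem proposition2p23:
  shows "first_order_part OG_to_ordinal \<equiv>\<^sub>W finite_parallelization LPO"
  using OG_le_LPO LPO_le_OG by (simp add: weihrauch_equiv_def)

end
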